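(* Let $\epsilon\in\{1,-1\}$, $1\le k<2n$, and let $(X_1,T_1)\in\mathbb{C}^{n\times k}\times\mathbb{C}^{k\times k}$ with $T_1$ nonsingular, $\begin{bmatrix}X_1\\-X_1T_1^{-1}\end{bmatrix}$ of full column rank, and $T_1$ similar to $T_1^{-\star}$. Then IEP-QP$(k)$-A with data $(X_1,T_1)$ has a regular solution $Q(\lambda)$ if and only if there exist a nonsingular $S_1\in\mathbb{S}_{T_1}$, a matrix $\Psi\in\mathbb{C}^{n\times(2n-k)}$ and a matrix $\widehat T_2\in\mathbb{C}^{(2n-k)\times(2n-k)}$ such that, with $Y$ and $\Delta$ the $Y$ and $\Delta$ factors of $X_1S_1X_1^{\star}$ and with the nonsingular matrix $\Omega\in\mathbb{C}^{(2n-k)\times(2n-k)}$ given by - $\Omega=\Delta_{n-p,n-q}$ if $\star=*$, where $p,q$ (necessarily $p,q\le n$) are the positive and negative inertia indices of $\sqrt{-\epsilon}\,S_1$, - $\Omega=\Delta_{2n-k}$ if $\star=\top$, the following hold: $\widehat T_2\Omega\widehat T_2^{\star}=\Omega$; the spectra of $T_1$ and $\widehat T_2$ are disjoint; $$\Psi\,\Omega\,\Psi^{\star}=-\Delta;$$ and $X_1T_1^{-1}S_1X_1^{\star}+Y\Psi\widehat T_2^{-1}\Omega\Psi^{\star}Y^{\star}$ is nonsingular. In such case, the coefficient matrices of $Q(\lambda)=\lambda^2A_1^{\star}+\lambda A_0+\epsilon A_1$ are given by $$A_1=\epsilon\,(XT^{-1}SX^{\star})^{-1},\qquad A_0=-A_1XT^{-2}SX^{\star}A_1,$$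 where $X=[X_1\ \ Y\Psi]$, $T=\mathrm{diag}(T_1,\widehat T_2)$ and $S=\mathrm{diag}(S_1,\Omega)$.
   Context: The symbol $\star$ denotes one fixed operation, either the transpose $\top$ or the conjugate transpose $*$ (for complex matrices); $M^{-\star}=(M^{-1})^{\star}$. $\imath$ is the imaginary unit, and $\sqrt{-\epsilon}=\imath$ if $\epsilon=1$, $\sqrt{-\epsilon}=1$ if $\epsilon=-1$. A $\star$-(anti)-palindromic system is $Q(\lambda)=\lambda^2A_1^{\star}+\lambda A_0+\epsilon A_1$ with $A_1,A_0\in\mathbb{C}^{n\times n}$, $A_0^{\star}=\epsilon A_0$; it is regular if $A_1$ is nonsingular. $\mathbb{S}_{T_1}=\{S\in\mathbb{C}^{k\times k}: S^{\star}=-\epsilon S,\ S=T_1ST_1^{\star}\}$. IEP-QP$(k)$-A: given $(X_1,T_1)$ as in the claim, construct a $\star$-(anti)-palindromic system $Q(\lambda)$ such that $A_1^{\star}X_1T_1^2+A_0X_1T_1+\epsilon A_1X_1=0$ and such that the remaining $2n-k$ eigenvalues of $Q(\lambda)$ (those left, counting algebraic multiplicities, after removing the $k$ eigenvalues of $T_1$ from the $2n$ eigenvalues of $Q$) do not intersect the set of eigenvalues of $T_1$. $\star$-factorization: every $B\in\mathbb{C}^{m\times m}$ with $B^{\star}=-\epsilon B$ and $\mathrm{rank}(B)=t$ can be written as $B=Y\Delta Y^{\star}$ with $Y=ZPD$ nonsingular ($Z$ unitary, $P$ a permutation matrix, $D$ a positive diagonal matrix) and $\Delta$ the $m\times m$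 matrix $\Delta=\Delta_{p,q}$ if $\star=*$ (with $p,q$ the positive and negative inertia indices of the Hermitian matrix $\sqrt{-\epsilon}B$, $p+q=t$), $\Delta=\Delta_t$ if $\star=\top$. Here $$\Delta_{p,q}=\begin{cases}\mathrm{diag}(\imath I_q,-\imath I_p,0)&\epsilon=1,\\ \mathrm{diag}(I_p,-I_q,0)&\epsilon=-1,\end{cases}\qquad \Delta_t=\begin{cases}\mathrm{diag}\left(\begin{bmatrix}0&I_{t/2}\\-I_{t/2}&0\end{bmatrix},0\right)&\epsilon=1,\\ \mathrm{diag}(I_t,0)&\epsilon=-1,\end{cases}$$ with the zero block of whatever size (possibly empty) makes the matrix of the required order. ($t$ is even when $\star=\top$, $\epsilon=1$.) This is called the $\star$-factorization of $B$, and $Y$, $\Delta$ are called the $Y$ and $\Delta$ factors of $B$. In $\Omega$ the zero block is empty. *)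

theory Defs
  imports
    "HOL-Combinatorics.Permutations"
    "Jordan_Normal_Form.Gauss_Jordan_Elimination"
    "Jordan_Normal_Form.Schur_Decomposition"
    "Jordan_Normal_Form.Spectral_Radius"
    "Jordan_Normal_Form.DL_Rank"
begin

datatype star = Transpose | ConjTranspose

fun star_mat :: "star \<Rightarrow> complex mat \<Rightarrow> complex mat" where
  "star_mat Transpose A = transpose_mat A"
| "star_mat ConjTranspose A = mat_adjoint A"

text \<open>Total wrapper of the library's partial inverse; its value is unspecified on singular matrices.\<close>
definition mat_inv :: "complex mat \<Rightarrow> complex mat" where
  "mat_inv A = the (mat_inverse A)"

definition append_cols :: "complex mat \<Rightarrow> complex mat \<Rightarrow> complex mat" where
  "append_cols A B = four_block_mat A B (0\<^sub>m 0 (dim_col A)) (0\<^sub>m 0 (dim_col B))"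

definition palindromic_system :: "complex \<Rightarrow> star \<Rightarrow> nat \<Rightarrow> complex mat \<Rightarrow> complex mat \<Rightarrow> bool" where
  "palindromic_system eps st n A1 A0 \<longleftrightarrow>
     A1 \<in> carrier_mat n n \<and> A0 \<in> carrier_mat n n \<and> star_mat st A0 = eps \<cdot>\<^sub>m A0"

text \<open>The quadratic \<open>\<lambda>\<^sup>2 A1\<^sup>\<star> + \<lambda> A0 + \<epsilon> A1\<close> as a matrix over the polynomial ring.\<close>
definition quad_poly_mat :: "complex \<Rightarrow> star \<Rightarrow> nat \<Rightarrow> complex mat \<Rightarrow> complex mat \<Rightarrow> complex poly mat" where
  "quad_poly_mat eps st n A1 A0 =
     mat n n (\<lambda>(i,j). [: eps * A1 $$ (i,j), A0 $$ (i,j), star_mat st A1 $$ (i,j) :])"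

text \<open>
  Finite eigenvalues with algebraic multiplicities. If \<open>A1\<close> is nonsingular, then the determinant
  has degree \<open>2 n\<close> and these are all the \<open>2 n\<close> eigenvalues.
\<close>
definition quad_eigenvalues :: "complex \<Rightarrow> star \<Rightarrow> nat \<Rightarrow> complex mat \<Rightarrow> complex mat \<Rightarrow> complex multiset" where
  "quad_eigenvalues eps st n A1 A0 = proots (det (quad_poly_mat eps st n A1 A0))"

definition mat_eigenvalues :: "complex mat \<Rightarrow> complex multiset" where
  "mat_eigenvalues A = proots (char_poly A)"

text \<open>
  The third conjunct uses multiset difference: the eigenvalues of \<open>T1\<close> are removed with their
  multiplicities. (When the first two conjuncts hold, \<open>A1\<close> and \<open>T1\<close> are nonsingular and
  \<open>(X1, T1)\<close> satisfies the full column rank condition, they do form a sub-multiset of the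
  eigenvalues of the system.)
\<close>
definition iep_solution ::
  "complex \<Rightarrow> star \<Rightarrow> nat \<Rightarrow> complex mat \<Rightarrow> complex mat \<Rightarrow> complex mat \<Rightarrow> complex mat \<Rightarrow> bool" where
  "iep_solution eps st n X1 T1 A1 A0 \<longleftrightarrow>
     palindromic_system eps st n A1 A0 \<and>
     star_mat st A1 * X1 * T1 ^\<^sub>m 2 + A0 * X1 * T1 + eps \<cdot>\<^sub>m (A1 * X1) = 0\<^sub>m n (dim_col X1) \<and>
     set_mset (quad_eigenvalues eps st n A1 A0 - mat_eigenvalues T1) \<inter> spectrum T1 = {}"

definition regular_iep_solution ::
  "complex \<Rightarrow> star \<Rightarrow> nat \<Rightarrow> complex mat \<Rightarrow> complex mat \<Rightarrow> complex mat \<Rightarrow> complex mat \<Rightarrow> bool" where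
  "regular_iep_solution eps st n X1 T1 A1 A0 \<longleftrightarrow>
     iep_solution eps st n X1 T1 A1 A0 \<and> invertible_mat A1"

text \<open>The set \<open>\<SS>\<^bsub>T\<^esub>\<close> for a \<open>k \<times> k\<close> matrix \<open>T\<close>.\<close>
definition S_set :: "complex \<Rightarrow> star \<Rightarrow> nat \<Rightarrow> complex mat \<Rightarrow> complex mat set" where
  "S_set eps st k T =
     {S \<in> carrier_mat k k. star_mat st S = (- eps) \<cdot>\<^sub>m S \<and> S = T * S * star_mat st T}"

text \<open>Inertia indices of a Hermitian matrix (whose eigenvalues are real).\<close>
definition pos_inertia :: "complex mat \<Rightarrow> nat" where
  "pos_inertia H = size (filter_mset (\<lambda>z. 0 < Re z) (mat_eigenvalues H))"

definition neg_inertia :: "complex mat \<Rightarrow> nat" where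
  "neg_inertia H = size (filter_mset (\<lambda>z. Re z < 0) (mat_eigenvalues H))"

text \<open>
  \<open>\<Delta>\<^bsub>p,q\<^esub>\<close> and \<open>\<Delta>\<^bsub>t\<^esub>\<close>, padded with zeros to order \<open>m\<close> (used only with \<open>p + q \<le> m\<close>, \<open>t \<le> m\<close>,
  and \<open>t\<close> even if \<open>\<epsilon> = 1\<close>).
\<close>
definition Delta_pq :: "complex \<Rightarrow> nat \<Rightarrow> nat \<Rightarrow> nat \<Rightarrow> complex mat" where
  "Delta_pq eps m p q =
     (if eps = 1
      then diag_block_mat [\<i> \<cdot>\<^sub>m 1\<^sub>m q, (- \<i>) \<cdot>\<^sub>m 1\<^sub>m p, 0\<^sub>m (m - (p + q)) (m - (p + q))]
      else diag_block_mat [1\<^sub>m p, - 1\<^sub>m q, 0\<^sub>m (m - (p + q)) (m - (p + q))])"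

definition Delta_t :: "complex \<Rightarrow> nat \<Rightarrow> nat \<Rightarrow> complex mat" where
  "Delta_t eps m t =
     (if eps = 1
      then diag_block_mat
        [four_block_mat (0\<^sub>m (t div 2) (t div 2)) (1\<^sub>m (t div 2))
                        (- 1\<^sub>m (t div 2)) (0\<^sub>m (t div 2) (t div 2)),
         0\<^sub>m (m - t) (m - t)]
      else diag_block_mat [1\<^sub>m t, 0\<^sub>m (m - t) (m - t)])"

text \<open>
  The \<open>\<Delta>\<close> factor of an \<open>m \<times> m\<close> matrix. For \<open>\<epsilon> \<in> {1, -1}\<close>, \<open>csqrt (- \<epsilon>)\<close> is the imaginary unit
  if \<open>\<epsilon> = 1\<close> and \<open>1\<close> if \<open>\<epsilon> = -1\<close>.
\<close>
fun Delta_factor :: "complex \<Rightarrow> star \<Rightarrow> nat \<Rightarrow> complex mat \<Rightarrow> complex mat" where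
  "Delta_factor eps ConjTranspose m B =
     Delta_pq eps m (pos_inertia (csqrt (- eps) \<cdot>\<^sub>m B)) (neg_inertia (csqrt (- eps) \<cdot>\<^sub>m B))"
| "Delta_factor eps Transpose m B = Delta_t eps m (vec_space.rank m B)"

definition perm_mat :: "nat \<Rightarrow> (nat \<Rightarrow> nat) \<Rightarrow> complex mat" where
  "perm_mat m \<pi> = mat m m (\<lambda>(i,j). if i = \<pi> j then 1 else 0)"

text \<open>The \<open>Y\<close> factor is not uniquely determined by \<open>B\<close>, hence a relation.\<close>
definition is_Y_factor :: "complex \<Rightarrow> star \<Rightarrow> nat \<Rightarrow> complex mat \<Rightarrow> complex mat \<Rightarrow> bool" where
  "is_Y_factor eps st m B Y \<longleftrightarrow>
     (\<exists>Z \<pi> d. Z \<in> carrier_mat m m \<and> mat_adjoint Z * Z = 1\<^sub>m m \<and>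
        \<pi> permutes {..<m} \<and> (\<forall>i<m. 0 < d i) \<and>
        Y = Z * perm_mat m \<pi> * mat_diag m (\<lambda>i. complex_of_real (d i))) \<and>
     B = Y * Delta_factor eps st m B * star_mat st Y"

text \<open>
  \<open>Omega_dims\<close> says that \<open>\<Omega>\<close> is defined as a matrix of order \<open>2 n - k\<close>; the truncated
  subtractions \<open>n - p\<close>, \<open>n - q\<close> in \<open>Omega\<close> are then exact.
\<close>
fun Omega_dims :: "complex \<Rightarrow> star \<Rightarrow> nat \<Rightarrow> complex mat \<Rightarrow> bool" where
  "Omega_dims eps ConjTranspose n S1 \<longleftrightarrow>
     pos_inertia (csqrt (- eps) \<cdot>\<^sub>m S1) \<le> n \<and> neg_inertia (csqrt (- eps) \<cdot>\<^sub>m S1) \<le> n"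
| "Omega_dims eps Transpose n S1 \<longleftrightarrow> True"

fun Omega :: "complex \<Rightarrow> star \<Rightarrow> nat \<Rightarrow> nat \<Rightarrow> complex mat \<Rightarrow> complex mat" where
  "Omega eps ConjTranspose n k S1 =
     Delta_pq eps (2 * n - k) (n - pos_inertia (csqrt (- eps) \<cdot>\<^sub>m S1))
                              (n - neg_inertia (csqrt (- eps) \<cdot>\<^sub>m S1))"
| "Omega eps Transpose n k S1 = Delta_t eps (2 * n - k) (2 * n - k)"

text \<open>The conditions on \<open>(S1, \<Psi>, T2)\<close>, for a given \<open>Y\<close> factor \<open>Y\<close> of \<open>X1 S1 X1\<^sup>\<star>\<close>.\<close>
definition iep_parameters ::
  "complex \<Rightarrow> star \<Rightarrow> nat \<Rightarrow> nat \<Rightarrow> complex mat \<Rightarrow> complex mat \<Rightarrow>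
   complex mat \<Rightarrow> complex mat \<Rightarrow> complex mat \<Rightarrow> complex mat \<Rightarrow> bool" where
  "iep_parameters eps st n k X1 T1 S1 Y Psi T2 \<longleftrightarrow>
     (let B = X1 * S1 * star_mat st X1; \<Omega> = Omega eps st n k S1 in
      S1 \<in> S_set eps st k T1 \<and> invertible_mat S1 \<and>
      is_Y_factor eps st n B Y \<and>
      Psi \<in> carrier_mat n (2 * n - k) \<and> T2 \<in> carrier_mat (2 * n - k) (2 * n - k) \<and>
      Omega_dims eps st n S1 \<and>
      T2 * \<Omega> * star_mat st T2 = \<Omega> \<and>
      spectrum T1 \<inter> spectrum T2 = {} \<and>
      Psi * \<Omega> * star_mat st Psi = - Delta_factor eps st n B \<and>
      invertible_mat (X1 * mat_inv T1 * S1 * star_mat st X1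
        + Y * Psi * mat_inv T2 * \<Omega> * star_mat st Psi * star_mat st Y))"

text \<open>The coefficients obtained from \<open>X\<close>, \<open>T\<close> and \<open>S\<close>.\<close>
definition coeff_A1 :: "complex \<Rightarrow> star \<Rightarrow> complex mat \<Rightarrow> complex mat \<Rightarrow> complex mat \<Rightarrow> complex mat" where
  "coeff_A1 eps st X T S = eps \<cdot>\<^sub>m mat_inv (X * mat_inv T * S * star_mat st X)"

definition coeff_A0 :: "complex \<Rightarrow> star \<Rightarrow> complex mat \<Rightarrow> complex mat \<Rightarrow> complex mat \<Rightarrow> complex mat" where
  "coeff_A0 eps st X T S =
     - (coeff_A1 eps st X T S * X * mat_inv T ^\<^sub>m 2 * S * star_mat st X * coeff_A1 eps st X T S)"

end

theory Submission
  imports Defs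
begin

text \<open>
  A regular system amounts to a matrix that preserves a form. The companion matrix \<open>L\<close> of \<open>Q\<close>
  (\<open>pal_companion\<close>) and the matrix \<open>J\<close> (\<open>pal_form\<close>), which depends on \<open>A1\<close> alone and satisfies
  \<open>J\<^sup>\<star> = - \<epsilon> J\<close>, are linked by \<open>L J L\<^sup>\<star> = J\<close> (\<open>L_J_star_L\<close>), and this identity expresses the
  symmetry of the coefficients. Let \<open>(X, T)\<close> be a pair with \<open>2 n\<close> columns that satisfies
  \<open>A1\<^sup>\<star> X T\<^sup>2 + A0 X T + \<epsilon> A1 X = 0\<close>, with \<open>V = [X; - X T\<^sup>-\<^sup>1]\<close> nonsingular. In the basis \<open>V\<close> the
  matrix \<open>L\<close> becomes \<open>T\<close> and \<open>J\<close> becomes \<open>S = V\<^sup>-\<^sup>1 J V\<^sup>-\<^sup>\<star>\<close>, so that \<open>S\<^sup>\<star> = - \<epsilon> S\<close> and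
  \<open>T S T\<^sup>\<star> = S\<close>. Comparing blocks yields \<open>X S X\<^sup>\<star> = 0\<close> and the formulas for \<open>A1\<close> and \<open>A0\<close>
  (\<open>triple_of_invariant_basis\<close>). Conversely, a triple \<open>(X, T, S)\<close>
  with these properties and with \<open>X T\<^sup>-\<^sup>1 S X\<^sup>\<star>\<close> nonsingular defines a system through the same formulas,
  and \<open>T\<close> carries its eigenvalues (locale \<open>palindromic_triple\<close>). Hence block diagonal data
  \<open>T = diag (T1, T2)\<close>, \<open>S = diag (S1, \<Omega>)\<close> that satisfy the conditions of the theorem give a solution
  (\<open>solution_of_parameters\<close>).

  For the other direction (\<open>parameters_of_solution\<close>), the prescribed pair spans an \<open>L\<close>-invariant
  subspace, and the remaining eigenvalues avoid the spectrum of \<open>T1\<close>. Solvability of a Sylvester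
  equation gives an invariant complement (\<open>decouple\<close>), that is \<open>T = diag (T1, F)\<close>. As \<open>T1\<close> is similar to
  \<open>T1\<^sup>-\<^sup>\<star>\<close>, the spectra of \<open>T1\<^sup>-\<^sup>1\<close> and \<open>F\<^sup>\<star>\<close> are disjoint too, so the off-diagonal blocks of \<open>S\<close> solve a
  homogeneous Sylvester equation and vanish: \<open>S = diag (S1, S2)\<close>. The star-factorization
  \<open>S2 = W \<Omega> W\<^sup>\<star>\<close> and the change of basis by \<open>W\<close> turn the second block into \<open>\<Omega>\<close>, and the condition
  \<open>X S X\<^sup>\<star> = 0\<close> becomes \<open>\<Psi> \<Omega> \<Psi>\<^sup>\<star> = - \<Delta>\<close> for \<open>\<Psi> = Y\<^sup>-\<^sup>1 X2 W\<close>.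

  That \<open>S2\<close> has the canonical form \<open>\<Omega>\<close> is a matter of rank for the transpose. For the conjugate
  transpose it is a matter of inertia: \<open>X S X\<^sup>\<star> = 0\<close> exhibits an \<open>n\<close>-dimensional isotropic subspace of a
  nondegenerate Hermitian form on a space of dimension \<open>2 n\<close>, so both inertia indices of the form are
  \<open>n\<close>, and those of \<open>S2\<close> are complementary to those of \<open>S1\<close> (\<open>isotropic_inertia_complement\<close>).

  The star-factorization (\<open>star_factorization\<close>) comes from unitary congruence: the spectral theorem for
  Hermitian matrices, the Takagi factorization of symmetric ones and the Youla decomposition of
  skew-symmetric ones. All three are proved by splitting off one- or two-dimensional subspaces
  (\<open>deflation\<close>); a permutation and a positive scaling then produce \<open>\<Delta>\<close>.
\<close>

section \<open>Matrix algebra with dimension side conditions\<close>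

text \<open>
  The ring laws with side conditions that are equations between dimensions. All variables of such a
  side condition occur in the equation itself, so the laws work as rewrite rules; \<open>matalg\<close> brings
  expressions into a normal form with right-nested products.
\<close>
lemma mult_assoc_dim:
  fixes A B C :: "'a :: semiring_0 mat"
  assumes "dim_col A = dim_row B" "dim_col B = dim_row C"
  shows "A * B * C = A * (B * C)"
  by (rule assoc_mult_mat) (use assms in auto)

lemma add_mult_dim:
  fixes A B C :: "'a :: semiring_0 mat"
  assumes "dim_row A = dim_row B" "dim_col A = dim_col B" "dim_col B = dim_row C"
  shows "(A + B) * C = A * C + B * C"
  by (rule add_mult_distrib_mat) (use assms in auto)

lemma mult_add_dim:
  fixes A B C :: "'a :: semiring_0 mat"
  assumes "dim_col A = dim_row B" "dim_row B = dim_row C" "dim_col B = dim_col C"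
  shows "A * (B + C) = A * B + A * C"
  by (rule mult_add_distrib_mat) (use assms in auto)

lemma smult_mult_dim:
  fixes A B :: "'a :: comm_semiring_0 mat"
  assumes "dim_col A = dim_row B"
  shows "(c \<cdot>\<^sub>m A) * B = c \<cdot>\<^sub>m (A * B)"
  by (rule mult_smult_assoc_mat) (use assms in auto)

lemma mult_smult_dim:
  fixes A B :: "'a :: comm_semiring_0 mat"
  assumes "dim_col A = dim_row B"
  shows "A * (c \<cdot>\<^sub>m B) = c \<cdot>\<^sub>m (A * B)"
  by (rule mult_smult_distrib) (use assms in auto)

lemma uminus_mult_dim:
  fixes A B :: "'a :: comm_ring_1 mat"
  assumes "dim_col A = dim_row B"
  shows "(- A) * B = - (A * B)"
  by (rule uminus_mult_left_mat) (use assms in auto)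

lemma mult_uminus_dim:
  fixes A B :: "'a :: comm_ring_1 mat"
  assumes "dim_col A = dim_row B"
  shows "A * (- B) = - (A * B)"
  by (rule uminus_mult_right_mat) (use assms in auto)

lemma smult_add_dim:
  fixes A B :: "'a :: semiring mat"
  assumes "dim_row A = dim_row B" "dim_col A = dim_col B"
  shows "c \<cdot>\<^sub>m (A + B) = c \<cdot>\<^sub>m A + c \<cdot>\<^sub>m B"
  by (rule add_smult_distrib_left_mat) (use assms in auto)

lemma smult_uminus: "c \<cdot>\<^sub>m (- A) = - (c \<cdot>\<^sub>m (A :: 'a :: comm_ring_1 mat))"
  by (rule eq_matI) auto

lemma one_mult_dim: "dim_row A = n \<Longrightarrow> 1\<^sub>m n * (A :: 'a :: semiring_1 mat) = A"
  by auto

lemma mult_one_dim: "dim_col A = n \<Longrightarrow> (A :: 'a :: semiring_1 mat) * 1\<^sub>m n = A"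
  by auto

lemma zero_mult_dim: "dim_row A = m \<Longrightarrow> 0\<^sub>m n m * (A :: 'a :: semiring_0 mat) = 0\<^sub>m n (dim_col A)"
  by auto

lemma mult_zero_dim: "dim_col A = n \<Longrightarrow> (A :: 'a :: semiring_0 mat) * 0\<^sub>m n m = 0\<^sub>m (dim_row A) m"
  by auto

lemma add_zero_dim: "dim_row A = n \<Longrightarrow> dim_col A = m \<Longrightarrow> (A :: 'a :: monoid_add mat) + 0\<^sub>m n m = A"
  by auto

lemma zero_add_dim: "dim_row A = n \<Longrightarrow> dim_col A = m \<Longrightarrow> 0\<^sub>m n m + (A :: 'a :: monoid_add mat) = A"
  by auto

lemma smult_zero_mat: "c \<cdot>\<^sub>m 0\<^sub>m n m = (0\<^sub>m n m :: 'a :: mult_zero mat)"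
  by auto

lemma add_uminus_dim: "dim_row A = n \<Longrightarrow> dim_col A = m \<Longrightarrow> (A :: 'a :: group_add mat) + (- A) = 0\<^sub>m n m"
  by (rule eq_matI) auto

lemma uminus_add_dim: "dim_row A = n \<Longrightarrow> dim_col A = m \<Longrightarrow> (- A) + (A :: 'a :: group_add mat) = 0\<^sub>m n m"
  by (rule eq_matI) auto

lemma smult_smult_assoc: "c \<cdot>\<^sub>m (d \<cdot>\<^sub>m A) = (c * d) \<cdot>\<^sub>m (A :: 'a :: semigroup_mult mat)"
  by (rule eq_matI) (auto simp: mult.assoc)

lemma one_smult_mat: "1 \<cdot>\<^sub>m A = (A :: 'a :: monoid_mult mat)"
  by (rule eq_matI) auto

lemma minus_one_smult_mat: "(- 1) \<cdot>\<^sub>m A = - (A :: 'a :: comm_ring_1 mat)"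
  by (rule eq_matI) auto

lemma uminus_smult: "(- c) \<cdot>\<^sub>m A = - (c \<cdot>\<^sub>m (A :: 'a :: comm_ring_1 mat))"
  by (rule eq_matI) auto

lemma uminus_zero_mat: "- 0\<^sub>m n m = (0\<^sub>m n m :: 'a :: group_add mat)"
  by (rule eq_matI) auto

lemma add_assoc_dim:
  fixes A B C :: "'a :: semigroup_add mat"
  assumes "dim_row A = dim_row B" "dim_col A = dim_col B" "dim_row B = dim_row C" "dim_col B = dim_col C"
  shows "A + B + C = A + (B + C)"
  by (rule eq_matI) (use assms in \<open>auto simp: add.assoc\<close>)

lemma add_uminus_eq_zeroD:
  fixes A B :: "'a :: ab_group_add mat"
  assumes "A + (- B) = 0\<^sub>m n m" "dim_row A = n" "dim_row B = n" "dim_col A = m" "dim_col B = m"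
  shows "A = B"
proof (rule eq_matI)
  fix i j assume ij: "i < dim_row B" "j < dim_col B"
  have "(A + (- B)) $$ (i, j) = 0" using ij assms(2-) unfolding assms(1) by simp
  then show "A $$ (i, j) = B $$ (i, j)" using ij assms(2-) by simp
qed (use assms in auto)

lemma dim_mat_diag [simp]: "dim_row (mat_diag m f) = m" "dim_col (mat_diag m f) = m"
  by (auto simp: mat_diag_def)

text \<open>
  Cancels a pair of inverse factors inside a right-nested product.
\<close>
lemma mult_cancel_left_dim:
  fixes A B Z :: "'a :: semiring_1 mat"
  assumes "A * B = 1\<^sub>m m" "dim_col A = dim_row B" "dim_col B = dim_row Z" 
  shows "A * (B * Z) = Z"
proof -
  have "m = dim_row A" "m = dim_col B" using arg_cong[OF assms(1), of dim_row] arg_cong[OF assms(1), of dim_col] by auto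
  have "A * (B * Z) = (A * B) * Z" using assms by (intro mult_assoc_dim[symmetric])
  also have "\<dots> = Z" using assms \<open>m = dim_col B\<close> by (simp)
  finally show ?thesis .
qed

lemmas matalg =
  mult_assoc_dim add_mult_dim mult_add_dim smult_mult_dim mult_smult_dim uminus_mult_dim
  mult_uminus_dim smult_add_dim smult_uminus one_mult_dim mult_one_dim zero_mult_dim mult_zero_dim
  add_zero_dim zero_add_dim smult_zero_mat smult_smult_assoc one_smult_mat
  uminus_smult uminus_zero_mat

section \<open>The star operation\<close>

definition star_scalar :: "star \<Rightarrow> complex \<Rightarrow> complex" where
  "star_scalar st c = (if st = Transpose then c else cnj c)"

lemma star_scalar_simps [simp]:
  "star_scalar st (star_scalar st c) = c"
  "star_scalar st (c * d) = star_scalar st c * star_scalar st d"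
  "star_scalar st (c + d) = star_scalar st c + star_scalar st d"
  "star_scalar st (c - d) = star_scalar st c - star_scalar st d"
  "star_scalar st (- c) = - star_scalar st c"
  "star_scalar st 0 = 0"
  "star_scalar st 1 = 1"
  "star_scalar st (of_real r) = of_real r"
  by (auto simp: star_scalar_def)

lemma star_scalar_inject [simp]: "star_scalar st c = star_scalar st d \<longleftrightarrow> c = d"
  by (auto simp: star_scalar_def)

lemma star_scalar_sum: "star_scalar st (sum f A) = (\<Sum>x\<in>A. star_scalar st (f x))"
  by (auto simp: star_scalar_def)

lemma dim_mat_adjoint [simp]:
  "dim_row (mat_adjoint A) = dim_col A" "dim_col (mat_adjoint A) = dim_row A"
  by (auto simp: mat_adjoint_def)

lemma dim_star_mat [simp]:
  "dim_row (star_mat st A) = dim_col A" "dim_col (star_mat st A) = dim_row A"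
  by (cases st; simp)+

lemma star_mat_carrier: "A \<in> carrier_mat n m \<Longrightarrow> star_mat st A \<in> carrier_mat m n"
  by (intro carrier_matI) auto

lemma index_mat_adjoint [simp]:
  "i < dim_col A \<Longrightarrow> j < dim_row A \<Longrightarrow> mat_adjoint A $$ (i, j) = cnj (A $$ (j, i))"
  by (auto simp: mat_adjoint_def mat_of_rows_index)

lemma index_star_mat [simp]:
  "i < dim_col A \<Longrightarrow> j < dim_row A \<Longrightarrow> star_mat st A $$ (i, j) = star_scalar st (A $$ (j, i))"
  by (cases st) (auto simp: star_scalar_def)

lemma star_mat_mult:
  "dim_col A = dim_row B \<Longrightarrow> star_mat st (A * B) = star_mat st B * star_mat st A"
  by (rule eq_matI) (auto simp: scalar_prod_def star_scalar_sum mult.commute)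

lemma star_mat_add:
  "dim_row A = dim_row B \<Longrightarrow> dim_col A = dim_col B \<Longrightarrow>
   star_mat st (A + B) = star_mat st A + star_mat st B"
  by (rule eq_matI) auto

lemma star_mat_simps [simp]:
  "star_mat st (star_mat st A) = A"
  "star_mat st (1\<^sub>m n) = 1\<^sub>m n"
  "star_mat st (0\<^sub>m n m) = 0\<^sub>m m n"
  by (rule eq_matI; auto)+

lemma star_mat_smult: "star_mat st (c \<cdot>\<^sub>m A) = star_scalar st c \<cdot>\<^sub>m star_mat st A"
  by (rule eq_matI) auto

lemma star_mat_uminus: "star_mat st (- A) = - star_mat st A"
  by (rule eq_matI) auto

lemma star_mat_four_block:
  assumes "dim_row B = dim_row A" "dim_col C = dim_col A" "dim_row C = dim_row D" "dim_col B = dim_col D"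
  shows "star_mat st (four_block_mat A B C D) =
    four_block_mat (star_mat st A) (star_mat st C) (star_mat st B) (star_mat st D)"
  by (rule eq_matI) (use assms in auto)

lemmas starmat = star_mat_mult star_mat_add star_mat_smult star_mat_uminus star_mat_four_block

section \<open>Inverses\<close>

lemma invertible_mat_iff:
  fixes A :: "'a :: field mat"
  assumes A: "A \<in> carrier_mat n n"
  shows "invertible_mat A \<longleftrightarrow> (\<exists>B \<in> carrier_mat n n. A * B = 1\<^sub>m n \<and> B * A = 1\<^sub>m n)"
proof
  assume "invertible_mat A"
  then obtain B where B: "A * B = 1\<^sub>m n" "B * A = 1\<^sub>m (dim_row B)"
    using A unfolding invertible_mat_def inverts_mat_def by auto
  have "dim_col B = n" using arg_cong[OF B(1), of dim_col] by simp
  moreover have "dim_row B = n" using arg_cong[OF B(2), of dim_col] A by simp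
  ultimately show "\<exists>B \<in> carrier_mat n n. A * B = 1\<^sub>m n \<and> B * A = 1\<^sub>m n"
    using B by (auto intro!: bexI[of _ B] carrier_matI)
next
  assume "\<exists>B \<in> carrier_mat n n. A * B = 1\<^sub>m n \<and> B * A = 1\<^sub>m n"
  then show "invertible_mat A"
    using A unfolding invertible_mat_def inverts_mat_def by auto
qed

lemma invertible_mat_iff_det:
  fixes A :: "'a :: field mat"
  assumes A: "A \<in> carrier_mat n n"
  shows "invertible_mat A \<longleftrightarrow> det A \<noteq> 0"
proof
  assume "invertible_mat A"
  then obtain B where B: "B \<in> carrier_mat n n" "A * B = 1\<^sub>m n"
    using invertible_mat_iff[OF A] by auto
  have "det A * det B = 1" using det_mult[OF A B(1)] B(2) by simp
  then show "det A \<noteq> 0" by auto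
next
  assume "det A \<noteq> 0"
  from det_non_zero_imp_unit[OF A this, of "()"] show "invertible_mat A"
    unfolding invertible_mat_iff[OF A] by (auto simp: Units_def ring_mat_def)
qed

lemma invertible_matI:
  fixes A B :: "'a :: field mat"
  assumes "A \<in> carrier_mat n n" "B \<in> carrier_mat n n" "A * B = 1\<^sub>m n"
  shows "invertible_mat A" "invertible_mat B"
proof -
  have "B * A = 1\<^sub>m n" by (rule mat_mult_left_right_inverse[OF assms])
  then show "invertible_mat A" "invertible_mat B"
    using assms invertible_mat_iff[of A n] invertible_mat_iff[of B n] by auto
qed

lemma mat_inv:
  assumes A: "A \<in> carrier_mat n n" and inv: "invertible_mat A"
  shows "mat_inv A \<in> carrier_mat n n" "A * mat_inv A = 1\<^sub>m n" "mat_inv A * A = 1\<^sub>m n"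
proof -
  from inv obtain B where "B \<in> carrier_mat n n" "A * B = 1\<^sub>m n" "B * A = 1\<^sub>m n"
    using invertible_mat_iff[OF A] by auto
  then have "A \<in> Units (ring_mat TYPE(complex) n ())"
    using A by (auto simp: Units_def ring_mat_def)
  then obtain C where C: "mat_inverse A = Some C"
    using mat_inverse(1)[OF A, of "()"] by (cases "mat_inverse A") auto
  from mat_inverse(2)[OF A this] C
  show "mat_inv A \<in> carrier_mat n n" "A * mat_inv A = 1\<^sub>m n" "mat_inv A * A = 1\<^sub>m n"
    by (auto simp: mat_inv_def)
qed

lemma mat_inv_unique:
  assumes A: "A \<in> carrier_mat n n" and B: "B \<in> carrier_mat n n" and AB: "A * B = 1\<^sub>m n"
  shows "mat_inv A = B"
proof -
  note i = mat_inv[OF A invertible_matI(1)[OF assms]]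
  have "mat_inv A = mat_inv A * (A * B)" using i A B AB by simp
  also have "\<dots> = B" using i A B by (subst mult_cancel_left_dim[OF i(3)]) auto
  finally show ?thesis .
qed

lemma invertible_mat_mult:
  fixes A B :: "'a :: field mat"
  assumes "A \<in> carrier_mat n n" "B \<in> carrier_mat n n" "invertible_mat A" "invertible_mat B"
  shows "invertible_mat (A * B)"
  using assms by (simp add: invertible_mat_iff_det[of _ n] det_mult[of A n B])

lemma invertible_mat_factors:
  fixes A B :: "'a :: field mat"
  assumes "A \<in> carrier_mat n n" "B \<in> carrier_mat n n" "invertible_mat (A * B)"
  shows "invertible_mat A" "invertible_mat B"
  using assms by (auto simp: invertible_mat_iff_det[of _ n] det_mult[of A n B])

lemma invertible_star_mat:
  assumes A: "A \<in> carrier_mat n n" and inv: "invertible_mat A"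
  shows "invertible_mat (star_mat st A)" "mat_inv (star_mat st A) = star_mat st (mat_inv A)"
proof -
  note i = mat_inv[OF A inv]
  have "star_mat st A * star_mat st (mat_inv A) = 1\<^sub>m n"
    using i A by (subst star_mat_mult[symmetric]) auto
  then show "invertible_mat (star_mat st A)" "mat_inv (star_mat st A) = star_mat st (mat_inv A)"
    using A i by (auto intro!: invertible_matI(1)[of _ n "star_mat st (mat_inv A)"] mat_inv_unique
       star_mat_carrier)
qed

lemma invertible_mat_smult:
  fixes A :: "'a :: field mat"
  assumes "A \<in> carrier_mat n n" "invertible_mat A" "c \<noteq> 0"
  shows "invertible_mat (c \<cdot>\<^sub>m A)"
  using assms by (simp add: invertible_mat_iff_det[of _ n])

section \<open>Block matrices\<close>

lemma dim_append_cols [simp]: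
  "dim_row (append_cols A B) = dim_row A" "dim_col (append_cols A B) = dim_col A + dim_col B"
  by (auto simp: append_cols_def)

lemma dim_append_rows [simp]:
  "dim_row (A @\<^sub>r B) = dim_row A + dim_row B" "dim_col (A @\<^sub>r B) = dim_col A"
  by (auto simp: append_rows_def)

lemma index_append_cols [simp]:
  "i < dim_row A \<Longrightarrow> j < dim_col A + dim_col B \<Longrightarrow>
   append_cols A B $$ (i, j) = (if j < dim_col A then A $$ (i, j) else B $$ (i, j - dim_col A))"
  by (auto simp: append_cols_def)

lemma index_append_rows [simp]:
  "i < dim_row A + dim_row B \<Longrightarrow> j < dim_col A \<Longrightarrow>
   (A @\<^sub>r B) $$ (i, j) = (if i < dim_row A then A $$ (i, j) else B $$ (i - dim_row A, j))"
  by (auto simp: append_rows_def)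

lemma star_append_cols:
  "dim_row A = dim_row B \<Longrightarrow> star_mat st (append_cols A B) = star_mat st A @\<^sub>r star_mat st B"
  by (rule eq_matI) auto

lemma star_append_rows:
  "dim_col A = dim_col B \<Longrightarrow> star_mat st (A @\<^sub>r B) = append_cols (star_mat st A) (star_mat st B)"
  by (rule eq_matI) auto

lemma mult_append_cols:
  assumes "dim_col (R :: complex mat) = dim_row A" "dim_row A = dim_row B"
  shows "R * append_cols A B = append_cols (R * A) (R * B)"
  by (rule eq_matI) (use assms in \<open>auto simp: scalar_prod_def\<close>)

lemma append_rows_mult:
  fixes A :: "'a :: semiring_0 mat"
  assumes "dim_col A = dim_row R" "dim_col A = dim_col B"
  shows "(A @\<^sub>r B) * R = (A * R) @\<^sub>r (B * R)"
  by (rule eq_matI) (use assms in \<open>auto simp: scalar_prod_def\<close>)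

lemma append_cols_mult_append_rows:
  assumes "dim_col A = dim_row C" "dim_col B = dim_row D" "dim_row A = dim_row B" "dim_col C = dim_col D"
  shows "append_cols A B * (C @\<^sub>r D) = A * C + B * D"
proof -
  have "append_cols A B * (C @\<^sub>r D) =
      four_block_mat (A * C + B * D) (A * 0\<^sub>m (dim_col A) 0 + B * 0\<^sub>m (dim_col B) 0)
        (0\<^sub>m 0 (dim_col A) * C + 0\<^sub>m 0 (dim_col B) * D) (0\<^sub>m 0 (dim_col A) * 0\<^sub>m (dim_col A) 0 + 0\<^sub>m 0 (dim_col B) * 0\<^sub>m (dim_col B) 0)"
    unfolding append_cols_def append_rows_def
    using assms by (subst mult_four_block_mat[of _ "dim_row A" "dim_col A" _ "dim_col B" _ 0 _ _ "dim_col C" _ 0]) auto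
  also have "\<dots> = A * C + B * D"
    by (rule eq_matI) (use assms in auto)
  finally show ?thesis .
qed

lemma append_rows_mult_append_cols:
  assumes "dim_col A = dim_row C" "dim_row C = dim_row D" "dim_col A = dim_col B"
  shows "(A @\<^sub>r B) * append_cols C D = four_block_mat (A * C) (A * D) (B * C) (B * (D :: complex mat))"
  by (rule eq_matI) (use assms in \<open>auto simp: scalar_prod_def\<close>)

lemma append_cols_mult_four_block:
  assumes "dim_col A = dim_row P" "dim_col B = dim_row S" "dim_row A = dim_row B"
    "dim_row Q = dim_row P" "dim_col R = dim_col P" "dim_row R = dim_row S" "dim_col Q = dim_col S"
  shows "append_cols A B * four_block_mat P Q R S = append_cols (A * P + B * R) (A * Q + B * S)"
  unfolding append_cols_def 
  using assms by (subst mult_four_block_mat[of _ "dim_row A" "dim_col A" _ "dim_col B" _ 0 _ _ "dim_col P" _ "dim_col S"]) auto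

lemma four_block_mult_dim:
  fixes A :: "complex mat"
  assumes "dim_row B = dim_row A" "dim_col C = dim_col A" "dim_row C = dim_row D" "dim_col B = dim_col D"
    "dim_col A = dim_row P" "dim_col D = dim_row S"
    "dim_row Q = dim_row P" "dim_col R = dim_col P" "dim_row R = dim_row S" "dim_col Q = dim_col S"
  shows "four_block_mat A B C D * four_block_mat P Q R S =
    four_block_mat (A * P + B * R) (A * Q + B * S) (C * P + D * R) (C * Q + D * S)"
  by (rule mult_four_block_mat[of _ "dim_row A" "dim_col A" _ "dim_col B" _ "dim_row D" _ _ "dim_col P" _ "dim_col S"]) (use assms in auto)

lemma append_cols_inject:
  assumes "append_cols A B = append_cols C D" "dim_row A = dim_row B" "dim_row C = dim_row D" "dim_col A = dim_col C"
  shows "A = C" "B = D"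
proof -
  have d: "dim_row A = dim_row C" using arg_cong[OF assms(1), of dim_row] by simp
  have d2: "dim_col B = dim_col D" using arg_cong[OF assms(1), of dim_col] assms(2-) by simp
  have e: "append_cols A B $$ (i, j) = append_cols C D $$ (i, j)" for i j using assms(1) by simp
  show "A = C"
  proof (rule eq_matI)
    fix i j assume "i < dim_row C" "j < dim_col C"
    then show "A $$ (i, j) = C $$ (i, j)" using e[of i j] assms(2-) d d2 by simp
  qed (use assms d in auto)
  show "B = D"
  proof (rule eq_matI)
    fix i j assume "i < dim_row D" "j < dim_col D"
    then show "B $$ (i, j) = D $$ (i, j)" using e[of i "j + dim_col A"] assms(2-) d d2 by simp
  qed (use assms d d2 in auto)
qed

lemma append_rows_inject:
  assumes "A @\<^sub>r B = C @\<^sub>r D" "dim_col A = dim_col B" "dim_col C = dim_col D" "dim_row A = dim_row C"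
  shows "A = C" "B = (D :: complex mat)"
proof -
  have "append_cols (star_mat Transpose A) (star_mat Transpose B) = append_cols (star_mat Transpose C) (star_mat Transpose D)"
    using arg_cong[OF assms(1), of "star_mat Transpose"] assms(2-) by (simp del: star_mat.simps add: star_append_rows)
  note * = append_cols_inject[OF this]
  have "star_mat Transpose A = star_mat Transpose C" "star_mat Transpose B = star_mat Transpose D"
    using * assms by auto
  from this[THEN arg_cong, of "star_mat Transpose"] show "A = C" "B = D" by (simp_all del: star_mat.simps)
qed

lemma four_block_inject:
  assumes "four_block_mat A B C D = four_block_mat P Q R S"
    "A \<in> carrier_mat n1 m1" "B \<in> carrier_mat n1 m2" "C \<in> carrier_mat n2 m1" "D \<in> carrier_mat n2 m2"
    "P \<in> carrier_mat n1 m1" "Q \<in> carrier_mat n1 m2" "R \<in> carrier_mat n2 m1" "S \<in> carrier_mat n2 m2"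
  shows "A = P" "B = Q" "C = R" "D = S"
proof -
  have e: "four_block_mat A B C D $$ (i, j) = four_block_mat P Q R S $$ (i, j)" for i j using assms(1) by simp
  show "A = P"
  proof (rule eq_matI)
    fix i j assume "i < dim_row P" "j < dim_col P"
    then show "A $$ (i, j) = P $$ (i, j)" using e[of i j] assms(2-) by simp
  qed (use assms in auto)
  show "B = Q"
  proof (rule eq_matI)
    fix i j assume "i < dim_row Q" "j < dim_col Q"
    then show "B $$ (i, j) = Q $$ (i, j)" using e[of i "j + m1"] assms(2-) by simp
  qed (use assms in auto)
  show "C = R"
  proof (rule eq_matI)
    fix i j assume "i < dim_row R" "j < dim_col R"
    then show "C $$ (i, j) = R $$ (i, j)" using e[of "i + n1" j] assms(2-) by simp
  qed (use assms in auto)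
  show "D = S"
  proof (rule eq_matI)
    fix i j assume "i < dim_row S" "j < dim_col S"
    then show "D $$ (i, j) = S $$ (i, j)" using e[of "i + n1" "j + m1"] assms(2-) by simp
  qed (use assms in auto)
qed

lemma mat_diag_block:
  "four_block_mat (mat_diag a f) (0\<^sub>m a b) (0\<^sub>m b a) (mat_diag b g) =
    mat_diag (a + b) (\<lambda>i. if i < a then f i else g (i - a))"
  by (rule eq_matI) (auto simp: mat_diag_def)

lemma diag_block_mat_two: "diag_block_mat [A, B] = 
  four_block_mat A (0\<^sub>m (dim_row A) (dim_col B)) (0\<^sub>m (dim_row B) (dim_col A)) B"
proof -
  have "four_block_mat B (0\<^sub>m (dim_row B) 0) (0\<^sub>m 0 (dim_col B)) (0\<^sub>m 0 0) = B"
    by (rule eq_matI) auto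
  then show ?thesis by (simp add: Let_def)
qed

lemma split_cols:
  assumes "A \<in> carrier_mat n (m1 + m2)"
  obtains B C where "B \<in> carrier_mat n m1" "C \<in> carrier_mat n m2" "A = append_cols B C"
proof
  show "A = append_cols (mat n m1 (\<lambda>(i,j). A $$ (i,j))) (mat n m2 (\<lambda>(i,j). A $$ (i,j+m1)))"
    by (rule eq_matI) (use assms in auto)
qed auto

lemma split_rows:
  assumes "A \<in> carrier_mat (m1 + m2) n"
  obtains B C where "B \<in> carrier_mat m1 n" "C \<in> carrier_mat m2 n" "A = B @\<^sub>r C"
proof
  show "A = (mat m1 n (\<lambda>(i,j). A $$ (i,j))) @\<^sub>r (mat m2 n (\<lambda>(i,j). A $$ (i+m1,j)))"
    by (rule eq_matI) (use assms in auto)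
qed auto

lemma split_four_block:
  assumes "A \<in> carrier_mat (n1 + n2) (m1 + m2)"
  obtains B C D E where "B \<in> carrier_mat n1 m1" "C \<in> carrier_mat n1 m2" "D \<in> carrier_mat n2 m1" "E \<in> carrier_mat n2 m2"
    "A = four_block_mat B C D E"
proof
  show "A = four_block_mat (mat n1 m1 (\<lambda>(i,j). A $$ (i,j))) (mat n1 m2 (\<lambda>(i,j). A $$ (i,j+m1)))
      (mat n2 m1 (\<lambda>(i,j). A $$ (i+n1,j))) (mat n2 m2 (\<lambda>(i,j). A $$ (i+n1,j+m1)))"
    by (rule eq_matI) (use assms in auto)
qed auto

lemma append_cols_add:
  "dim_row A = dim_row B \<Longrightarrow> dim_row A = dim_row C \<Longrightarrow> dim_row C = dim_row D \<Longrightarrow> dim_col A = dim_col C \<Longrightarrow> dim_col B = dim_col D \<Longrightarrow>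
   append_cols A B + append_cols C D = append_cols (A + C) (B + (D :: complex mat))"
  by (rule eq_matI) auto

lemma append_cols_smult: "dim_row A = dim_row B \<Longrightarrow> c \<cdot>\<^sub>m append_cols A B = append_cols (c \<cdot>\<^sub>m A) (c \<cdot>\<^sub>m B)"
  by (rule eq_matI) auto

lemma block_diag_inverse:
  assumes "A \<in> carrier_mat k k" "B \<in> carrier_mat m m" "invertible_mat A" "invertible_mat B"
  shows "invertible_mat (four_block_mat A (0\<^sub>m k m) (0\<^sub>m m k) B)"
    "mat_inv (four_block_mat A (0\<^sub>m k m) (0\<^sub>m m k) B) = four_block_mat (mat_inv A) (0\<^sub>m k m) (0\<^sub>m m k) (mat_inv B)"
proof -
  note i = mat_inv[OF assms(1,3)] mat_inv[OF assms(2,4)]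
  have c: "four_block_mat A (0\<^sub>m k m) (0\<^sub>m m k) B \<in> carrier_mat (k + m) (k + m)"
    "four_block_mat (mat_inv A) (0\<^sub>m k m) (0\<^sub>m m k) (mat_inv B) \<in> carrier_mat (k + m) (k + m)"
    using assms i by auto
  have "four_block_mat A (0\<^sub>m k m) (0\<^sub>m m k) B * four_block_mat (mat_inv A) (0\<^sub>m k m) (0\<^sub>m m k) (mat_inv B)
     = four_block_mat (1\<^sub>m k) (0\<^sub>m k m) (0\<^sub>m m k) (1\<^sub>m m)"
    using assms i by (simp add: four_block_mult_dim matalg)
  also have "\<dots> = 1\<^sub>m (k + m)" by (rule eq_matI) auto
  finally have e: "four_block_mat A (0\<^sub>m k m) (0\<^sub>m m k) B * four_block_mat (mat_inv A) (0\<^sub>m k m) (0\<^sub>m m k) (mat_inv B) = 1\<^sub>m (k + m)" .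
  show "invertible_mat (four_block_mat A (0\<^sub>m k m) (0\<^sub>m m k) B)" by (rule invertible_matI(1)[OF c e])
  show "mat_inv (four_block_mat A (0\<^sub>m k m) (0\<^sub>m m k) B) = four_block_mat (mat_inv A) (0\<^sub>m k m) (0\<^sub>m m k) (mat_inv B)"
    by (rule mat_inv_unique[OF c e])
qed

text \<open>
  The residual \<open>A2 X T\<^sup>2 + A0 X T + c A1 X\<close> decouples for block diagonal \<open>T\<close>; this is how a
  prescribed pair is recovered from a full set of pairs.
\<close>
lemma residual_append_cols:
  fixes A0 :: "complex mat"
  assumes "A2 \<in> carrier_mat n n" "A0 \<in> carrier_mat n n" "A1 \<in> carrier_mat n n"
    and "X1 \<in> carrier_mat n k" "X2 \<in> carrier_mat n m" "T1 \<in> carrier_mat k k" "T2 \<in> carrier_mat m m"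
  shows "A2 * append_cols X1 X2 * four_block_mat T1 (0\<^sub>m k m) (0\<^sub>m m k) T2 ^\<^sub>m 2
      + A0 * append_cols X1 X2 * four_block_mat T1 (0\<^sub>m k m) (0\<^sub>m m k) T2 + c \<cdot>\<^sub>m (A1 * append_cols X1 X2)
    = append_cols (A2 * X1 * T1 ^\<^sub>m 2 + A0 * X1 * T1 + c \<cdot>\<^sub>m (A1 * X1)) (A2 * X2 * T2 ^\<^sub>m 2 + A0 * X2 * T2 + c \<cdot>\<^sub>m (A1 * X2))"
proof -
  note [simp] = assms[THEN carrier_matD(1)] assms[THEN carrier_matD(2)]
  define T where "T = four_block_mat T1 (0\<^sub>m k m) (0\<^sub>m m k) T2"
  have [simp]: "dim_row T = k + m" "dim_col T = k + m" by (auto simp: T_def)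
  have mT: "append_cols P Q * T = append_cols (P * T1) (Q * T2)"
    if "P \<in> carrier_mat r k" "Q \<in> carrier_mat r m" for P Q r
    unfolding T_def using that by (simp add: append_cols_mult_four_block matalg)
  have AX: "C * append_cols X1 X2 = append_cols (C * X1) (C * X2)" if "C \<in> carrier_mat n n" for C
    using that by (intro mult_append_cols) auto
  have T2: "C * T ^\<^sub>m 2 = C * T * T" if "dim_col C = k + m" for C
    using that by (simp add: numeral_2_eq_2 mult_assoc_dim one_mult_dim)
  have TT: "T1 ^\<^sub>m 2 = T1 * T1" "T2 ^\<^sub>m 2 = T2 * T2" by (simp_all add: numeral_2_eq_2)
  have CT: "C * append_cols X1 X2 * T = append_cols (C * X1 * T1) (C * X2 * T2)" if "C \<in> carrier_mat n n" for C
    unfolding AX[OF that] by (rule mT[of _ n]) (use that in \<open>auto intro!: carrier_matI\<close>)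
  have "A2 * append_cols X1 X2 * T * T = append_cols (A2 * X1 * T1 * T1) (A2 * X2 * T2 * T2)"
    unfolding CT[OF assms(1)] by (rule mT[of _ n]) (auto intro!: carrier_matI)
  then have "A2 * append_cols X1 X2 * T ^\<^sub>m 2 = append_cols (A2 * X1 * T1 ^\<^sub>m 2) (A2 * X2 * T2 ^\<^sub>m 2)"
    by (subst T2) (simp_all add: TT mult_assoc_dim)
  moreover note CT[OF assms(2)]
  moreover have "c \<cdot>\<^sub>m (A1 * append_cols X1 X2) = append_cols (c \<cdot>\<^sub>m (A1 * X1)) (c \<cdot>\<^sub>m (A1 * X2))"
    unfolding AX[OF assms(3)] by (rule append_cols_smult) simp
  ultimately show ?thesis unfolding T_def[symmetric] by (simp add: append_cols_add)
qed

section \<open>Linearization\<close>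

text \<open>
  The linearization of \<open>Q\<close> with eigenvector \<open>(x, - x / \<lambda>)\<close> for each eigenpair \<open>(\<lambda>, x)\<close>, \<open>\<lambda> \<noteq> 0\<close>: the
  first block row is the equation \<open>Q(\<lambda>) x = 0\<close> solved for \<open>\<lambda> x\<close>. The sign in the second component is the
  one of the full column rank condition.
\<close>
definition pal_companion :: "complex \<Rightarrow> star \<Rightarrow> nat \<Rightarrow> complex mat \<Rightarrow> complex mat \<Rightarrow> complex mat" where
  "pal_companion eps st n A1 A0 = four_block_mat
     (- (mat_inv (star_mat st A1) * A0)) (eps \<cdot>\<^sub>m (mat_inv (star_mat st A1) * A1)) (- 1\<^sub>m n) (0\<^sub>m n n)"

text \<open>
  The form preserved by the companion matrix. It is the matrix that \<open>V S V\<^sup>\<star>\<close> has to be for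
  \<open>V = [X; - X T\<^sup>-\<^sup>1]\<close>: the zero blocks say that \<open>X S X\<^sup>\<star> = 0\<close> and the other two determine \<open>A1\<close>.
\<close>
definition pal_form :: "complex \<Rightarrow> star \<Rightarrow> nat \<Rightarrow> complex mat \<Rightarrow> complex mat" where
  "pal_form eps st n A1 = four_block_mat
     (0\<^sub>m n n) (mat_inv (star_mat st A1)) ((- eps) \<cdot>\<^sub>m mat_inv A1) (0\<^sub>m n n)"

locale regular_palindromic =
  fixes eps :: complex and st :: star and n :: nat and A1 A0 :: "complex mat"
  assumes eps: "eps \<in> {1, -1}"
    and A1: "A1 \<in> carrier_mat n n" and A0: "A0 \<in> carrier_mat n n"
    and A0_sym: "star_mat st A0 = eps \<cdot>\<^sub>m A0"
    and A1_inv: "invertible_mat A1"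
begin

definition A1i where "A1i = mat_inv A1"
definition A1s where "A1s = star_mat st A1"
definition A1si where "A1si = star_mat st A1i"

lemma eps_simps: "eps * eps = 1" "star_scalar st eps = eps" "eps \<noteq> 0" "eps * (eps * c) = c"
  using eps by (auto simp: star_scalar_def)

lemma dims [simp]:
  "dim_row A1 = n" "dim_col A1 = n" "dim_row A0 = n" "dim_col A0 = n"
  "dim_row A1i = n" "dim_col A1i = n" "dim_row A1s = n" "dim_col A1s = n"
  "dim_row A1si = n" "dim_col A1si = n"
  using A1 A0 mat_inv(1)[OF A1 A1_inv] by (auto simp: A1i_def A1s_def A1si_def)

lemma carriers: "A1i \<in> carrier_mat n n" "A1s \<in> carrier_mat n n" "A1si \<in> carrier_mat n n"
  by (auto intro!: carrier_matI)

lemma stars [simp]: "star_mat st A1i = A1si" "star_mat st A1si = A1i" "star_mat st A1 = A1s" "star_mat st A1s = A1"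
  by (auto simp: A1i_def A1s_def A1si_def)

lemma mat_inv_A1 [simp]: "mat_inv A1 = A1i" "mat_inv A1s = A1si"
proof -
  show "mat_inv A1 = A1i" by (simp only: A1i_def)
  show "mat_inv A1s = A1si"
    unfolding A1s_def A1si_def A1i_def by (rule invertible_star_mat(2)[OF A1 A1_inv])
qed

lemma invs: "A1 * A1i = 1\<^sub>m n" "A1i * A1 = 1\<^sub>m n" "A1s * A1si = 1\<^sub>m n" "A1si * A1s = 1\<^sub>m n"
proof -
  show *: "A1 * A1i = 1\<^sub>m n" "A1i * A1 = 1\<^sub>m n" 
    unfolding A1i_def by (rule mat_inv[OF A1 A1_inv])+
  have "star_mat st (A1 * A1i) = 1\<^sub>m n" "star_mat st (A1i * A1) = 1\<^sub>m n"
    unfolding * by simp_all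
  then show "A1s * A1si = 1\<^sub>m n" "A1si * A1s = 1\<^sub>m n" 
    by (simp_all add: star_mat_mult)
qed

lemma invs_cancel:
  "dim_row Z = n \<Longrightarrow> A1 * (A1i * Z) = Z" "dim_row Z = n \<Longrightarrow> A1i * (A1 * Z) = Z"
  "dim_row Z = n \<Longrightarrow> A1s * (A1si * Z) = Z" "dim_row Z = n \<Longrightarrow> A1si * (A1s * Z) = Z"
  by (simp_all add: mult_cancel_left_dim[OF invs(1)] mult_cancel_left_dim[OF invs(2)]
      mult_cancel_left_dim[OF invs(3)] mult_cancel_left_dim[OF invs(4)])

abbreviation L where "L \<equiv> pal_companion eps st n A1 A0"
abbreviation J where "J \<equiv> pal_form eps st n A1"

lemma L_eq: "L = four_block_mat (- (A1si * A0)) (eps \<cdot>\<^sub>m (A1si * A1)) (- 1\<^sub>m n) (0\<^sub>m n n)"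
  by (simp add: pal_companion_def)

lemma J_eq: "J = four_block_mat (0\<^sub>m n n) A1si ((- eps) \<cdot>\<^sub>m A1i) (0\<^sub>m n n)"
  by (simp add: pal_form_def)

lemma L_carrier: "L \<in> carrier_mat (2 * n) (2 * n)"
  by (auto simp: L_eq intro!: carrier_matI)

lemma J_carrier: "J \<in> carrier_mat (2 * n) (2 * n)"
  by (auto simp: J_eq intro!: carrier_matI)

lemma star_J: "star_mat st J = (- eps) \<cdot>\<^sub>m J"
  by (rule eq_matI) (auto simp: J_eq starmat eps_simps)

lemma J_invertible: "invertible_mat J"
proof -
  have "J * four_block_mat (0\<^sub>m n n) ((- eps) \<cdot>\<^sub>m A1) A1s (0\<^sub>m n n) = 
     four_block_mat (1\<^sub>m n) (0\<^sub>m n n) (0\<^sub>m n n) (1\<^sub>m n)"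
    unfolding J_eq by (subst four_block_mult_dim) (simp_all add: matalg invs eps_simps)
  also have "\<dots> = 1\<^sub>m (2 * n)" by (rule eq_matI) auto
  finally show ?thesis
    by (rule invertible_matI(1)[OF J_carrier, rotated]) (auto intro!: carrier_matI)
qed

lemma star_L: "star_mat st L =
  four_block_mat (- ((eps \<cdot>\<^sub>m A0) * A1i)) (- 1\<^sub>m n) (eps \<cdot>\<^sub>m (A1s * A1i)) (0\<^sub>m n n)"
  unfolding L_eq by (simp add: starmat A0_sym eps_simps)

lemma J_star_L: "J * star_mat st L =
  four_block_mat (A1si * (eps \<cdot>\<^sub>m (A1s * A1i))) (0\<^sub>m n n) (A1i * (A0 * A1i)) (eps \<cdot>\<^sub>m A1i)"
  unfolding star_L unfolding J_eq
  by (subst four_block_mult_dim) (simp_all add: matalg invs eps_simps)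

text \<open>
  The invariance that drives the whole proof; the symmetry \<open>A0\<^sup>\<star> = \<epsilon> A0\<close> is what makes the first
  diagonal block cancel.
\<close>
lemma L_J_star_L: "L * J * star_mat st L = J"
proof -
  have "L * J * star_mat st L = L * (J * star_mat st L)"
    using L_carrier J_carrier by (simp add: mult_assoc_dim)
  also have "\<dots> = J"
    unfolding J_star_L unfolding L_eq J_eq
    by (subst four_block_mult_dim)
      (simp_all add: matalg invs invs_cancel eps_simps add_uminus_dim uminus_add_dim)
  finally show ?thesis .
qed

text \<open>
  It suffices to compare values at every \<open>x\<close>. The lower blocks of \<open>x - L\<close> are multiples of the identity,
  hence commute, and the determinant formula for such block matrices turns \<open>det (x - L)\<close> into the
  determinant of \<open>A1\<^sup>-\<^sup>\<star> Q(x)\<close>.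
\<close>
lemma det_quad_poly_mat:
  "det (quad_poly_mat eps st n A1 A0) = Polynomial.smult (det A1s) (char_poly L)"
proof -
  have "poly (det (quad_poly_mat eps st n A1 A0)) x = poly (Polynomial.smult (det A1s) (char_poly L)) x" for x
  proof -
    define Q where "Q = (x * x) \<cdot>\<^sub>m A1s + (x \<cdot>\<^sub>m A0 + eps \<cdot>\<^sub>m A1)"
    have Q: "Q \<in> carrier_mat n n" by (auto simp: Q_def intro!: carrier_matI)
    have lhs: "poly (det (quad_poly_mat eps st n A1 A0)) x = det Q"
      by (rule poly_det_cong[OF Q])
        (auto simp: quad_poly_mat_def Q_def algebra_simps index_star_mat[symmetric] simp del: index_star_mat intro!: carrier_matI)
    have "poly (char_poly L) x = det (- char_matrix L x)"
      by (rule char_poly_matrix[OF L_carrier])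
    also have "- char_matrix L x = four_block_mat (x \<cdot>\<^sub>m 1\<^sub>m n + A1si * A0) (- (eps \<cdot>\<^sub>m (A1si * A1))) (1\<^sub>m n) (x \<cdot>\<^sub>m 1\<^sub>m n)"
      unfolding char_matrix_def L_eq by (rule eq_matI) auto
    also have "det \<dots> = det ((x \<cdot>\<^sub>m 1\<^sub>m n + A1si * A0) * (x \<cdot>\<^sub>m 1\<^sub>m n) - (- (eps \<cdot>\<^sub>m (A1si * A1))) * 1\<^sub>m n)"
      by (rule det_four_block_mat) (auto intro!: carrier_matI)
    also have "(x \<cdot>\<^sub>m 1\<^sub>m n + A1si * A0) * (x \<cdot>\<^sub>m 1\<^sub>m n) - (- (eps \<cdot>\<^sub>m (A1si * A1))) * 1\<^sub>m n
        = (x * x) \<cdot>\<^sub>m 1\<^sub>m n + x \<cdot>\<^sub>m (A1si * A0) + eps \<cdot>\<^sub>m (A1si * A1)"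
    proof -
      have "(x \<cdot>\<^sub>m 1\<^sub>m n + A1si * A0) * (x \<cdot>\<^sub>m 1\<^sub>m n) = (x * x) \<cdot>\<^sub>m 1\<^sub>m n + x \<cdot>\<^sub>m (A1si * A0)"
        by (simp add: matalg)
      moreover have "(- (eps \<cdot>\<^sub>m (A1si * A1))) * 1\<^sub>m n = - (eps \<cdot>\<^sub>m (A1si * A1))"
        by (simp add: matalg)
      ultimately show ?thesis by (simp) (rule eq_matI, auto)
    qed
    also have "\<dots> = A1si * Q"
      by (simp add: Q_def matalg invs) (rule eq_matI, auto)
    also have "det \<dots> = det A1si * det Q" by (rule det_mult[OF carriers(3) Q])
    finally have "poly (char_poly L) x = det A1si * det Q" .
    moreover have "det A1s * det A1si = 1"
      using det_mult[OF carriers(2,3)] invs(3) by simp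
    ultimately show ?thesis unfolding lhs by (simp flip: mult.assoc)
  qed
  then show ?thesis by (simp add: poly_eq_poly_eq_iff[symmetric] fun_eq_iff)
qed

lemma quad_eigenvalues_eq: "quad_eigenvalues eps st n A1 A0 = mat_eigenvalues L"
proof -
  have "det A1s \<noteq> 0" using det_mult[OF carriers(2,3)] invs(3) by auto
  then show ?thesis unfolding quad_eigenvalues_def mat_eigenvalues_def det_quad_poly_mat by simp
qed

text \<open>
  The first block row of the equation is the residual multiplied by \<open>A1\<^sup>-\<^sup>\<star>\<close> from the left and by
  \<open>T\<^sup>-\<^sup>1\<close> from the right.
\<close>
lemma companion_mult:
  assumes X: "X \<in> carrier_mat n N" and T: "T \<in> carrier_mat N N" and Ti: "Ti \<in> carrier_mat N N" "Ti * T = 1\<^sub>m N"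
    and R: "A1s * X * T ^\<^sub>m 2 + A0 * X * T + eps \<cdot>\<^sub>m (A1 * X) = 0\<^sub>m n N"
  shows "L * (X @\<^sub>r (- (X * Ti))) = (X @\<^sub>r (- (X * Ti))) * T"
proof -
  define U where "U = X @\<^sub>r (- (X * Ti))"
  note [simp] = carrier_matD[OF X] carrier_matD[OF T] carrier_matD[OF Ti(1)]
  have TTi: "T * Ti = 1\<^sub>m N" by (rule mat_mult_left_right_inverse[OF Ti(1) T Ti(2)])
  note c = Ti(2) TTi mult_cancel_left_dim[OF Ti(2)] mult_cancel_left_dim[OF TTi]
  have R': "X * T = - (A1si * (A0 * X)) - eps \<cdot>\<^sub>m (A1si * (A1 * (X * Ti)))"
  proof -
    have "A1si * (A1s * X * T ^\<^sub>m 2 + A0 * X * T + eps \<cdot>\<^sub>m (A1 * X)) * Ti = 0\<^sub>m n N"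
      unfolding R by (simp add: matalg)
    then have z: "X * T + (A1si * (A0 * X) + eps \<cdot>\<^sub>m (A1si * (A1 * (X * Ti)))) = 0\<^sub>m n N" (is "?a + (?b + ?c) = _")
      by (simp add: matalg invs_cancel c numeral_2_eq_2 add_assoc_dim)
    have d: "dim_row ?a = n" "dim_col ?a = N" "dim_row ?b = n" "dim_col ?b = N" "dim_row ?c = n" "dim_col ?c = N" by auto
    show ?thesis
    proof (rule eq_matI)
      fix i j assume ij: "i < dim_row (- ?b - ?c)" "j < dim_col (- ?b - ?c)"
      then have "(?a + (?b + ?c)) $$ (i,j) = 0" unfolding z using d by simp
      then have "?a $$ (i,j) + (?b $$ (i,j) + ?c $$ (i,j)) = 0"
        using ij d by (simp del: index_mult_mat(1) index_smult_mat(1))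
      then show "?a $$ (i,j) = (- ?b - ?c) $$ (i,j)"
        using ij d by (simp del: index_mult_mat(1) index_smult_mat(1) add: eq_neg_iff_add_eq_0 algebra_simps)
    qed auto
  qed
  have "L * U = (append_cols (- (A1si * A0)) (eps \<cdot>\<^sub>m (A1si * A1)) @\<^sub>r append_cols (- 1\<^sub>m n) (0\<^sub>m n n)) * U"
    by (rule arg_cong[of _ _ "\<lambda>x. x * U"], rule eq_matI) (auto simp: L_eq)
  also have "\<dots> = (append_cols (- (A1si * A0)) (eps \<cdot>\<^sub>m (A1si * A1)) * U) @\<^sub>r (append_cols (- 1\<^sub>m n) (0\<^sub>m n n) * U)"
    by (rule append_rows_mult) (auto simp: U_def)
  also have "append_cols (- (A1si * A0)) (eps \<cdot>\<^sub>m (A1si * A1)) * U = X * T"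
    unfolding R' U_def by (subst append_cols_mult_append_rows) (auto simp: matalg intro!: minus_add_uminus_mat[symmetric])
  also have "append_cols (- 1\<^sub>m n) (0\<^sub>m n n) * U = - X"
    unfolding U_def by (subst append_cols_mult_append_rows) (auto simp: matalg)
  also have "(X * T) @\<^sub>r (- X) = U * T"
    unfolding U_def by (subst append_rows_mult) (auto simp: matalg c)
  finally show ?thesis unfolding U_def .
qed

end

section \<open>From a standard triple to a palindromic system\<close>

text \<open>
  With \<open>N\<^sub>j = X T\<^sup>j S X\<^sup>\<star>\<close>, the assumptions say that \<open>N\<^sub>0 = 0\<close> and that \<open>N\<^sub>-\<^sub>1\<close> is nonsingular. The relation
  \<open>T S T\<^sup>\<star> = S\<close> lets powers of \<open>T\<^sup>\<star>\<close> move across \<open>S\<close>, so \<open>N\<^sub>j\<^sup>\<star> = - \<epsilon> N\<^sub>-\<^sub>j\<close>.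
\<close>
locale palindromic_triple =
  fixes eps :: complex and st :: star and n :: nat and X T S :: "complex mat"
  assumes eps: "eps \<in> {1, -1}"
    and X: "X \<in> carrier_mat n (2 * n)" and T: "T \<in> carrier_mat (2 * n) (2 * n)"
    and S: "S \<in> carrier_mat (2 * n) (2 * n)"
    and T_inv: "invertible_mat T"
    and S_sym: "star_mat st S = (- eps) \<cdot>\<^sub>m S"
    and TS: "T * S * star_mat st T = S"
    and XS: "X * S * star_mat st X = 0\<^sub>m n n"
    and M_inv: "invertible_mat (X * mat_inv T * S * star_mat st X)"
begin

definition "Ti = mat_inv T"
definition "Xs = star_mat st X"
definition "M = X * (Ti * (S * Xs))"
definition "Mi = mat_inv M"

lemma eps_simps: "eps * eps = 1" "star_scalar st eps = eps" "eps \<noteq> 0" "eps * (eps * c) = c"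
  using eps by (auto simp: star_scalar_def)

lemma dims0 [simp]:
  "dim_row X = n" "dim_col X = 2 * n" "dim_row T = 2 * n" "dim_col T = 2 * n"
  "dim_row S = 2 * n" "dim_col S = 2 * n"
  "dim_row Ti = 2 * n" "dim_col Ti = 2 * n" "dim_row Xs = 2 * n" "dim_col Xs = n"
  "dim_row M = n" "dim_col M = n"
  using X T S mat_inv(1)[OF T T_inv] by (auto simp: Ti_def Xs_def M_def)

lemma M_invertible: "M \<in> carrier_mat n n" "invertible_mat M"
  using M_inv by (auto simp: M_def Ti_def[symmetric] Xs_def[symmetric] matalg intro!: carrier_matI)

lemma dims [simp]: "dim_row Mi = n" "dim_col Mi = n"
  using mat_inv(1)[OF M_invertible] by (auto simp: Mi_def)

lemma stars [simp]: "star_mat st X = Xs" "star_mat st Xs = X"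
  by (auto simp: Xs_def)

lemma Mi: "M * Mi = 1\<^sub>m n" "Mi * M = 1\<^sub>m n"
  unfolding Mi_def by (rule mat_inv[OF M_invertible])+

lemma star_Mi: "star_mat st Mi * star_mat st M = 1\<^sub>m n" "star_mat st M * star_mat st Mi = 1\<^sub>m n"
  by (subst star_mat_mult[symmetric], simp_all only: dims dims0 Mi star_mat_simps)+

lemma Ti: "T * Ti = 1\<^sub>m (2 * n)" "Ti * T = 1\<^sub>m (2 * n)"
  unfolding Ti_def by (rule mat_inv[OF T T_inv])+

lemmas cancel = mult_cancel_left_dim[OF Ti(1)] mult_cancel_left_dim[OF Ti(2)]
  mult_cancel_left_dim[OF Mi(1)] mult_cancel_left_dim[OF Mi(2)]
  mult_cancel_left_dim[OF star_Mi(1)] mult_cancel_left_dim[OF star_Mi(2)]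

lemma S_star_T: "S * star_mat st T = Ti * S"
proof -
  have "Ti * (T * S * star_mat st T) = S * star_mat st T"
    by (simp add: matalg cancel)
  then show ?thesis unfolding TS by simp
qed

lemma S_star_Ti: "S * star_mat st Ti = T * S"
proof -
  have "star_mat st (Ti * T) = 1\<^sub>m (2 * n)" unfolding Ti by simp
  then have *: "star_mat st T * star_mat st Ti = 1\<^sub>m (2 * n)" by (simp add: star_mat_mult)
  have "T * S * star_mat st T * star_mat st Ti = T * S"
    by (simp add: matalg *)
  then show ?thesis unfolding TS by simp
qed

lemma S_star_T_mult:
  "dim_row Z = 2 * n \<Longrightarrow> S * (star_mat st T * Z) = Ti * (S * Z)"
  "dim_row Z = 2 * n \<Longrightarrow> S * (star_mat st Ti * Z) = T * (S * Z)"
  using S_star_T S_star_Ti by (simp_all flip: mult_assoc_dim)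

lemma XSXs: "X * (S * Xs) = 0\<^sub>m n n"
  using XS by (simp add: matalg)

lemma star_M: "star_mat st M = (- eps) \<cdot>\<^sub>m (X * (T * (S * Xs)))"
  by (simp add: M_def starmat S_sym matalg S_star_T_mult)

lemma XTSXs: "X * (T * (S * Xs)) = (- eps) \<cdot>\<^sub>m star_mat st M"
  unfolding star_M by (simp add: matalg eps_simps)

abbreviation A1 where "A1 \<equiv> coeff_A1 eps st X T S"
abbreviation A0 where "A0 \<equiv> coeff_A0 eps st X T S"
definition "N2 = X * (Ti * (Ti * (S * Xs)))"

lemma dims_N2 [simp]: "dim_row N2 = n" "dim_col N2 = n" by (auto simp: N2_def)

lemma A1_eq: "A1 = eps \<cdot>\<^sub>m Mi"
  by (simp add: coeff_A1_def Ti_def[symmetric] matalg Mi_def M_def)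

lemma A0_eq: "A0 = - (A1 * (N2 * A1))"
  unfolding coeff_A0_def
  by (simp add: A1_eq Ti_def[symmetric] matalg N2_def numeral_2_eq_2)

lemma dims_A [simp]: "dim_row A1 = n" "dim_col A1 = n" "dim_row A0 = n" "dim_col A0 = n"
  by (auto simp: A1_eq A0_eq)

lemma A1_invertible: "A1 \<in> carrier_mat n n" "invertible_mat A1"
proof -
  show "A1 \<in> carrier_mat n n" by (intro carrier_matI) auto
  have "A1 * (eps \<cdot>\<^sub>m M) = 1\<^sub>m n"
    by (simp add: A1_eq matalg eps_simps Mi)
  then show "invertible_mat A1"
    by (rule invertible_matI(1)[rotated 2]) (auto intro!: carrier_matI)
qed

text \<open>
  The residual of \<open>(X, T)\<close>, to be shown to vanish.
\<close>
definition "R = star_mat st A1 * X * T ^\<^sub>m 2 + A0 * X * T + eps \<cdot>\<^sub>m (A1 * X)"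

lemma dims_R [simp]: "dim_row R = n" "dim_col R = 2 * n"
  by (auto simp: R_def)

lemma R_mult: "dim_row Z = 2 * n \<Longrightarrow> 
  R * Z = star_mat st A1 * (X * (T * (T * Z))) + (A0 * (X * (T * Z)) + eps \<cdot>\<^sub>m (A1 * (X * Z)))"
  unfolding R_def by (simp add: matalg numeral_2_eq_2 add_assoc_dim)

text \<open>
  The choice of \<open>A1\<close> makes the residual vanish on the block column \<open>T\<^sup>-\<^sup>1 S X\<^sup>\<star>\<close>.
\<close>
lemma R_mult_1: "R * (Ti * (S * Xs)) = 0\<^sub>m n n"
proof -
  have "R * (Ti * (S * Xs)) = star_mat st A1 * (X * (T * (S * Xs))) + eps \<cdot>\<^sub>m (A1 * M)"
    by (simp add: R_mult cancel XSXs matalg M_def[symmetric])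
  also have "\<dots> = 0\<^sub>m n n"
    unfolding XTSXs by (simp add: A1_eq starmat matalg star_Mi Mi eps_simps uminus_add_dim)
  finally show ?thesis .
qed

text \<open>
  The choice of \<open>A0\<close> makes the residual vanish on the block column \<open>T\<^sup>-\<^sup>2 S X\<^sup>\<star>\<close>.
\<close>
lemma R_mult_2: "R * (Ti * (Ti * (S * Xs))) = 0\<^sub>m n n"
proof -
  have "R * (Ti * (Ti * (S * Xs))) = A0 * M + eps \<cdot>\<^sub>m (A1 * N2)"
    by (simp add: R_mult cancel XSXs matalg M_def[symmetric] N2_def[symmetric])
  also have "\<dots> = 0\<^sub>m n n"
    unfolding A0_eq by (simp add: A1_eq matalg star_Mi Mi eps_simps uminus_add_dim)
  finally show ?thesis .
qed

definition "U = X @\<^sub>r (- (X * Ti))"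
definition "W = append_cols (Ti * (S * Xs)) (Ti * (Ti * (S * Xs)))"

lemma U_W_carrier: "U \<in> carrier_mat (2 * n) (2 * n)" "W \<in> carrier_mat (2 * n) (2 * n)"
  by (auto simp: U_def W_def intro!: carrier_matI)

text \<open>
  The product \<open>U (T W)\<close> is block triangular with respect to the antidiagonal, with \<open>M\<close> and \<open>- M\<close> on it;
  \<open>G\<close> in the proof is its inverse.
\<close>
lemma U_W_invertible: "invertible_mat U" "invertible_mat W"
proof -
  have TW: "T * W = append_cols (S * Xs) (Ti * (S * Xs))"
    unfolding W_def by (subst mult_append_cols) (auto simp: cancel)
  have UTW: "U * (T * W) = four_block_mat (0\<^sub>m n n) M (- M) (- N2)" 
    unfolding TW U_def
    by (subst append_rows_mult_append_cols) (simp_all add: matalg XSXs M_def N2_def)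
  define G where "G = four_block_mat (- (Mi * (N2 * Mi))) (- Mi) Mi (0\<^sub>m n n)"
  have G: "G \<in> carrier_mat (2 * n) (2 * n)" by (auto simp: G_def intro!: carrier_matI)
  have TWc: "T * W \<in> carrier_mat (2 * n) (2 * n)" using T U_W_carrier by simp
  have "U * (T * W) * G = four_block_mat (1\<^sub>m n) (0\<^sub>m n n) (0\<^sub>m n n) (1\<^sub>m n)"
    unfolding UTW G_def
    by (subst four_block_mult_dim) (simp_all add: matalg Mi cancel add_uminus_dim)
  also have "\<dots> = 1\<^sub>m (2 * n)" by (rule eq_matI) auto
  finally have "invertible_mat (U * (T * W))"
    by (rule invertible_matI(1)[OF _ G, rotated]) (use U_W_carrier TWc in simp)
  from invertible_mat_factors[OF U_W_carrier(1) TWc this]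
  show "invertible_mat U" "invertible_mat W"
    using invertible_mat_factors[OF T U_W_carrier(2)] by auto
qed

text \<open>
  The two block columns on which the residual vanishes form the nonsingular matrix \<open>W\<close>.
\<close>
lemma R_zero: "R = 0\<^sub>m n (2 * n)"
proof -
  have "R * W = 0\<^sub>m n (2 * n)"
    unfolding W_def by (subst mult_append_cols) (simp_all add: R_mult_1 R_mult_2, rule eq_matI, auto)
  then have "R * W * mat_inv W = 0\<^sub>m n (2 * n)"
    using mat_inv[OF U_W_carrier(2) U_W_invertible(2)] by (simp add: matalg)
  then show ?thesis
    using mat_inv[OF U_W_carrier(2) U_W_invertible(2)] U_W_carrier(2) by (simp add: matalg)
qed

text \<open>
  Evaluating the vanishing residual on \<open>S X\<^sup>\<star>\<close> gives a second expression for \<open>A0\<close>, namely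
  \<open>A1\<^sup>\<star> X T\<^sup>2 S X\<^sup>\<star> A1\<^sup>\<star>\<close>, and up to the factor \<open>\<epsilon>\<close> this is the star of the defining one.
\<close>
lemma A0_star: "star_mat st A0 = eps \<cdot>\<^sub>m A0"
proof -
  define N2' where "N2' = X * (T * (T * (S * Xs)))"
  have [simp]: "dim_row N2' = n" "dim_col N2' = n" by (auto simp: N2'_def)
  have "star_mat st A1 * N2' + (- (eps \<cdot>\<^sub>m (A0 * star_mat st M))) = R * (S * Xs)"
    by (simp add: R_mult XSXs XTSXs matalg N2'_def)
  also have "\<dots> = 0\<^sub>m n n" unfolding R_zero by (simp add: matalg)
  finally have "star_mat st A1 * N2' + (- (eps \<cdot>\<^sub>m (A0 * star_mat st M))) = 0\<^sub>m n n" .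
  then have "eps \<cdot>\<^sub>m (A0 * star_mat st M) = star_mat st A1 * N2'"
    by (rule add_uminus_eq_zeroD[symmetric]) auto
  then have "eps \<cdot>\<^sub>m (A0 * star_mat st M) * star_mat st Mi = star_mat st A1 * N2' * star_mat st Mi"
    by simp
  then have A0': "eps \<cdot>\<^sub>m A0 = star_mat st A1 * (N2' * star_mat st Mi)"
    by (simp add: matalg star_Mi)
  have N2s: "star_mat st N2 = - (eps \<cdot>\<^sub>m N2')"
    by (simp add: N2_def N2'_def starmat S_sym matalg S_star_T_mult)
  have "star_mat st A0 = star_mat st A1 * (N2' * star_mat st Mi)"
    unfolding A0_eq by (simp add: starmat matalg A1_eq N2s eps_simps)
  then show ?thesis using A0' by simp
qed

lemma regular: "regular_palindromic eps st n A1 A0"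
proof
  show "A0 \<in> carrier_mat n n" by (intro carrier_matI) auto
qed (fact eps A1_invertible A0_star)+

lemma char_poly_companion: "char_poly (pal_companion eps st n A1 A0) = char_poly T"
proof -
  interpret regular_palindromic eps st n A1 A0 by (rule regular)
  have "pal_companion eps st n A1 A0 * U = U * T"
    unfolding U_def
    by (rule companion_mult[OF X T _ Ti(2)]) (use R_zero in \<open>auto simp: R_def intro!: carrier_matI\<close>)
  then have "pal_companion eps st n A1 A0 * U * mat_inv U = U * T * mat_inv U" by simp
  then have "pal_companion eps st n A1 A0 = U * T * mat_inv U"
    using mat_inv[OF U_W_carrier(1) U_W_invertible(1)] U_W_carrier(1) L_carrier by (simp add: matalg)
  then have "similar_mat (pal_companion eps st n A1 A0) T"
    by (intro similar_matI[of _ _ U "mat_inv U" "2 * n"])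
      (use T U_W_carrier mat_inv[OF U_W_carrier(1) U_W_invertible(1)] L_carrier in auto)
  then show ?thesis by (rule char_poly_similar)
qed

end

section \<open>From a palindromic system to a standard triple\<close>

context regular_palindromic
begin

text \<open>
  In the basis \<open>V\<close> the pair \<open>(L, J)\<close> becomes \<open>(T, S)\<close>, so the invariance of \<open>J\<close> becomes \<open>T S T\<^sup>\<star> = S\<close>.
  The blocks of \<open>V S V\<^sup>\<star> = J\<close> give the isotropy of \<open>X\<close> and the formula for \<open>A1\<close>; those of
  \<open>V S T\<^sup>\<star> V\<^sup>\<star> = J L\<^sup>\<star>\<close> give the formula for \<open>A0\<close>.
\<close>
lemma triple_of_invariant_basis:
  assumes X: "X \<in> carrier_mat n (2 * n)" and T: "T \<in> carrier_mat (2 * n) (2 * n)" "invertible_mat T"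
    and V: "V = X @\<^sub>r (- (X * mat_inv T))" "invertible_mat V"
    and LV: "L * V = V * T"
    and S_def: "S = mat_inv V * J * star_mat st (mat_inv V)"
  shows "S \<in> carrier_mat (2 * n) (2 * n)" "invertible_mat S" "star_mat st S = (- eps) \<cdot>\<^sub>m S"
    "T * S * star_mat st T = S" "X * S * star_mat st X = 0\<^sub>m n n"
    "invertible_mat (X * mat_inv T * S * star_mat st X)"
    "A1 = coeff_A1 eps st X T S" "A0 = coeff_A0 eps st X T S"
proof -
  have Vc: "V \<in> carrier_mat (2 * n) (2 * n)" using X T mat_inv[OF T] by (auto simp: V intro!: carrier_matI)
  define Ti Vi Ls Vs Vis where "Ti = mat_inv T" and "Vi = mat_inv V"
    and "Ls = star_mat st L" and "Vs = star_mat st V" and "Vis = star_mat st Vi"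
  have carr: "Ti \<in> carrier_mat (2 * n) (2 * n)" "Vi \<in> carrier_mat (2 * n) (2 * n)"
    "Ls \<in> carrier_mat (2 * n) (2 * n)" "Vs \<in> carrier_mat (2 * n) (2 * n)" "Vis \<in> carrier_mat (2 * n) (2 * n)"
    using mat_inv[OF T] mat_inv[OF Vc V(2)] L_carrier Vc
    by (auto simp: Ti_def Vi_def Ls_def Vs_def Vis_def intro: star_mat_carrier)
  note [simp] = carr[THEN carrier_matD(1)] carr[THEN carrier_matD(2)] carrier_matD[OF X] carrier_matD[OF T(1)]
    carrier_matD[OF Vc] carrier_matD[OF L_carrier] carrier_matD[OF J_carrier]
  have ii: "T * Ti = 1\<^sub>m (2 * n)" "Ti * T = 1\<^sub>m (2 * n)" "V * Vi = 1\<^sub>m (2 * n)" "Vi * V = 1\<^sub>m (2 * n)"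
    using mat_inv[OF T] mat_inv[OF Vc V(2)] by (auto simp: Ti_def Vi_def)
  have isv: "Vis * Vs = 1\<^sub>m (2 * n)" "Vs * Vis = 1\<^sub>m (2 * n)"
    unfolding Vis_def Vs_def by (subst star_mat_mult[symmetric], simp, simp only: ii star_mat_simps)+
  note c = ii[THEN mult_cancel_left_dim] isv[THEN mult_cancel_left_dim]
  have S_eq: "S = Vi * (J * Vis)" by (simp add: S_def Vi_def[symmetric] Vis_def[symmetric] matalg)
  show Sc: "S \<in> carrier_mat (2 * n) (2 * n)" by (auto simp: S_eq intro!: carrier_matI)
  note [simp] = carrier_matD[OF Sc]
  have VSVs: "V * (S * Vs) = J" by (simp add: S_eq matalg c isv)
  show "star_mat st S = (- eps) \<cdot>\<^sub>m S"
    by (simp add: S_eq starmat star_J matalg Vis_def)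
  show "invertible_mat S"
  proof -
    have "invertible_mat Vi" by (rule invertible_matI(2)[OF Vc carr(2) ii(3)])
    moreover have "invertible_mat Vis" by (rule invertible_matI(1)[OF carr(5) carr(4) isv(1)])
    ultimately show ?thesis unfolding S_eq
      using invertible_mat_mult[OF carr(2) _ _ invertible_mat_mult[OF J_carrier carr(5) J_invertible]]
        J_carrier carr by auto
  qed
  have LsE: "Vs * Ls = star_mat st T * Vs"
    using arg_cong[OF LV, of "star_mat st"] by (simp add: starmat Ls_def Vs_def)
  have VTS: "V * (T * (S * (star_mat st T * Vs))) = J"
  proof -
    have "V * (T * (S * (star_mat st T * Vs))) = (V * T) * (S * (Vs * Ls))"
      unfolding LsE by (simp add: matalg)
    also have "\<dots> = L * (V * (S * Vs)) * Ls" unfolding LV[symmetric] by (simp add: matalg)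
    also have "\<dots> = J" unfolding VSVs using L_J_star_L by (simp add: Ls_def)
    finally show ?thesis .
  qed
  show TSTs: "T * S * star_mat st T = S"
  proof -
    have "T * S * star_mat st T = Vi * (V * (T * (S * (star_mat st T * Vs)))) * Vis"
      by (simp add: matalg c isv)
    also have "\<dots> = S" unfolding VTS by (simp add: S_eq matalg)
    finally show ?thesis .
  qed
  have STs: "S * star_mat st T = Ti * S"
  proof -
    have "Ti * (T * S * star_mat st T) = S * star_mat st T"
      by (simp add: matalg c)
    then show ?thesis unfolding TSTs by simp
  qed
  define Xs where "Xs = star_mat st X"
  have [simp]: "dim_row Xs = 2 * n" "dim_col Xs = n" by (auto simp: Xs_def)
  have V_eq: "V = X @\<^sub>r (- (X * Ti))" by (simp add: V Ti_def)
  have Vs_eq: "Vs = append_cols Xs (- (star_mat st Ti * Xs))"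
    unfolding Vs_def V_eq by (simp add: star_append_rows starmat Xs_def)
  have SVs: "Z * Vs = append_cols (Z * Xs) (- (Z * (star_mat st Ti * Xs)))" if "dim_col Z = 2 * n" for Z
    unfolding Vs_eq using that by (subst mult_append_cols) (auto simp: matalg)
  have blk: "V * (Z * Vs) = four_block_mat (X * (Z * Xs)) (- (X * (Z * (star_mat st Ti * Xs))))
      (- (X * (Ti * (Z * Xs)))) (X * (Ti * (Z * (star_mat st Ti * Xs))))" 
    if "dim_row Z = 2 * n" "dim_col Z = 2 * n" for Z
    unfolding SVs[OF that(2)] V_eq using that by (subst append_rows_mult_append_cols) (auto simp: matalg)
  note VSVs_blk = VSVs[unfolded blk[OF carrier_matD[OF Sc]] J_eq]
  have N1: "- (X * (Ti * (S * Xs))) = (- eps) \<cdot>\<^sub>m A1i"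
    by (rule four_block_inject(3)[OF VSVs_blk, of n n n n]) (auto intro!: carrier_matI)
  have "X * (S * Xs) = 0\<^sub>m n n"
    by (rule four_block_inject(1)[OF VSVs_blk, of n n n n]) (auto intro!: carrier_matI)
  then show "X * S * star_mat st X = 0\<^sub>m n n" by (simp add: matalg Xs_def)
  from N1 have N1: "X * mat_inv T * S * star_mat st X = eps \<cdot>\<^sub>m A1i"
    by (simp add: matalg Xs_def[symmetric] Ti_def[symmetric])
  have i1: "(eps \<cdot>\<^sub>m A1i) * (eps \<cdot>\<^sub>m A1) = 1\<^sub>m n" by (simp add: matalg invs eps_simps)
  show "invertible_mat (X * mat_inv T * S * star_mat st X)"
    unfolding N1 by (rule invertible_matI(1)[OF _ _ i1]) (auto intro!: carrier_matI)
  have "mat_inv (eps \<cdot>\<^sub>m A1i) = eps \<cdot>\<^sub>m A1"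
    by (rule mat_inv_unique[OF _ _ i1]) (auto intro!: carrier_matI)
  then show A1_eq: "A1 = coeff_A1 eps st X T S"
    unfolding coeff_A1_def N1 by (simp add: matalg eps_simps)
  have "V * ((S * star_mat st T) * Vs) = J * Ls"
    unfolding VSVs[symmetric] using LsE by (simp add: matalg)
  then have *: "V * ((Ti * S) * Vs) = J * Ls" unfolding STs .
  have "dim_row (Ti * S) = 2 * n" "dim_col (Ti * S) = 2 * n" by auto
  from *[unfolded blk[OF this] Ls_def J_star_L]
  have "- (X * (Ti * (Ti * S * Xs))) = A1i * (A0 * A1i)"
    by (rule four_block_inject(3)[of _ _ _ _ _ _ _ _ n n n n]) (auto intro!: carrier_matI)
  then have "A1 * (- (X * (Ti * (Ti * S * Xs)))) * A1 = A0"
    by (simp add: matalg invs invs_cancel)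
  then show "A0 = coeff_A0 eps st X T S"
    unfolding coeff_A0_def A1_eq[symmetric]
    by (simp add: matalg Ti_def[symmetric] Xs_def[symmetric] numeral_2_eq_2)
qed

end

section \<open>Spectra\<close>

lemma star_det: "A \<in> carrier_mat n n \<Longrightarrow> det (star_mat st A) = star_scalar st (det A)"
proof -
  assume A: "A \<in> carrier_mat n n"
  have "det (map_mat cnj A) = cnj (det A)"
  proof -
    interpret cnj: comm_ring_hom cnj by unfold_locales auto
    show ?thesis by simp
  qed
  moreover have "mat_adjoint A = transpose_mat (map_mat cnj A)"
    by (rule eq_matI) auto
  ultimately show ?thesis
    using A by (cases st) (auto simp: star_scalar_def det_transpose[of _ n])
qed

lemma spectrum_iff_det:
  fixes A :: "'a :: field mat"
  assumes "A \<in> carrier_mat n n"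
  shows "x \<in> spectrum A \<longleftrightarrow> det (char_matrix A x) = 0"
  using eigenvalue_det[OF assms] by (simp add: spectrum_def)

lemma spectrum_iff_root:
  fixes A :: "'a :: field mat"
  assumes "A \<in> carrier_mat n n"
  shows "x \<in> spectrum A \<longleftrightarrow> poly (char_poly A) x = 0"
  using eigenvalue_root_char_poly[OF assms] by (simp add: spectrum_def)

lemma spectrum_similar: "similar_mat A (B :: 'a :: field mat) \<Longrightarrow> spectrum A = spectrum B"
proof -
  assume sim: "similar_mat A B"
  from similar_matD[OF this] obtain n P Q where AB: "{A, B, P, Q} \<subseteq> carrier_mat n n" by blast
  then show ?thesis using char_poly_similar[OF sim] spectrum_iff_root[of A n] spectrum_iff_root[of B n] by auto
qed

lemma spectrum_star:
  assumes A: "A \<in> carrier_mat n n"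
  shows "x \<in> spectrum (star_mat st A) \<longleftrightarrow> star_scalar st x \<in> spectrum A"
proof -
  have "char_matrix (star_mat st A) x = star_mat st (char_matrix A (star_scalar st x))"
    unfolding char_matrix_def by (rule eq_matI) (use A in auto)
  moreover have "det (star_mat st (char_matrix A (star_scalar st x))) = star_scalar st (det (char_matrix A (star_scalar st x)))"
    by (rule star_det[of _ n]) (use A in auto)
  ultimately show ?thesis
    unfolding spectrum_iff_det[OF A] spectrum_iff_det[OF star_mat_carrier[OF A]]
    by (metis star_scalar_inject star_scalar_simps(6))
qed

lemma char_poly_nonzero: 
  fixes A :: "complex mat"
  shows "A \<in> carrier_mat n n \<Longrightarrow> char_poly A \<noteq> 0"
  using degree_monic_char_poly[of A n] by auto

lemma set_mat_eigenvalues: "A \<in> carrier_mat n n \<Longrightarrow> set_mset (mat_eigenvalues A) = spectrum A"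
  using char_poly_nonzero[of A n] spectrum_iff_root[of A n] by (auto simp: mat_eigenvalues_def)

lemma mat_eigenvalues_block_triangular:
  assumes "A \<in> carrier_mat n n" "B \<in> carrier_mat n m" "D \<in> carrier_mat m m"
  shows "mat_eigenvalues (four_block_mat A B (0\<^sub>m m n) D) = mat_eigenvalues A + mat_eigenvalues D"
proof -
  have "char_poly (four_block_mat A B (0\<^sub>m m n) D) = char_poly A * char_poly D"
    by (rule char_poly_0_block[OF refl]) (use assms char_poly_factorized[of A] char_poly_factorized[of D] in blast)+
  then show ?thesis using assms char_poly_nonzero[of A] char_poly_nonzero[of D]
    by (simp add: mat_eigenvalues_def proots_mult)
qed

section \<open>The Sylvester equation\<close>

lemma sylvester_column:
  assumes A: "A \<in> carrier_mat k k" and b: "b \<notin> spectrum A" and e: "e \<in> carrier_mat k m"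
  shows "\<exists>!z. z \<in> carrier_mat k m \<and> A * z = b \<cdot>\<^sub>m z + (e :: complex mat)"
proof -
  define C where "C = char_matrix A b"
  have C: "C \<in> carrier_mat k k" using A by (simp add: C_def)
  have "invertible_mat C" using b invertible_mat_iff_det[OF C] spectrum_iff_det[OF A] by (simp add: C_def)
  note Ci = mat_inv[OF C this]
  have C_mult: "C * z = A * z + (- (b \<cdot>\<^sub>m z))" if "z \<in> carrier_mat k m" for z
    unfolding C_def char_matrix_def using that A by (simp add: matalg) 
  have iff: "A * z = b \<cdot>\<^sub>m z + e \<longleftrightarrow> z = mat_inv C * e" if z: "z \<in> carrier_mat k m" for z
  proof -
    have "A * z = b \<cdot>\<^sub>m z + e \<longleftrightarrow> C * z = e"
    proof
      assume *: "A * z = b \<cdot>\<^sub>m z + e"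
      show "C * z = e" unfolding C_mult[OF z] * by (rule eq_matI) (use z e in auto)
    next
      assume *: "C * z = e"
      show "A * z = b \<cdot>\<^sub>m z + e" unfolding *[symmetric] C_mult[OF z] 
        by (rule eq_matI) (use z e A in auto)
    qed
    also have "\<dots> \<longleftrightarrow> z = mat_inv C * e"
      using mult_cancel_left_dim[OF Ci(2), of e] mult_cancel_left_dim[OF Ci(3), of z] C Ci(1) e z
      by (metis carrier_matD)
    finally show ?thesis .
  qed
  show ?thesis
    by (rule ex1I[of _ "mat_inv C * e"]) (use iff Ci(1) e in auto)
qed

text \<open>
  The first column \<open>z\<close> of the unknown only meets the first diagonal entry \<open>\<beta>\<close> of \<open>B\<close>, which gives the
  nonsingular system \<open>(A - \<beta>) z = e\<close>. With \<open>z\<close> known, the other columns satisfy an equation of the same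
  kind for the lower right block of \<open>B\<close>. Proving unique existence by one induction serves both uses:
  existence decouples invariant subspaces, uniqueness makes the form block diagonal.
\<close>
lemma sylvester_upper_triangular:
  assumes A: "A \<in> carrier_mat k k"
  shows "B \<in> carrier_mat m m \<Longrightarrow> upper_triangular B \<Longrightarrow> (\<And>j. j < m \<Longrightarrow> B $$ (j, j) \<notin> spectrum A) \<Longrightarrow>
    E \<in> carrier_mat k m \<Longrightarrow> \<exists>!Z. Z \<in> carrier_mat k m \<and> A * Z = Z * B + (E :: complex mat)"
proof (induction m arbitrary: B E)
  case 0
  show ?case
    by (rule ex1I[of _ "0\<^sub>m k 0"]) (use 0 A in \<open>auto intro!: eq_matI\<close>)
next
  case (Suc m)
  from Suc.prems(1) have "B \<in> carrier_mat (1 + m) (1 + m)" by simp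
  from split_four_block[OF this] obtain b r x B' where
    bl: "b \<in> carrier_mat 1 1" "r \<in> carrier_mat 1 m" "x \<in> carrier_mat m 1" "B' \<in> carrier_mat m m"
    and B: "B = four_block_mat b r x B'" by metis
  have x: "x = 0\<^sub>m m 1"
  proof (rule eq_matI)
    fix i j assume ij: "i < dim_row (0\<^sub>m m 1 :: complex mat)" "j < dim_col (0\<^sub>m m 1 :: complex mat)"
    have "B $$ (i + 1, j) = x $$ (i, j)" unfolding B using bl ij by simp
    moreover have "B $$ (i + 1, j) = 0" using Suc.prems(1,2) ij by (auto simp: upper_triangular_def)
    ultimately show "x $$ (i, j) = 0\<^sub>m m 1 $$ (i, j)" using ij by simp
  qed (use bl in auto)
  define \<beta> where "\<beta> = b $$ (0, 0)"
  have b: "b = \<beta> \<cdot>\<^sub>m 1\<^sub>m 1" by (rule eq_matI) (use bl in \<open>auto simp: \<beta>_def\<close>)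
  have "B $$ (0, 0) = \<beta>" unfolding B using bl by (simp add: \<beta>_def)
  then have \<beta>: "\<beta> \<notin> spectrum A" using Suc.prems(3)[of 0] by auto
  have B'_index: "B $$ (i + 1, j + 1) = B' $$ (i, j)" if "i < m" "j < m" for i j
    unfolding B using bl that by simp
  have ut: "upper_triangular B'"
    unfolding upper_triangular_def
  proof (intro allI impI)
    fix i j assume "i < dim_row B'" "j < i"
    then show "B' $$ (i, j) = 0" using B'_index[of i j] Suc.prems(1,2) bl unfolding upper_triangular_def by force
  qed
  have diag: "B' $$ (j, j) \<notin> spectrum A" if "j < m" for j
    using Suc.prems(3)[of "j + 1"] B'_index[OF that that] that by auto
  from Suc.prems(4) have "E \<in> carrier_mat k (1 + m)" by simp
  from split_cols[OF this] obtain e E' where E: "e \<in> carrier_mat k 1" "E' \<in> carrier_mat k m" "E = append_cols e E'" by metis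
  have eq_iff: "A * append_cols z Z = append_cols z Z * B + E \<longleftrightarrow>
      A * z = \<beta> \<cdot>\<^sub>m z + e \<and> A * Z = Z * B' + (z * r + E')"
    if z: "z \<in> carrier_mat k 1" "Z \<in> carrier_mat k m" for z Z
  proof -
    have 1: "A * append_cols z Z = append_cols (A * z) (A * Z)"
      using z A by (subst mult_append_cols) auto
    have "append_cols z Z * B = append_cols (\<beta> \<cdot>\<^sub>m z) (z * r + Z * B')"
      unfolding B x b using z bl
      by (subst append_cols_mult_four_block) (auto simp: matalg)
    then have 2: "append_cols z Z * B + E = append_cols (\<beta> \<cdot>\<^sub>m z + e) (Z * B' + (z * r + E'))"
      unfolding E(3) by (simp, intro eq_matI) (use z bl E A in \<open>auto simp: algebra_simps simp del: index_mult_mat(1)\<close>)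
    show ?thesis
    proof
      assume "A * append_cols z Z = append_cols z Z * B + E"
      then have "append_cols (A * z) (A * Z) = append_cols (\<beta> \<cdot>\<^sub>m z + e) (Z * B' + (z * r + E'))"
        unfolding 1 2 .
      from append_cols_inject[OF this] show "A * z = \<beta> \<cdot>\<^sub>m z + e \<and> A * Z = Z * B' + (z * r + E')"
        using z bl E A by auto
    next
      assume "A * z = \<beta> \<cdot>\<^sub>m z + e \<and> A * Z = Z * B' + (z * r + E')"
      then show "A * append_cols z Z = append_cols z Z * B + E" unfolding 1 2 by simp
    qed
  qed
  obtain z where z: "z \<in> carrier_mat k 1" "A * z = \<beta> \<cdot>\<^sub>m z + e"
    and z_unique: "\<And>z'. z' \<in> carrier_mat k 1 \<Longrightarrow> A * z' = \<beta> \<cdot>\<^sub>m z' + e \<Longrightarrow> z' = z"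
    using sylvester_column[OF A \<beta> E(1)] by blast
  have "z * r + E' \<in> carrier_mat k m" using z bl E by simp
  from Suc.IH[OF bl(4) ut diag this]
  obtain Z where Z: "Z \<in> carrier_mat k m" "A * Z = Z * B' + (z * r + E')"
    and Z_unique: "\<And>Z'. Z' \<in> carrier_mat k m \<Longrightarrow> A * Z' = Z' * B' + (z * r + E') \<Longrightarrow> Z' = Z"
    by blast
  show ?case
  proof (rule ex1I[of _ "append_cols z Z"])
    show "append_cols z Z \<in> carrier_mat k (Suc m) \<and> A * append_cols z Z = append_cols z Z * B + E"
      using eq_iff z Z by (auto intro!: carrier_matI)
  next
    fix Y assume Y: "Y \<in> carrier_mat k (Suc m) \<and> A * Y = Y * B + E"
    then have "Y \<in> carrier_mat k (1 + m)" by simp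
    from split_cols[OF this] obtain y Y' where Y': "y \<in> carrier_mat k 1" "Y' \<in> carrier_mat k m" "Y = append_cols y Y'" by metis
    then have "A * y = \<beta> \<cdot>\<^sub>m y + e \<and> A * Y' = Y' * B' + (y * r + E')" using Y eq_iff by auto
    then have "y = z" "Y' = Z" using z_unique Z_unique Y' by auto
    then show "Y = append_cols z Z" using Y' by simp
  qed
qed

lemma sylvester:
  fixes A B E :: "complex mat"
  assumes A: "A \<in> carrier_mat k k" and B: "B \<in> carrier_mat m m"
    and disj: "spectrum A \<inter> spectrum B = {}" and E: "E \<in> carrier_mat k m"
  shows "\<exists>!Z. Z \<in> carrier_mat k m \<and> A * Z = Z * B + E"
proof -
  obtain es where es: "char_poly B = (\<Prod>a\<leftarrow>es. [:- a, 1:])" using char_poly_factorized[OF B] by auto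
  obtain B' where B': "B' \<in> carrier_mat m m" "upper_triangular B'" "similar_mat B B'"
    using schur_decomposition_exists[OF B es] by auto
  have diag: "B' $$ (j, j) \<notin> spectrum A" if "j < m" for j
  proof -
    have "poly (char_poly B') (B' $$ (j, j)) = 0"
      unfolding char_poly_upper_triangular[OF B'(1,2)] using that B'(1)
      by (auto simp: poly_prod_list prod_list_zero_iff diag_mat_def)
    then have "B' $$ (j, j) \<in> spectrum B"
      using spectrum_iff_root[OF B'(1)] spectrum_similar[OF B'(3)] by simp
    then show ?thesis using disj by auto
  qed
  from B'(3) obtain P Q where "similar_mat_wit B B' P Q" unfolding similar_mat_def by blast
  note PQ = similar_mat_witD2[OF B this]
  note [simp] = carrier_matD[OF A] carrier_matD[OF B] carrier_matD[OF B'(1)] carrier_matD[OF PQ(6)] carrier_matD[OF PQ(7)]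
     carrier_matD[OF E]
  note c = PQ(1,2) mult_cancel_left_dim[OF PQ(1)] mult_cancel_left_dim[OF PQ(2)]
  have E': "E * P \<in> carrier_mat k m" by (auto intro!: carrier_matI)
  from sylvester_upper_triangular[OF A B'(1,2) diag E'] obtain Z where Z: "Z \<in> carrier_mat k m" "A * Z = Z * B' + E * P"
    and uniq: "\<And>Y. Y \<in> carrier_mat k m \<Longrightarrow> A * Y = Y * B' + E * P \<Longrightarrow> Y = Z"
    by blast
  note [simp] = carrier_matD[OF Z(1)]
  show ?thesis
  proof (rule ex1I[of _ "Z * Q"])
    have "A * (Z * Q) = (A * Z) * Q" by (simp add: matalg)
    also have "\<dots> = Z * Q * B + E" unfolding Z(2) unfolding PQ(3) by (simp add: matalg c)
    finally show "Z * Q \<in> carrier_mat k m \<and> A * (Z * Q) = Z * Q * B + E" by (auto intro!: carrier_matI)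
  next
    fix Y assume Y: "Y \<in> carrier_mat k m \<and> A * Y = Y * B + E"
    then have [simp]: "dim_row Y = k" "dim_col Y = m" by auto
    have "A * (Y * P) = (A * Y) * P" by (simp add: matalg)
    also have "\<dots> = (Y * B + E) * P" using Y by simp
    also have "\<dots> = Y * P * B' + E * P" unfolding PQ(3) by (simp add: matalg c)
    finally have "Y * P = Z" by (intro uniq) (auto intro!: carrier_matI)
    then show "Y = Z * Q" by (auto simp: matalg c)
  qed
qed

corollary sylvester_zero:
  fixes A B Z :: "complex mat"
  assumes "A \<in> carrier_mat k k" "B \<in> carrier_mat m m" "spectrum A \<inter> spectrum B = {}"
    "Z \<in> carrier_mat k m" "A * Z = Z * B"
  shows "Z = 0\<^sub>m k m"
proof -
  have "A * Z = Z * B + 0\<^sub>m k m" "A * 0\<^sub>m k m = 0\<^sub>m k m * B + 0\<^sub>m k m"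
    using assms by (auto simp: matalg)
  then show ?thesis
    using sylvester[OF assms(1-3) zero_carrier_mat] assms(4) zero_carrier_mat by blast
qed

section \<open>Completing a matrix of full column rank\<close>

lemma (in vec_space) distinct_cols_of_full_rank:
  assumes A: "A \<in> carrier_mat n k" and r: "rank A = k"
  shows "distinct (cols A)"
proof -
  obtain S where S: "maximal S (\<lambda>T. T \<subseteq> set (cols A) \<and> lin_indpt T)"
    using maximal_exists[of "(\<lambda>T. T \<subseteq> set (cols A) \<and> lin_indpt T)" "card (set (cols A))" "{}"]
    by (meson List.finite_set card_mono empty_iff empty_subsetI finite_lin_indpt2 rev_finite_subset)
  then have "card S \<le> card (set (cols A))" by (simp add: card_mono maximal_def)
  then have "length (cols A) \<le> card (set (cols A))" using rank_card_indpt[OF A S] r A by simp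
  then show ?thesis using card_length[of "cols A"] by (intro card_distinct le_antisym)
qed

text \<open>
  The replacement theorem extends the independent columns by at most \<open>n - k\<close> vectors to a generating
  set, which is a basis by counting.
\<close>
lemma (in vec_space) full_rank_completion:
  assumes K: "K \<in> carrier_mat n k" and r: "rank K = k"
  shows "k \<le> n \<and> (\<exists>G \<in> carrier_mat n (n - k). \<forall>V \<in> carrier_mat n n. cols V = cols K @ cols G \<longrightarrow> det V \<noteq> 0)"
proof -
  note dist = distinct_cols_of_full_rank[OF K r]
  note li = full_rank_lin_indpt[OF K r dist]
  have colsK: "set (cols K) \<subseteq> carrier_vec n" using cols_dim K by blast
  have cardK: "card (set (cols K)) = k" using dist K by (simp add: distinct_card)
  have "card (set (unit_vecs n :: 'a vec list)) = n"
    unfolding distinct_card[OF unit_vecs_distinct] by (rule unit_vecs_length)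
  moreover have "set (unit_vecs n :: 'a vec list) \<subseteq> carrier V" by (auto simp: unit_vecs_def)
  ultimately obtain C where C: "finite C" "C \<subseteq> carrier_vec n" "C \<inter> set (cols K) = {}"
    "int (card C) \<le> int n - int k" "span (set (cols K) \<union> C) = carrier_vec n"
    using replacement[of "set (cols K)" "set (unit_vecs n)"] li colsK cardK span_unit_vecs_is_carrier by auto
  have cardU: "card (set (cols K) \<union> C) = k + card C"
    using C cardK by (subst card_Un_disjoint) auto
  have basis: "basis (set (cols K) \<union> C)"
    by (rule dim_gen_is_basis) (use C colsK cardU dim_is_n in auto)
  then have "dim = k + card C" using dim_basis[OF _ basis] C cardU by simp
  then have cardC: "card C = n - k" "k \<le> n" using dim_is_n by auto
  obtain cs where cs: "set cs = C" "distinct cs" using finite_distinct_list[OF C(1)] by auto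
  have lencs: "length cs = n - k" using cs cardC distinct_card by metis
  define G where "G = mat_of_cols n cs"
  have G: "G \<in> carrier_mat n (n - k)" "cols G = cs" 
    using lencs cs C by (auto simp: G_def intro!: cols_mat_of_cols)
  have "det V' \<noteq> 0" if "V' \<in> carrier_mat n n" "cols V' = cols K @ cs" for V'
  proof -
    have "rank V' = n"
      by (rule lin_indpt_full_rank[OF that(1)]) (use that cs C dist basis in \<open>auto simp: basis_def Un_commute\<close>)
    then show ?thesis using det_rank_iff[OF that(1)] by simp
  qed
  then show ?thesis using G cardC by auto
qed

lemma full_column_rank_completion:
  assumes K: "K \<in> carrier_mat n k" and r: "vec_space.rank n (K :: complex mat) = k"
  obtains G where "k \<le> n" "G \<in> carrier_mat n (n - k)" "invertible_mat (append_cols K G)"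
proof -
  interpret vec_space "TYPE(complex)" n .
  obtain G where G: "k \<le> n" "G \<in> carrier_mat n (n - k)" 
     "\<forall>V \<in> carrier_mat n n. cols V = cols K @ cols G \<longrightarrow> det V \<noteq> 0"
    using full_rank_completion[OF K r] by auto
  have V: "append_cols K G \<in> carrier_mat n n" using K G by (auto intro!: carrier_matI)
  have "cols (append_cols K G) = cols K @ cols G"
    by (rule nth_equalityI) (use K G in \<open>auto simp: nth_append col_def intro!: eq_vecI\<close>)
  then show thesis using that G V invertible_mat_iff_det[OF V] by auto
qed

section \<open>Splitting off the prescribed eigenpairs\<close>

context regular_palindromic
begin

text \<open>
  In a basis that extends \<open>K\<close>, the companion matrix is block triangular with diagonal blocks \<open>T1\<close> and \<open>F\<close>.
  The eigenvalues of \<open>F\<close> are the remaining ones, so the spectra are disjoint and a solution of the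
  Sylvester equation removes the off-diagonal block.
\<close>
lemma decouple:
  assumes K: "K \<in> carrier_mat (2 * n) k" and T1: "T1 \<in> carrier_mat k k" and k: "k \<le> 2 * n"
    and r: "vec_space.rank (2 * n) K = k" and LK: "L * K = K * T1"
    and disj: "set_mset (mat_eigenvalues L - mat_eigenvalues T1) \<inter> spectrum T1 = {}"
  obtains K2 F where "K2 \<in> carrier_mat (2 * n) (2 * n - k)" "F \<in> carrier_mat (2 * n - k) (2 * n - k)"
    "invertible_mat (append_cols K K2)" "L * append_cols K K2 = append_cols K K2 * four_block_mat T1 (0\<^sub>m k (2 * n - k)) (0\<^sub>m (2 * n - k) k) F"
    "spectrum T1 \<inter> spectrum F = {}"
proof -
  define m where "m = 2 * n - k"
  have km: "k + m = 2 * n" using k by (simp add: m_def)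
  obtain G where G: "G \<in> carrier_mat (2 * n) m" "invertible_mat (append_cols K G)"
    using full_column_rank_completion[OF K r] unfolding m_def by metis
  define V where "V = append_cols K G"
  have V: "V \<in> carrier_mat (2 * n) (2 * n)" using K G km by (auto simp: V_def intro!: carrier_matI)
  note Vi = mat_inv[OF V G(2)[folded V_def]]
  note [simp] = carrier_matD[OF K] carrier_matD[OF T1] carrier_matD[OF G(1)] carrier_matD[OF V] carrier_matD[OF Vi(1)]
    carrier_matD[OF L_carrier]
  note c = Vi(2,3) Vi(2,3)[THEN mult_cancel_left_dim]
  define N where "N = mat_inv V * L * V"
  have N: "N \<in> carrier_mat (k + m) (k + m)" unfolding km by (auto simp: N_def intro!: carrier_matI)
  have VN: "V * N = L * V" by (simp add: N_def matalg c)
  from split_four_block[OF N] obtain N1 E N3 F where 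
    bl: "N1 \<in> carrier_mat k k" "E \<in> carrier_mat k m" "N3 \<in> carrier_mat m k" "F \<in> carrier_mat m m"
    and N_eq: "N = four_block_mat N1 E N3 F" by metis
  note [simp] = bl[THEN carrier_matD(1)] bl[THEN carrier_matD(2)]
  have "V * (N1 @\<^sub>r N3) = L * K"
  proof -
    have "append_cols (V * (N1 @\<^sub>r N3)) (V * (E @\<^sub>r F)) = V * append_cols (N1 @\<^sub>r N3) (E @\<^sub>r F)"
      by (subst mult_append_cols) (auto simp: km)
    also have "append_cols (N1 @\<^sub>r N3) (E @\<^sub>r F) = N" unfolding N_eq by (rule eq_matI) auto
    also have "V * N = append_cols (L * K) (L * G)" unfolding VN unfolding V_def by (subst mult_append_cols) auto
    finally show ?thesis by (rule append_cols_inject(1)) auto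
  qed
  also have "\<dots> = V * (T1 @\<^sub>r 0\<^sub>m m k)"
    unfolding LK V_def by (subst append_cols_mult_append_rows) (auto simp: matalg)
  finally have "mat_inv V * (V * (N1 @\<^sub>r N3)) = mat_inv V * (V * (T1 @\<^sub>r 0\<^sub>m m k))" by simp
  then have "N1 @\<^sub>r N3 = T1 @\<^sub>r 0\<^sub>m m k" by (simp add: c km)
  from append_rows_inject[OF this] have N13: "N1 = T1" "N3 = 0\<^sub>m m k" by auto
  have "similar_mat L N"
    by (rule similar_matI[of _ _ V "mat_inv V" "2 * n"]) (use V Vi L_carrier N km in \<open>auto simp: N_def matalg c\<close>)
  then have "mat_eigenvalues L = mat_eigenvalues N" unfolding mat_eigenvalues_def by (simp add: char_poly_similar)
  also have "\<dots> = mat_eigenvalues T1 + mat_eigenvalues F"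
    unfolding N_eq N13 by (rule mat_eigenvalues_block_triangular) (use T1 bl in auto)
  finally have disjF: "spectrum T1 \<inter> spectrum F = {}"
    using disj set_mat_eigenvalues[OF bl(4)] by auto
  then obtain Z where Z: "Z \<in> carrier_mat k m" "T1 * Z = Z * F + (- E)"
    using sylvester[OF T1 bl(4) disjF, of "- E"] bl by auto
  note [simp] = carrier_matD[OF Z(1)]
  define K2 where "K2 = K * Z + G"
  have K2c: "K2 \<in> carrier_mat (2 * n) m" by (auto simp: K2_def intro!: carrier_matI)
  define P where "P = four_block_mat (1\<^sub>m k) Z (0\<^sub>m m k) (1\<^sub>m m)"
  have P: "P \<in> carrier_mat (2 * n) (2 * n)" using km by (auto simp: P_def intro!: carrier_matI)
  have "det P = 1" unfolding P_def by (subst det_four_block_mat_lower_left_zero[of _ k _ m]) (use Z in auto)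
  then have Pinv: "invertible_mat P" using invertible_mat_iff_det[OF P] by simp
  have VP: "V * P = append_cols K K2" unfolding V_def P_def
    by (subst append_cols_mult_four_block) (auto simp: matalg K2_def)
  have "N * P = P * four_block_mat T1 (0\<^sub>m k m) (0\<^sub>m m k) F"
  proof -
    have "T1 * Z + E = Z * F" unfolding Z(2) by (rule eq_matI) auto
    then show ?thesis unfolding N_eq N13 P_def 
      by (subst (1 2) four_block_mult_dim) (simp_all add: matalg)
  qed
  then have "V * (N * P) = V * (P * four_block_mat T1 (0\<^sub>m k m) (0\<^sub>m m k) F)" by simp
  then have "L * (V * P) = V * P * four_block_mat T1 (0\<^sub>m k m) (0\<^sub>m m k) F"
    using P N km VN by (simp flip: mult_assoc_dim)
  then show thesis
    using that[of K2 F] K2c bl disjF invertible_mat_mult[OF V P G(2)[folded V_def] Pinv] 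
    unfolding VP m_def by blast
qed

end

section \<open>Unitary matrices\<close>

text \<open>
  For unitary \<open>Z\<close> the inverse of \<open>Z\<^sup>\<star>\<close> is \<open>twist st Z\<close>: the matrix \<open>Z\<close> itself for the conjugate transpose, its
  entrywise conjugate for the transpose. Eigenvectors of Hermitian matrices and the coneigenvectors
  \<open>B (cnj z) = \<sigma> z\<close> of symmetric matrices thus have the common description \<open>B * twist st z = \<sigma> z\<close>.
\<close>
definition twist :: "star \<Rightarrow> complex mat \<Rightarrow> complex mat" where
  "twist st A = star_mat st (mat_adjoint A)"

lemma dim_twist [simp]: "dim_row (twist st A) = dim_row A" "dim_col (twist st A) = dim_col A"
  by (auto simp: twist_def)

lemma index_twist [simp]:
  "i < dim_row A \<Longrightarrow> j < dim_col A \<Longrightarrow> twist st A $$ (i, j) = star_scalar st (cnj (A $$ (i, j)))"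
  by (auto simp: twist_def)

lemma twist_ConjTranspose [simp]: "twist ConjTranspose A = A"
  by (rule eq_matI) (auto simp: star_scalar_def)

lemma adjoint_simps:
  "dim_col A = dim_row B \<Longrightarrow> mat_adjoint (A * B) = mat_adjoint B * mat_adjoint A"
  "dim_row A = dim_row B \<Longrightarrow> dim_col A = dim_col B \<Longrightarrow> mat_adjoint (A + B) = mat_adjoint A + mat_adjoint B"
  "mat_adjoint (c \<cdot>\<^sub>m A) = cnj c \<cdot>\<^sub>m mat_adjoint A"
  "mat_adjoint (- A) = - mat_adjoint A"
  "mat_adjoint (mat_adjoint A) = A"
  "mat_adjoint (1\<^sub>m n) = (1\<^sub>m n :: complex mat)"
  "mat_adjoint (0\<^sub>m n m) = (0\<^sub>m m n :: complex mat)"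
  using star_mat_mult[of A B ConjTranspose] star_mat_add[of A B ConjTranspose]
    star_mat_smult[of ConjTranspose c A] star_mat_uminus[of ConjTranspose A] star_mat_simps[of ConjTranspose]
  by (auto simp: star_scalar_def)

lemma twist_mult: "dim_col A = dim_row B \<Longrightarrow> twist st (A * B) = twist st A * twist st B"
  by (simp add: twist_def adjoint_simps star_mat_mult)

lemma twist_add: "dim_row A = dim_row B \<Longrightarrow> dim_col A = dim_col B \<Longrightarrow> twist st (A + B) = twist st A + twist st B"
  by (simp add: twist_def adjoint_simps star_mat_add)

lemma twist_smult: "twist st (c \<cdot>\<^sub>m A) = star_scalar st (cnj c) \<cdot>\<^sub>m twist st A"
  by (simp add: twist_def adjoint_simps star_mat_smult)

lemma twist_uminus: "twist st (- A) = - twist st A"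
  by (simp add: twist_def adjoint_simps star_mat_uminus)

lemma twist_simps [simp]: "twist st (twist st A) = A" "twist st (1\<^sub>m n) = 1\<^sub>m n"
  by (rule eq_matI; auto simp: star_scalar_def)+

lemma twist_append_cols:
  "dim_row A = dim_row B \<Longrightarrow> twist st (append_cols A B) = append_cols (twist st A) (twist st B)"
  by (rule eq_matI) auto

lemma star_twist: "star_mat st (twist st A) = mat_adjoint A" "star_mat st (mat_adjoint A) = twist st A"
  by (simp_all add: twist_def)

lemma twist_star: "twist st (star_mat st A) = mat_adjoint A"
  by (rule eq_matI) (auto simp: star_scalar_def)

lemma twist_symmetric: "star_mat st B = B \<Longrightarrow> twist st B = mat_adjoint B"
  using twist_star[of st B] by simp

lemma twist_skew: "star_mat st B = - B \<Longrightarrow> mat_adjoint B = - twist st B"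
  using twist_star[of st B] by (simp add: twist_uminus)

lemma adjoint_append_cols:
  "dim_row A = dim_row B \<Longrightarrow> mat_adjoint (append_cols A B) = mat_adjoint A @\<^sub>r mat_adjoint B"
  using star_append_cols[of A B ConjTranspose] by simp

definition unitary :: "nat \<Rightarrow> complex mat \<Rightarrow> bool" where
  "unitary m Z \<longleftrightarrow> Z \<in> carrier_mat m m \<and> mat_adjoint Z * Z = 1\<^sub>m m"

lemma adjoint_carrier: "Z \<in> carrier_mat m k \<Longrightarrow> mat_adjoint Z \<in> carrier_mat k m"
  by (intro carrier_matI) auto

lemma unitaryD:
  assumes "unitary m Z"
  shows "Z \<in> carrier_mat m m" "mat_adjoint Z * Z = 1\<^sub>m m" "Z * mat_adjoint Z = 1\<^sub>m m"
proof -
  show Z: "Z \<in> carrier_mat m m" "mat_adjoint Z * Z = 1\<^sub>m m" using assms by (auto simp: unitary_def)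
  show "Z * mat_adjoint Z = 1\<^sub>m m"
    by (rule mat_mult_left_right_inverse[OF adjoint_carrier[OF Z(1)] Z])
qed

lemma unitary_mult:
  assumes "unitary m Y" "unitary m Z"
  shows "unitary m (Y * Z)"
proof -
  note Y = unitaryD[OF assms(1)] and Z = unitaryD[OF assms(2)]
  show ?thesis unfolding unitary_def
    using Y(1) Z(1) mult_cancel_left_dim[OF Y(2), of Z] Z(2) by (auto simp: adjoint_simps matalg)
qed

lemma unitary_block:
  assumes "unitary m Z"
  shows "unitary (r + m) (four_block_mat (1\<^sub>m r) (0\<^sub>m r m) (0\<^sub>m m r) Z)"
proof -
  note Z = unitaryD[OF assms]
  have "mat_adjoint (four_block_mat (1\<^sub>m r) (0\<^sub>m r m) (0\<^sub>m m r) Z) =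
     four_block_mat (1\<^sub>m r) (0\<^sub>m r m) (0\<^sub>m m r) (mat_adjoint Z)"
    using star_mat_four_block[of "0\<^sub>m r m" "1\<^sub>m r" "0\<^sub>m m r" Z ConjTranspose] Z(1) by (simp add: adjoint_simps)
  moreover have "four_block_mat (1\<^sub>m r) (0\<^sub>m r m) (0\<^sub>m m r) (mat_adjoint Z) * four_block_mat (1\<^sub>m r) (0\<^sub>m r m) (0\<^sub>m m r) Z
      = four_block_mat (1\<^sub>m r) (0\<^sub>m r m) (0\<^sub>m m r) (1\<^sub>m m)"
    using Z by (subst four_block_mult_dim) (auto simp: matalg)
  moreover have "four_block_mat (1\<^sub>m r) (0\<^sub>m r m) (0\<^sub>m m r) (1\<^sub>m m) = (1\<^sub>m (r + m) :: complex mat)"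
    by (rule eq_matI) auto
  ultimately show ?thesis using Z(1) by (auto simp: unitary_def intro!: carrier_matI)
qed

lemma star_twist_cancel:
  assumes "unitary m Z"
  shows "star_mat st Z * twist st Z = 1\<^sub>m m" "twist st Z * star_mat st Z = 1\<^sub>m m"
proof -
  note Z = unitaryD[OF assms]
  have 1: "star_mat st (mat_adjoint Z * Z) = star_mat st Z * twist st Z"
    and 2: "star_mat st (Z * mat_adjoint Z) = twist st Z * star_mat st Z"
    using Z(1) by (auto simp: star_mat_mult star_twist)
  show "star_mat st Z * twist st Z = 1\<^sub>m m" unfolding 1[symmetric] Z(2) by simp
  show "twist st Z * star_mat st Z = 1\<^sub>m m" unfolding 2[symmetric] Z(3) by simp
qed

text \<open>
  The squared Euclidean norm of the first column, used for matrices with a single column.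
\<close>
definition norm_sq_col :: "complex mat \<Rightarrow> real" where
  "norm_sq_col z = (\<Sum>l<dim_row z. (cmod (z $$ (l, 0)))\<^sup>2)"

lemma norm_sq_col:
  assumes "z \<in> carrier_mat m 1"
  shows "mat_adjoint z * z = of_real (norm_sq_col z) \<cdot>\<^sub>m 1\<^sub>m 1"
  by (rule eq_matI) (use assms in \<open>auto simp: scalar_prod_def norm_sq_col_def complex_norm_square
        mult.commute lessThan_atLeast0 simp del: of_real_power intro!: sum.cong\<close>)

lemma smult_one_injectD: "c \<cdot>\<^sub>m 1\<^sub>m 1 = d \<cdot>\<^sub>m 1\<^sub>m 1 \<Longrightarrow> c = (d :: complex)"
proof -
  assume "c \<cdot>\<^sub>m 1\<^sub>m 1 = d \<cdot>\<^sub>m 1\<^sub>m 1"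
  then have "(c \<cdot>\<^sub>m 1\<^sub>m 1) $$ (0, 0) = (d \<cdot>\<^sub>m 1\<^sub>m 1) $$ (0, 0)" by (rule arg_cong)
  then show "c = d" by simp
qed

lemma norm_sq_col_nonneg: "norm_sq_col z \<ge> 0"
  by (auto simp: norm_sq_col_def intro: sum_nonneg)

lemma norm_sq_col_eq_0: "z \<in> carrier_mat m 1 \<Longrightarrow> norm_sq_col z = 0 \<longleftrightarrow> z = 0\<^sub>m m 1"
proof
  assume z: "z \<in> carrier_mat m 1" and "norm_sq_col z = 0"
  then have "\<forall>l<m. z $$ (l, 0) = 0"
    by (auto simp: norm_sq_col_def sum_nonneg_eq_0_iff)
  then show "z = 0\<^sub>m m 1" by (intro eq_matI) (use z in auto)
qed (auto simp: norm_sq_col_def)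

lemma normalized_column:
  fixes z :: "complex mat"
  assumes z: "z \<in> carrier_mat m 1" "z \<noteq> 0\<^sub>m m 1"
  obtains c :: real where "c > 0" "mat_adjoint (of_real c \<cdot>\<^sub>m z) * (of_real c \<cdot>\<^sub>m z) = 1\<^sub>m 1"
proof -
  have pos: "norm_sq_col z > 0" using norm_sq_col_nonneg[of z] norm_sq_col_eq_0[OF z(1)] z(2) by linarith
  define c where "c = 1 / sqrt (norm_sq_col z)"
  have c: "c > 0" using pos by (simp add: c_def)
  have "c * (c * norm_sq_col z) = 1" using pos by (simp add: c_def)
  then have "complex_of_real c * (complex_of_real c * complex_of_real (norm_sq_col z)) = 1"
    by (metis of_real_mult of_real_1)
  then have "mat_adjoint (of_real c \<cdot>\<^sub>m z) * (of_real c \<cdot>\<^sub>m z) = 1\<^sub>m 1"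
    using z(1) norm_sq_col[OF z(1)] by (simp add: adjoint_simps matalg mult.assoc)
  with c show thesis by (rule that)
qed

text \<open>
  Gram-Schmidt orthogonalization of a basis that starts with \<open>z\<close>, followed by normalization.
\<close>
lemma unitary_completion_column:
  fixes z :: "complex mat"
  assumes z: "z \<in> carrier_mat (Suc m) 1" "mat_adjoint z * z = 1\<^sub>m 1"
  obtains G where "G \<in> carrier_mat (Suc m) m" "unitary (Suc m) (append_cols z G)"
proof -
  let ?n = "Suc m"
  interpret cof_vec_space ?n "TYPE(complex)" .
  define v where "v = col z 0"
  have v: "v \<in> carrier_vec ?n" using z(1) by (intro carrier_vecI) (simp add: v_def)
  have v_index: "v $ l = z $$ (l, 0)" if "l < ?n" for l using that z(1) by (simp add: v_def)
  have "v \<noteq> 0\<^sub>v ?n"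
  proof
    assume "v = 0\<^sub>v ?n"
    then have "z $$ (l, 0) = 0" if "l < ?n" for l using v_index[OF that] that by simp
    then have "z = 0\<^sub>m ?n 1" by (intro eq_matI) (use z in auto)
    then have "norm_sq_col z = 0" using norm_sq_col_eq_0[OF z(1)] by simp
    then have "(1\<^sub>m 1 :: complex mat) = 0 \<cdot>\<^sub>m 1\<^sub>m 1" using norm_sq_col[OF z(1)] z(2) by simp
    from arg_cong[OF this, of "\<lambda>A. A $$ (0, 0)"] show False by simp
  qed
  note bc = basis_completion[OF v this]
  define ws where "ws = gram_schmidt ?n (basis_completion v)"
  note gs = gram_schmidt_result[OF bc(2,4,5) ws_def]
  have len: "length ws = ?n" using gs(4) bc(6) by simp
  have hd: "hd ws = v" using bc(7) bc(6) v unfolding ws_def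
    by (cases "basis_completion v") auto
  have ws_c: "ws ! i \<in> carrier_vec ?n" if "i < ?n" for i using gs(3) len that by (metis nth_mem subsetD)
  define A where "A i = mat_of_cols ?n [ws ! i]" for i
  have A: "A i \<in> carrier_mat ?n 1" for i by (intro carrier_matI) (auto simp: A_def)
  have A_index: "A i $$ (l, 0) = ws ! i $ l" if "l < ?n" for i l using that by (simp add: A_def mat_of_cols_index)
  define c where "c i = 1 / sqrt (norm_sq_col (A i))" for i
  have inner: "(\<Sum>l<?n. cnj (A i $$ (l, 0)) * A j $$ (l, 0)) = (if i = j then of_real (norm_sq_col (A i)) else 0)"
    if "i < ?n" "j < ?n" for i j
  proof -
    have "(\<Sum>l<?n. cnj (A i $$ (l, 0)) * A j $$ (l, 0)) = ws ! j \<bullet>c ws ! i"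
      unfolding scalar_prod_def lessThan_atLeast0 using ws_c[OF that(1)] ws_c[OF that(2)]
      by (intro sum.cong) (auto simp: A_index)
    moreover have "ws ! j \<bullet>c ws ! i = 0" if "i \<noteq> j"
      using corthogonalD[OF gs(2)] that \<open>i < ?n\<close> \<open>j < ?n\<close> len by auto
    moreover have "(\<Sum>l<?n. cnj (A i $$ (l, 0)) * A i $$ (l, 0)) = of_real (norm_sq_col (A i))"
      using A[of i] by (auto simp: norm_sq_col_def complex_norm_square mult.commute simp del: of_real_power)
    ultimately show ?thesis by auto
  qed
  have pos: "norm_sq_col (A i) > 0" if "i < ?n" for i
  proof -
    have "ws ! i \<bullet>c ws ! i \<noteq> 0" using corthogonalD[OF gs(2)] that len by auto
    moreover have "ws ! i \<bullet>c ws ! i = of_real (norm_sq_col (A i))"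
      using inner[OF that that] ws_c[OF that] that
      by (auto simp: scalar_prod_def A_index lessThan_atLeast0 mult.commute)
    ultimately show ?thesis using norm_sq_col_nonneg[of "A i"] by auto
  qed
  define Z where "Z = mat ?n ?n (\<lambda>(l, i). of_real (c i) * A i $$ (l, 0))"
  have Zc: "Z \<in> carrier_mat ?n ?n" by (simp add: Z_def)
  have "mat_adjoint Z * Z = 1\<^sub>m ?n"
  proof (rule eq_matI)
    fix i j assume ij: "i < dim_row (1\<^sub>m ?n :: complex mat)" "j < dim_col (1\<^sub>m ?n :: complex mat)"
    have "(mat_adjoint Z * Z) $$ (i, j) = (\<Sum>l<?n. of_real (c i * c j) * (cnj (A i $$ (l, 0)) * A j $$ (l, 0)))"
      using ij by (auto simp: scalar_prod_def Z_def lessThan_atLeast0 intro!: sum.cong)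
    also have "\<dots> = of_real (c i * c j) * (if i = j then of_real (norm_sq_col (A i)) else 0)"
      using inner[of i j] ij by (simp flip: sum_distrib_left)
    also have "\<dots> = 1\<^sub>m ?n $$ (i, j)"
    proof (cases "i = j")
      case True
      have "c i * c i * norm_sq_col (A i) = 1" using pos[of i] ij by (simp add: c_def)
      then have "complex_of_real (c i * c i) * of_real (norm_sq_col (A i)) = 1" by (metis of_real_mult of_real_1)
      then show ?thesis using True ij by simp
    qed (use ij in auto)
    finally show "(mat_adjoint Z * Z) $$ (i, j) = 1\<^sub>m ?n $$ (i, j)" .
  qed (auto simp: Z_def)
  then have uZ: "unitary ?n Z" using Zc by (simp add: unitary_def)
  have A0: "A 0 = z"
  proof (rule eq_matI)
    fix l j assume "l < dim_row z" "j < dim_col z"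
    then show "A 0 $$ (l, j) = z $$ (l, j)"
      using z(1) hd len A_index[of l 0] by (cases ws) (auto simp: v_def)
  qed (use z A in auto)
  have "norm_sq_col z = 1"
  proof -
    have "complex_of_real (norm_sq_col z) = (mat_adjoint z * z) $$ (0, 0)" unfolding norm_sq_col[OF z(1)] by simp
    then show ?thesis unfolding z(2) by simp
  qed
  then have c0: "c 0 = 1" by (simp add: c_def A0)
  have "Z \<in> carrier_mat ?n (1 + m)" using Zc by simp
  from split_cols[OF this] obtain z' G where G: "z' \<in> carrier_mat ?n 1" "G \<in> carrier_mat ?n m" "Z = append_cols z' G" by metis
  have "z' = z"
  proof (rule eq_matI)
    fix l j assume lj: "l < dim_row z" "j < dim_col z"
    then have "Z $$ (l, 0) = z' $$ (l, 0)" unfolding G(3) using G z(1) by simp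
    moreover have "Z $$ (l, 0) = z $$ (l, 0)" using lj z(1) c0 A0 by (simp add: Z_def)
    ultimately show "z' $$ (l, j) = z $$ (l, j)" using lj z(1) by simp
  qed (use z G in auto)
  then show thesis using that[of G] G uZ by simp
qed

text \<open>
  Let \<open>[P' G]\<close> complete all columns but the last one \<open>v\<close>. As \<open>v\<close> is orthogonal to \<open>P'\<close>, it equals \<open>G u\<close> for
  the unit vector \<open>u = G\<^sup>* v\<close>; completing \<open>u\<close> in the smaller space and applying \<open>G\<close> completes \<open>P\<close>.
\<close>
lemma isometry_completion:
  "P \<in> carrier_mat m r \<Longrightarrow> r \<le> m \<Longrightarrow> mat_adjoint P * P = 1\<^sub>m r \<Longrightarrow>
   \<exists>G \<in> carrier_mat m (m - r). unitary m (append_cols P G)"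
proof (induction r arbitrary: P)
  case 0
  have "append_cols P (1\<^sub>m m) = 1\<^sub>m m" by (rule eq_matI) (use 0 in auto)
  then show ?case by (intro bexI[of _ "1\<^sub>m m"]) (auto simp: unitary_def adjoint_simps)
next
  case (Suc r)
  have "P \<in> carrier_mat m (r + 1)" using Suc.prems by simp
  from split_cols[OF this] obtain P' v where P': "P' \<in> carrier_mat m r" "v \<in> carrier_mat m 1" "P = append_cols P' v" by metis
  note [simp] = carrier_matD[OF P'(1)] carrier_matD[OF P'(2)]
  have e1: "mat_adjoint P * P = four_block_mat (mat_adjoint P' * P') (mat_adjoint P' * v) (mat_adjoint v * P') (mat_adjoint v * v)"
    unfolding P'(3) by (simp add: adjoint_append_cols) (subst append_rows_mult_append_cols; simp)
  have e2: "1\<^sub>m (Suc r) = four_block_mat (1\<^sub>m r) (0\<^sub>m r 1) (0\<^sub>m 1 r) (1\<^sub>m 1 :: complex mat)"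
    by (rule eq_matI) auto
  have blk: "four_block_mat (mat_adjoint P' * P') (mat_adjoint P' * v) (mat_adjoint v * P') (mat_adjoint v * v)
     = four_block_mat (1\<^sub>m r) (0\<^sub>m r 1) (0\<^sub>m 1 r) (1\<^sub>m 1 :: complex mat)"
    unfolding e1[symmetric] Suc.prems(3) e2 by (rule refl)
  have PP: "mat_adjoint P' * P' = 1\<^sub>m r"
    by (rule four_block_inject(1)[OF blk, of r r 1 1]) (auto intro!: carrier_matI)
  have Pv: "mat_adjoint P' * v = 0\<^sub>m r 1"
    by (rule four_block_inject(2)[OF blk, of r r 1 1]) (auto intro!: carrier_matI)
  have vv: "mat_adjoint v * v = 1\<^sub>m 1"
    by (rule four_block_inject(4)[OF blk, of r r 1 1]) (auto intro!: carrier_matI)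
  define q where "q = m - Suc r"
  have q: "m - r = Suc q" "m - Suc r = q" "r + Suc q = m" using Suc.prems(2) by (auto simp: q_def)
  from Suc.IH[OF P'(1) _ PP] Suc.prems(2) obtain G where G: "G \<in> carrier_mat m (Suc q)" "unitary m (append_cols P' G)"
    unfolding q by auto
  note [simp] = carrier_matD[OF G(1)]
  note uZ = unitaryD[OF G(2)]
  have "v = append_cols P' G * (mat_adjoint (append_cols P' G) * v)"
    using uZ by (subst mult_cancel_left_dim[OF uZ(3)]) auto
  also have "\<dots> = P' * (mat_adjoint P' * v) + G * (mat_adjoint G * v)"
    by (simp add: adjoint_append_cols append_rows_mult) (subst append_cols_mult_append_rows; simp)
  finally have v_eq: "G * (mat_adjoint G * v) = v" by (simp add: Pv matalg)
  define u where "u = mat_adjoint G * v"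
  have u: "u \<in> carrier_mat (Suc q) 1" by (auto simp: u_def intro!: carrier_matI)
  note [simp] = carrier_matD[OF u]
  have "mat_adjoint u * u = mat_adjoint v * (G * (mat_adjoint G * v))" by (simp add: u_def adjoint_simps matalg)
  then have "mat_adjoint u * u = 1\<^sub>m 1" by (simp add: v_eq vv)
  from unitary_completion_column[OF u this] obtain H where
    H: "H \<in> carrier_mat (Suc q) q" "unitary (Suc q) (append_cols u H)" by blast
  note [simp] = carrier_matD[OF H(1)]
  have "unitary m (append_cols P' G * four_block_mat (1\<^sub>m r) (0\<^sub>m r (Suc q)) (0\<^sub>m (Suc q) r) (append_cols u H))"
    using unitary_mult[OF G(2)] unitary_block[OF H(2), of r] unfolding q by simp
  also have "append_cols P' G * four_block_mat (1\<^sub>m r) (0\<^sub>m r (Suc q)) (0\<^sub>m (Suc q) r) (append_cols u H)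
     = append_cols P' (G * append_cols u H)"
    by (subst append_cols_mult_four_block) (auto simp: matalg)
  also have "G * append_cols u H = append_cols v (G * H)"
    by (subst mult_append_cols) (auto simp: u_def v_eq)
  also have "append_cols P' (append_cols v (G * H)) = append_cols P (G * H)"
    unfolding P'(3) by (rule eq_matI) (auto simp del: index_mult_mat(1))
  finally show ?case unfolding q by (intro bexI[of _ "G * H"]) (auto intro!: carrier_matI)
qed

text \<open>
  In an orthonormal basis that extends \<open>P\<close>, the first block column of \<open>B\<close> is \<open>\<Sigma>\<close> above zero, and the
  symmetry of \<open>B\<close> clears the first block row.
\<close>
lemma deflation:
  assumes P: "P \<in> carrier_mat m r" "r \<le> m" "mat_adjoint P * P = 1\<^sub>m r"
    and B: "B \<in> carrier_mat m m" "star_mat st B = \<eta> \<cdot>\<^sub>m B" "\<eta> \<noteq> 0"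
    and BP: "B * twist st P = P * \<Sigma>" and \<Sigma>: "\<Sigma> \<in> carrier_mat r r"
  obtains Z C where "unitary m Z" "C \<in> carrier_mat (m - r) (m - r)" "star_mat st C = \<eta> \<cdot>\<^sub>m C"
    "B = Z * four_block_mat \<Sigma> (0\<^sub>m r (m - r)) (0\<^sub>m (m - r) r) C * star_mat st Z"
proof -
  from isometry_completion[OF P] obtain G where G: "G \<in> carrier_mat m (m - r)" "unitary m (append_cols P G)" by auto
  define Z where "Z = append_cols P G"
  note uZ = G(2)[folded Z_def]
  note Z = unitaryD[OF uZ]
  note [simp] = carrier_matD[OF P(1)] carrier_matD[OF G(1)] carrier_matD[OF B(1)] carrier_matD[OF \<Sigma>] carrier_matD[OF Z(1)]
  define C where "C = mat_adjoint G * (B * twist st G)"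
  have "four_block_mat (mat_adjoint P * P) (mat_adjoint P * G) (mat_adjoint G * P) (mat_adjoint G * G) = mat_adjoint Z * Z"
    unfolding Z_def by (simp add: adjoint_append_cols) (subst append_rows_mult_append_cols; simp)
  also have "\<dots> = 1\<^sub>m m" by (rule Z)
  also have "\<dots> = four_block_mat (1\<^sub>m r) (0\<^sub>m r (m - r)) (0\<^sub>m (m - r) r) (1\<^sub>m (m - r))"
    by (rule eq_matI) (use P(2) in auto)
  finally have blk: "four_block_mat (mat_adjoint P * P) (mat_adjoint P * G) (mat_adjoint G * P) (mat_adjoint G * G) = \<dots>" .
  have GP: "mat_adjoint G * P = 0\<^sub>m (m - r) r"
    by (rule four_block_inject(3)[OF blk, of r r "m - r" "m - r"]) (auto intro!: carrier_matI)
  have ll: "mat_adjoint G * (B * twist st P) = 0\<^sub>m (m - r) r"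
    unfolding BP using GP by (simp add: matalg flip: mult_assoc_dim)
  have ul: "mat_adjoint P * (B * twist st P) = \<Sigma>"
    unfolding BP using P(3) by (simp add: matalg flip: mult_assoc_dim)
  have "\<eta> \<cdot>\<^sub>m (mat_adjoint P * (B * twist st G)) = star_mat st (mat_adjoint G * (B * twist st P))"
    by (simp add: starmat star_twist B(2) matalg)
  also have "\<dots> = 0\<^sub>m r (m - r)" unfolding ll by simp
  finally have *: "\<eta> \<cdot>\<^sub>m (mat_adjoint P * (B * twist st G)) = 0\<^sub>m r (m - r)" .
  have "mat_adjoint P * (B * twist st G) = (1 / \<eta>) \<cdot>\<^sub>m (\<eta> \<cdot>\<^sub>m (mat_adjoint P * (B * twist st G)))"
    using B(3) by (simp add: matalg)
  then have ur: "mat_adjoint P * (B * twist st G) = 0\<^sub>m r (m - r)" unfolding * by (simp add: matalg)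
  have "B * twist st Z = append_cols (B * twist st P) (B * twist st G)"
    unfolding Z_def by (simp add: twist_append_cols) (subst mult_append_cols; simp)
  then have "mat_adjoint Z * (B * twist st Z) = four_block_mat \<Sigma> (0\<^sub>m r (m - r)) (0\<^sub>m (m - r) r) C"
    by (simp add: Z_def adjoint_append_cols)
      (subst append_rows_mult_append_cols; simp add: ll ul ur C_def)
  then have "Z * (mat_adjoint Z * (B * twist st Z)) * star_mat st Z =
      Z * four_block_mat \<Sigma> (0\<^sub>m r (m - r)) (0\<^sub>m (m - r) r) C * star_mat st Z" by simp
  moreover have "Z * (mat_adjoint Z * (B * twist st Z)) * star_mat st Z = B"
    by (subst mult_cancel_left_dim[OF Z(3)]) (auto simp: matalg star_twist_cancel[OF uZ])
  ultimately have B_eq: "B = Z * four_block_mat \<Sigma> (0\<^sub>m r (m - r)) (0\<^sub>m (m - r) r) C * star_mat st Z" by simp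
  have C_star: "star_mat st C = \<eta> \<cdot>\<^sub>m C"
    by (simp add: C_def starmat star_twist B(2) matalg)
  have "C \<in> carrier_mat (m - r) (m - r)" by (auto simp: C_def intro!: carrier_matI)
  then show thesis using C_star B_eq by (rule that[OF uZ])
qed

section \<open>Unitary diagonalization: spectral theorem and Takagi factorization\<close>

lemma unit_eigenvector:
  assumes A: "A \<in> carrier_mat m m" and m: "m \<noteq> 0"
  obtains l z where "z \<in> carrier_mat m 1" "mat_adjoint z * z = 1\<^sub>m 1" "A * z = l \<cdot>\<^sub>m (z :: complex mat)"
proof -
  from spectrum_non_empty[OF A] m obtain l where "eigenvalue A l" by (auto simp: spectrum_def)
  then obtain v where v: "v \<in> carrier_vec m" "v \<noteq> 0\<^sub>v m" "A *\<^sub>v v = l \<cdot>\<^sub>v v"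
    using A by (auto simp: eigenvalue_def eigenvector_def)
  define z where "z = mat m 1 (\<lambda>(i, j). v $ i)"
  have z: "z \<in> carrier_mat m 1" by (simp add: z_def)
  have Az: "A * z = l \<cdot>\<^sub>m z"
  proof (rule eq_matI)
    fix i j assume ij: "i < dim_row (l \<cdot>\<^sub>m z)" "j < dim_col (l \<cdot>\<^sub>m z)"
    have "col z j = v" using v ij by (intro eq_vecI) (auto simp: z_def)
    then have "(A * z) $$ (i, j) = (A *\<^sub>v v) $ i" using A ij by (simp add: z_def)
    then show "(A * z) $$ (i, j) = (l \<cdot>\<^sub>m z) $$ (i, j)" unfolding v using v ij by (simp add: z_def)
  qed (use A z in auto)
  have "z \<noteq> 0\<^sub>m m 1"
  proof
    assume "z = 0\<^sub>m m 1"
    then have "z $$ (i, 0) = 0" if "i < m" for i using that by simp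
    then have "v = 0\<^sub>v m" using v by (intro eq_vecI) (auto simp: z_def)
    then show False using v by simp
  qed
  from normalized_column[OF z this] obtain c :: real
    where c: "mat_adjoint (of_real c \<cdot>\<^sub>m z) * (of_real c \<cdot>\<^sub>m z) = 1\<^sub>m 1" by blast
  show thesis
    by (rule that[OF _ c, of l]) (use z A in \<open>auto simp: matalg Az mult.commute\<close>)
qed

text \<open>
  The antilinear map \<open>x \<mapsto> B (cnj x)\<close> has square \<open>B B\<^sup>*\<close>, which multiplies its eigenvector \<open>v\<close> by some
  \<open>\<sigma>\<^sup>2 \<ge> 0\<close>. With \<open>w = B (cnj v)\<close>, the vector \<open>w + \<sigma> v\<close> is a coneigenvector for \<open>\<sigma>\<close> unless
  it vanishes.
\<close>
lemma takagi_step: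
  assumes B: "B \<in> carrier_mat m m" and m: "m \<noteq> 0" and sym: "star_mat Transpose B = B"
  obtains \<sigma> :: real and z where "\<sigma> \<ge> 0" "z \<in> carrier_mat m 1" "mat_adjoint z * z = 1\<^sub>m 1"
    "B * twist Transpose z = of_real \<sigma> \<cdot>\<^sub>m z"
proof -
  let ?t = "twist Transpose"
  have tB: "?t B = mat_adjoint B"
    by (rule twist_symmetric[OF sym])
  from unit_eigenvector[of "B * mat_adjoint B" m] B m obtain l v where
    v: "v \<in> carrier_mat m 1" "mat_adjoint v * v = 1\<^sub>m 1" "B * mat_adjoint B * v = l \<cdot>\<^sub>m v"
    using adjoint_carrier[OF B] by (metis mult_carrier_mat)
  note [simp] = carrier_matD[OF B] carrier_matD[OF v(1)]
  have v3: "B * (mat_adjoint B * v) = l \<cdot>\<^sub>m v" using v(3) by (simp add: matalg)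
  have Bv: "mat_adjoint B * v \<in> carrier_mat m 1" by (auto intro!: carrier_matI)
  have "of_real (norm_sq_col (mat_adjoint B * v)) \<cdot>\<^sub>m 1\<^sub>m 1 = mat_adjoint (mat_adjoint B * v) * (mat_adjoint B * v)"
    by (rule norm_sq_col[OF Bv, symmetric])
  also have "\<dots> = l \<cdot>\<^sub>m 1\<^sub>m 1" by (simp add: adjoint_simps matalg v3 v(2))
  finally have "of_real (norm_sq_col (mat_adjoint B * v)) = l"
    by (rule smult_one_injectD)
  then obtain s where s: "l = of_real s" "s \<ge> 0" using norm_sq_col_nonneg by metis
  define \<sigma> where "\<sigma> = sqrt s"
  have \<sigma>: "\<sigma> \<ge> 0" "l = of_real \<sigma> * of_real \<sigma>" using s by (auto simp: \<sigma>_def simp flip: of_real_mult)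
  define w where "w = B * ?t v"
  have [simp]: "dim_row w = m" "dim_col w = 1" by (auto simp: w_def)
  have Bw: "B * ?t w = (of_real \<sigma> * of_real \<sigma>) \<cdot>\<^sub>m v"
    unfolding w_def twist_mult[of B "?t v", simplified] tB \<sigma>(2)[symmetric] by (simp add: v3)
  define u where "u = w + of_real \<sigma> \<cdot>\<^sub>m v"
  have u: "u \<in> carrier_mat m 1" by (auto simp: u_def intro!: carrier_matI)
  note [simp] = carrier_matD[OF u]
  show thesis
  proof (cases "u = 0\<^sub>m m 1")
    case True
    \<comment> \<open>If the candidate vanishes, then \<open>v\<close> is a coneigenvector for \<open>- \<sigma>\<close>, and the factor \<open>\<i>\<close> flips the sign.\<close>
    have "w + (- (- (of_real \<sigma> \<cdot>\<^sub>m v))) = 0\<^sub>m m 1" using True by (simp add: u_def)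
    then have w: "w = - (of_real \<sigma> \<cdot>\<^sub>m v)" by (rule add_uminus_eq_zeroD) auto
    have "B * ?t (\<i> \<cdot>\<^sub>m v) = (- \<i>) \<cdot>\<^sub>m w" by (simp add: twist_smult w_def matalg star_scalar_def)
    also have "\<dots> = of_real \<sigma> \<cdot>\<^sub>m (\<i> \<cdot>\<^sub>m v)" unfolding w by (rule eq_matI) auto
    finally show thesis
      using v by (intro that[OF \<sigma>(1), of "\<i> \<cdot>\<^sub>m v"]) (auto simp: adjoint_simps matalg)
  next
    case False
    from normalized_column[OF u False] obtain c :: real
      where c: "mat_adjoint (of_real c \<cdot>\<^sub>m u) * (of_real c \<cdot>\<^sub>m u) = 1\<^sub>m 1" by blast
    have "B * ?t u = of_real \<sigma> \<cdot>\<^sub>m u"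
    proof -
      have "B * ?t u = B * ?t w + of_real \<sigma> \<cdot>\<^sub>m (B * ?t v)"
        unfolding u_def by (simp add: twist_add twist_smult mult_add_dim mult_smult_dim)
      also have "\<dots> = (of_real \<sigma> * of_real \<sigma>) \<cdot>\<^sub>m v + of_real \<sigma> \<cdot>\<^sub>m w"
        by (rule arg_cong2[of _ _ _ _ "(+)", OF Bw]) (rule arg_cong[OF w_def[symmetric]])
      also have "\<dots> = of_real \<sigma> \<cdot>\<^sub>m w + (of_real \<sigma> * of_real \<sigma>) \<cdot>\<^sub>m v"
        by (rule comm_add_mat[of _ m 1]) (auto intro!: carrier_matI)
      also have "\<dots> = of_real \<sigma> \<cdot>\<^sub>m u"
        unfolding u_def by (simp add: smult_add_dim smult_smult_assoc)
      finally show ?thesis .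
    qed
    then have "B * ?t (of_real c \<cdot>\<^sub>m u) = of_real \<sigma> \<cdot>\<^sub>m (of_real c \<cdot>\<^sub>m u)"
      by (simp add: twist_smult matalg mult.commute[of "of_real c"])
    then show thesis by (rule that[OF \<sigma>(1) smult_carrier_mat[OF u] c])
  qed
qed

lemma hermitian_step:
  assumes B: "B \<in> carrier_mat m m" and m: "m \<noteq> 0" and sym: "star_mat ConjTranspose B = B"
  obtains \<sigma> :: real and z where "z \<in> carrier_mat m 1" "mat_adjoint z * z = 1\<^sub>m 1"
    "B * z = of_real \<sigma> \<cdot>\<^sub>m z"
proof -
  from unit_eigenvector[OF B m] obtain l z where
    z: "z \<in> carrier_mat m 1" "mat_adjoint z * z = 1\<^sub>m 1" "B * z = l \<cdot>\<^sub>m z" by metis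
  note [simp] = carrier_matD[OF B] carrier_matD[OF z(1)]
  have e: "mat_adjoint z * (B * z) = l \<cdot>\<^sub>m 1\<^sub>m 1" using z by (simp add: matalg)
  have "mat_adjoint (mat_adjoint z * (B * z)) = mat_adjoint z * (B * z)"
    using sym by (simp add: adjoint_simps matalg)
  then have "cnj l \<cdot>\<^sub>m 1\<^sub>m 1 = l \<cdot>\<^sub>m 1\<^sub>m 1" unfolding e by (simp add: adjoint_simps)
  then have "cnj l = l" by (rule smult_one_injectD)
  then have "l = of_real (Re l)" by (simp add: complex_eq_iff)
  then show thesis using that z by metis
qed

text \<open>
  For the conjugate transpose this is the spectral theorem for Hermitian matrices, for the transpose it
  is the Takagi factorization of complex symmetric matrices.
\<close>
theorem unitary_diagonalization:
  "B \<in> carrier_mat m m \<Longrightarrow> star_mat st B = B \<Longrightarrow>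
   \<exists>Z (\<sigma> :: nat \<Rightarrow> real). unitary m Z \<and> (st = Transpose \<longrightarrow> (\<forall>i<m. \<sigma> i \<ge> 0)) \<and>
     B = Z * mat_diag m (\<lambda>i. of_real (\<sigma> i)) * star_mat st Z"
proof (induction m arbitrary: B)
  case 0
  show ?case
    by (rule exI[of _ "1\<^sub>m 0"], rule exI[of _ "\<lambda>_. 0"])
      (use 0 in \<open>auto simp: unitary_def adjoint_simps intro!: eq_matI\<close>)
next
  case (Suc m)
  obtain \<sigma> :: real and z where \<sigma>: "st = Transpose \<longrightarrow> \<sigma> \<ge> 0" and z: "z \<in> carrier_mat (Suc m) 1" "mat_adjoint z * z = 1\<^sub>m 1"
    "B * twist st z = of_real \<sigma> \<cdot>\<^sub>m z"
  proof (cases st)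
    case Transpose
    then show ?thesis using takagi_step[of B "Suc m"] Suc.prems that by (metis Zero_not_Suc)
  next
    case ConjTranspose
    then show ?thesis using hermitian_step[of B "Suc m"] Suc.prems that
      by (metis Zero_not_Suc star.distinct(1) twist_ConjTranspose)
  qed
  define \<Sigma> where "\<Sigma> = complex_of_real \<sigma> \<cdot>\<^sub>m 1\<^sub>m 1"
  have "B * twist st z = z * \<Sigma>" using z by (simp add: \<Sigma>_def matalg)
  with deflation[of z "Suc m" 1 B st 1 \<Sigma>] z(1,2) Suc.prems obtain Z0 C where
    Z0: "unitary (Suc m) Z0" and C: "C \<in> carrier_mat m m" "star_mat st C = C"
    and B: "B = Z0 * four_block_mat \<Sigma> (0\<^sub>m 1 m) (0\<^sub>m m 1) C * star_mat st Z0"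
    by (auto simp: \<Sigma>_def one_smult_mat)
  from Suc.IH[OF C] obtain Z1 \<tau> where Z1: "unitary m Z1" and \<tau>: "st = Transpose \<longrightarrow> (\<forall>i<m. \<tau> i \<ge> (0 :: real))"
    and C_eq: "C = Z1 * mat_diag m (\<lambda>i. of_real (\<tau> i)) * star_mat st Z1" by blast
  define W where "W = four_block_mat (1\<^sub>m 1) (0\<^sub>m 1 m) (0\<^sub>m m 1) Z1"
  have W: "unitary (Suc m) W" using unitary_block[OF Z1, of 1] by (simp add: W_def)
  define D where "D = mat_diag m (\<lambda>i. complex_of_real (\<tau> i))"
  have D: "dim_row D = m" "dim_col D = m" by (auto simp: D_def)
  define \<rho> where "\<rho> = case_nat \<sigma> \<tau>"
  have diag: "mat_diag (Suc m) (\<lambda>i. complex_of_real (\<rho> i)) = four_block_mat \<Sigma> (0\<^sub>m 1 m) (0\<^sub>m m 1) D"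
    by (rule eq_matI) (auto simp: mat_diag_def D_def \<Sigma>_def \<rho>_def split: nat.split)
  note [simp] = D carrier_matD[OF unitaryD(1)[OF Z1]] carrier_matD[OF unitaryD(1)[OF Z0]] carrier_matD[OF unitaryD(1)[OF W]]
  have [simp]: "dim_row \<Sigma> = 1" "dim_col \<Sigma> = 1" by (auto simp: \<Sigma>_def)
  have sW: "star_mat st W = four_block_mat (1\<^sub>m 1) (0\<^sub>m 1 m) (0\<^sub>m m 1) (star_mat st Z1)"
    unfolding W_def by (subst star_mat_four_block) auto
  have "W * four_block_mat \<Sigma> (0\<^sub>m 1 m) (0\<^sub>m m 1) D * star_mat st W = four_block_mat \<Sigma> (0\<^sub>m 1 m) (0\<^sub>m m 1) C"
    unfolding sW unfolding W_def C_eq D_def[symmetric] by (simp add: four_block_mult_dim matalg)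
  moreover have "(Z0 * W) * four_block_mat \<Sigma> (0\<^sub>m 1 m) (0\<^sub>m m 1) D * star_mat st (Z0 * W) =
      Z0 * (W * four_block_mat \<Sigma> (0\<^sub>m 1 m) (0\<^sub>m m 1) D * star_mat st W) * star_mat st Z0"
    by (simp add: starmat matalg)
  ultimately have "B = (Z0 * W) * mat_diag (Suc m) (\<lambda>i. complex_of_real (\<rho> i)) * star_mat st (Z0 * W)"
    unfolding B diag by simp
  moreover have "st = Transpose \<longrightarrow> (\<forall>i<Suc m. \<rho> i \<ge> 0)" using \<sigma> \<tau> by (auto simp: \<rho>_def split: nat.split)
  ultimately show ?case using unitary_mult[OF Z0 W] by blast
qed

section \<open>The Youla decomposition of skew-symmetric matrices\<close>

text \<open>
  The direct sum of the \<open>s\<close> blocks \<open>[[0, \<sigma>], [- \<sigma>, 0]]\<close> and of a zero block. Adjacent pairs of indices suit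
  the induction below; the permutation in the star-factorization separates them.
\<close>
definition youla_form :: "nat \<Rightarrow> nat \<Rightarrow> (nat \<Rightarrow> real) \<Rightarrow> complex mat" where
  "youla_form m s \<sigma> = mat m m (\<lambda>(i, j).
     if i < 2 * s \<and> even i \<and> j = Suc i then of_real (\<sigma> (i div 2))
     else if j < 2 * s \<and> even j \<and> i = Suc j then - of_real (\<sigma> (j div 2)) else 0)"

text \<open>
  As \<open>B B\<^sup>*\<close> is Hermitian and nonzero, it has an eigenvalue \<open>\<sigma>\<^sup>2 > 0\<close> with a unit eigenvector \<open>v\<close>. The vector
  \<open>w = B (cnj v) / \<sigma>\<close> is a unit vector, and \<open>v\<^sup>* w\<close> vanishes as a multiple of the value of a skew-symmetric
  bilinear form at equal arguments. The antilinear map \<open>x \<mapsto> B (cnj x)\<close> has square \<open>- B B\<^sup>*\<close> and therefore sends \<open>w\<close> back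
  to \<open>- \<sigma> v\<close>.
\<close>
lemma youla_step:
  assumes B: "B \<in> carrier_mat m m" and nz: "B \<noteq> 0\<^sub>m m m" and skew: "star_mat Transpose B = - B"
  obtains \<sigma> :: real and w v where "\<sigma> > 0" "w \<in> carrier_mat m 1" "v \<in> carrier_mat m 1"
    "mat_adjoint w * w = 1\<^sub>m 1" "mat_adjoint v * v = 1\<^sub>m 1" "mat_adjoint v * w = 0\<^sub>m 1 1"
    "B * twist Transpose w = - (of_real \<sigma> \<cdot>\<^sub>m v)" "B * twist Transpose v = of_real \<sigma> \<cdot>\<^sub>m w"
proof -
  let ?t = "twist Transpose"
  note [simp] = carrier_matD[OF B]
  have aB: "mat_adjoint B = - ?t B"
    by (rule twist_skew[OF skew])
  define H where "H = B * mat_adjoint B"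
  have H: "H \<in> carrier_mat m m" by (auto simp: H_def intro!: carrier_matI)
  note [simp] = carrier_matD[OF H]
  have "star_mat ConjTranspose H = H" by (simp add: H_def adjoint_simps)
  from unitary_diagonalization[OF H this] obtain Z \<tau> where Z: "unitary m Z"
    and H_eq: "H = Z * mat_diag m (\<lambda>i. complex_of_real (\<tau> i)) * mat_adjoint Z" by auto
  note uZ = unitaryD[OF Z]
  note [simp] = carrier_matD[OF uZ(1)]
  \<comment> \<open>If all eigenvalues vanished, then the diagonal of \<open>B B\<^sup>*\<close>, which holds the squared norms of the rows, would vanish.\<close>
  have "\<exists>i<m. \<tau> i \<noteq> 0"
  proof (rule ccontr)
    assume "\<not> (\<exists>i<m. \<tau> i \<noteq> 0)"
    then have "mat_diag m (\<lambda>i. complex_of_real (\<tau> i)) = 0\<^sub>m m m" by (intro eq_matI) (auto simp: mat_diag_def)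
    then have H0: "H = 0\<^sub>m m m" unfolding H_eq by (simp add: matalg)
    have "B $$ (a, b) = 0" if "a < m" "b < m" for a b
    proof -
      have "0 = H $$ (a, a)" using that by (simp add: H0)
      also have "\<dots> = (\<Sum>l<m. B $$ (a, l) * cnj (B $$ (a, l)))"
        unfolding H_def using that by (simp add: scalar_prod_def lessThan_atLeast0)
      also have "\<dots> = of_real (\<Sum>l<m. (cmod (B $$ (a, l)))\<^sup>2)"
        by (simp add: complex_norm_square del: of_real_power)
      finally have "(\<Sum>l<m. (cmod (B $$ (a, l)))\<^sup>2) = 0" by (metis of_real_eq_0_iff)
      then show ?thesis using that by (simp add: sum_nonneg_eq_0_iff)
    qed
    then have "B = 0\<^sub>m m m" by (intro eq_matI) auto
    then show False using nz by simp
  qed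
  then obtain i where i: "i < m" "\<tau> i \<noteq> 0" by blast
  define e where "e = mat m 1 (\<lambda>(l, j). if l = i then 1 else (0 :: complex))"
  have [simp]: "dim_row e = m" "dim_col e = 1" by (auto simp: e_def)
  define v where "v = Z * e"
  have v: "v \<in> carrier_mat m 1" by (auto simp: v_def intro!: carrier_matI)
  note [simp] = carrier_matD[OF v]
  have ee: "mat_adjoint e * e = 1\<^sub>m 1"
    by (rule eq_matI) (use i in \<open>auto simp: e_def scalar_prod_def if_distrib cong: if_cong\<close>)
  have vv: "mat_adjoint v * v = 1\<^sub>m 1"
    using mult_cancel_left_dim[OF uZ(2), of e] by (simp add: v_def adjoint_simps matalg ee)
  have De: "mat_diag m (\<lambda>i. complex_of_real (\<tau> i)) * e = of_real (\<tau> i) \<cdot>\<^sub>m e"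
    by (subst mat_diag_mult_left[of e m 1]) (auto simp: e_def intro!: eq_matI carrier_matI)
  have Hv: "H * v = of_real (\<tau> i) \<cdot>\<^sub>m v"
    unfolding H_eq using mult_cancel_left_dim[OF uZ(2), of e] by (simp add: v_def matalg De)
  have Hv': "B * (mat_adjoint B * v) = of_real (\<tau> i) \<cdot>\<^sub>m v" using Hv by (simp add: H_def matalg)
  have Bv: "mat_adjoint B * v \<in> carrier_mat m 1" by (auto intro!: carrier_matI)
  have "of_real (norm_sq_col (mat_adjoint B * v)) \<cdot>\<^sub>m 1\<^sub>m 1 = mat_adjoint (mat_adjoint B * v) * (mat_adjoint B * v)"
    by (rule norm_sq_col[OF Bv, symmetric])
  also have "\<dots> = complex_of_real (\<tau> i) \<cdot>\<^sub>m 1\<^sub>m 1" by (simp add: adjoint_simps matalg Hv' vv)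
  finally have "complex_of_real (norm_sq_col (mat_adjoint B * v)) = of_real (\<tau> i)"
    by (rule smult_one_injectD)
  then have "\<tau> i \<ge> 0" using norm_sq_col_nonneg by (metis of_real_eq_iff)
  with i have pos: "\<tau> i > 0" by simp
  define \<sigma> where "\<sigma> = sqrt (\<tau> i)"
  have \<sigma>: "\<sigma> > 0" "\<tau> i = \<sigma> * \<sigma>" using pos by (auto simp: \<sigma>_def)
  have \<sigma>c: "complex_of_real \<sigma> \<noteq> 0" using \<sigma> by simp
  define w where "w = (1 / complex_of_real \<sigma>) \<cdot>\<^sub>m (B * ?t v)"
  have w: "w \<in> carrier_mat m 1" by (auto simp: w_def intro!: carrier_matI)
  note [simp] = carrier_matD[OF w]
  have Btv: "B * ?t v = of_real \<sigma> \<cdot>\<^sub>m w" using \<sigma>c by (simp add: w_def matalg)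
  have tBv: "B * (?t B * v) = - ((of_real \<sigma> * of_real \<sigma>) \<cdot>\<^sub>m v)"
    using Hv' unfolding aB \<sigma>(2) by (simp add: matalg) (metis uminus_uminus_mat)
  have Btw: "B * ?t w = - (of_real \<sigma> \<cdot>\<^sub>m v)"
    unfolding w_def using \<sigma>c by (simp add: twist_smult twist_mult matalg tBv star_scalar_def)
  have vw: "mat_adjoint v * w = 0\<^sub>m 1 1"
  proof -
    define x where "x = mat_adjoint v * (B * ?t v)"
    have [simp]: "dim_row x = 1" "dim_col x = 1" by (auto simp: x_def)
    have "star_mat Transpose x = - x"
      unfolding x_def using skew star_twist[of Transpose v] by (simp add: starmat matalg del: star_mat.simps)
    then have "star_mat Transpose x $$ (0, 0) = (- x) $$ (0, 0)" by simp
    then have "x $$ (0, 0) = 0" by simp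
    then have "x = 0\<^sub>m 1 1" by (intro eq_matI) auto
    then show ?thesis unfolding w_def x_def by (simp add: matalg)
  qed
  have ww: "mat_adjoint w * w = 1\<^sub>m 1"
  proof -
    have "?t B * (B * ?t v) = ?t (B * (?t B * v))" by (simp add: twist_mult)
    also have "\<dots> = - ((of_real \<sigma> * of_real \<sigma>) \<cdot>\<^sub>m ?t v)" unfolding tBv by (simp add: twist_smult twist_uminus star_scalar_def)
    finally have BB: "mat_adjoint B * (B * ?t v) = (of_real \<sigma> * of_real \<sigma>) \<cdot>\<^sub>m ?t v"
      unfolding aB by (simp add: matalg)
    have "mat_adjoint (?t v) * ?t v = ?t (mat_adjoint v * v)" by (rule eq_matI) (auto simp: scalar_prod_def star_scalar_def)
    then have tvv: "mat_adjoint (?t v) * ?t v = 1\<^sub>m 1" unfolding vv by simp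
    show ?thesis unfolding w_def using \<sigma>c
      by (simp add: adjoint_simps matalg BB tvv)
  qed
  show thesis by (rule that[OF \<sigma>(1) w v ww vv vw Btw Btv])
qed

text \<open>
  Each step splits off the plane spanned by the two vectors of \<open>youla_step\<close>.
\<close>
theorem youla_decomposition:
  "B \<in> carrier_mat m m \<Longrightarrow> star_mat Transpose B = - B \<Longrightarrow>
   \<exists>Z s (\<sigma> :: nat \<Rightarrow> real). unitary m Z \<and> 2 * s \<le> m \<and> (\<forall>i. \<sigma> i > 0) \<and>
     B = Z * youla_form m s \<sigma> * star_mat Transpose Z"
proof (induction m arbitrary: B rule: less_induct)
  case (less m)
  show ?case
  proof (cases "B = 0\<^sub>m m m")
    case True
    have "youla_form m 0 (\<lambda>_. 1) = 0\<^sub>m m m" by (rule eq_matI) (auto simp: youla_form_def)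
    then show ?thesis using True
      by (intro exI[of _ "1\<^sub>m m"] exI[of _ "0 :: nat"] exI[of _ "\<lambda>_. 1 :: real"])
        (auto simp: unitary_def adjoint_simps matalg)
  next
    case False
    from youla_step[OF less.prems(1) False less.prems(2)] obtain \<sigma> :: real and w v where
      \<sigma>: "\<sigma> > 0" and w: "w \<in> carrier_mat m 1" and v: "v \<in> carrier_mat m 1"
      and orth: "mat_adjoint w * w = 1\<^sub>m 1" "mat_adjoint v * v = 1\<^sub>m 1" "mat_adjoint v * w = 0\<^sub>m 1 1"
      and BP: "B * twist Transpose w = - (of_real \<sigma> \<cdot>\<^sub>m v)" "B * twist Transpose v = of_real \<sigma> \<cdot>\<^sub>m w" by metis
    note [simp] = carrier_matD[OF w] carrier_matD[OF v] carrier_matD[OF less.prems(1)]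
    have wv: "mat_adjoint w * v = 0\<^sub>m 1 1"
      using arg_cong[OF orth(3), of mat_adjoint] by (simp add: adjoint_simps)
    define P where "P = append_cols w v"
    have P: "P \<in> carrier_mat m 2" by (auto simp: P_def intro!: carrier_matI)
    have PP: "mat_adjoint P * P = 1\<^sub>m 2"
      unfolding P_def by (simp add: adjoint_append_cols append_rows_mult_append_cols orth wv) (rule eq_matI, auto)
    define \<Sigma> where "\<Sigma> = four_block_mat (0\<^sub>m 1 1) (of_real \<sigma> \<cdot>\<^sub>m 1\<^sub>m 1) (- (of_real \<sigma> \<cdot>\<^sub>m 1\<^sub>m 1)) (0\<^sub>m 1 1 :: complex mat)"
    have \<Sigma>: "\<Sigma> \<in> carrier_mat 2 2" by (auto simp: \<Sigma>_def intro!: carrier_matI)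
    have BP2: "B * twist Transpose P = P * \<Sigma>"
      unfolding P_def \<Sigma>_def by (simp add: twist_append_cols mult_append_cols BP append_cols_mult_four_block matalg)
    have "2 \<le> m"
    proof (rule ccontr)
      assume "\<not> 2 \<le> m"
      then consider "m = 0" | "m = 1" by linarith
      then show False
      proof cases
        case 1
        then have "B = 0\<^sub>m m m" by (intro eq_matI) auto
        then show False using False by simp
      next
        case 2
        have "star_mat Transpose B $$ (0, 0) = (- B) $$ (0, 0)" using less.prems(2) by simp
        then have "B $$ (0, 0) = 0" using 2 by simp
        then have "B = 0\<^sub>m m m" using 2 by (intro eq_matI) auto
        then show False using False by simp
      qed
    qed
    then obtain q where q: "m = 2 + q" using le_Suc_ex by blast
    have "star_mat Transpose B = (- 1) \<cdot>\<^sub>m B" using less.prems(2) by (simp add: minus_one_smult_mat)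
    from deflation[OF P \<open>2 \<le> m\<close> PP less.prems(1) this _ BP2 \<Sigma>] obtain Z0 C where
      Z0: "unitary m Z0" and C: "C \<in> carrier_mat q q" "star_mat Transpose C = - C"
      and B: "B = Z0 * four_block_mat \<Sigma> (0\<^sub>m 2 q) (0\<^sub>m q 2) C * star_mat Transpose Z0"
      unfolding q by (auto simp: minus_one_smult_mat)
    from less.IH[OF _ C] q obtain Z1 s \<tau> where Z1: "unitary q Z1" and s: "2 * s \<le> q" and \<tau>: "\<forall>i. \<tau> i > (0 :: real)"
      and C_eq: "C = Z1 * youla_form q s \<tau> * star_mat Transpose Z1" by auto
    define W where "W = four_block_mat (1\<^sub>m 2) (0\<^sub>m 2 q) (0\<^sub>m q 2) Z1"
    have W: "unitary m W" using unitary_block[OF Z1, of 2] by (simp add: W_def q)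
    define D where "D = youla_form q s \<tau>"
    have D: "dim_row D = q" "dim_col D = q" by (auto simp: D_def youla_form_def)
    define \<rho> where "\<rho> = case_nat \<sigma> \<tau>"
    have form: "youla_form m (Suc s) \<rho> = four_block_mat \<Sigma> (0\<^sub>m 2 q) (0\<^sub>m q 2) D"
    proof (rule eq_matI)
      fix i j assume "i < dim_row (four_block_mat \<Sigma> (0\<^sub>m 2 q) (0\<^sub>m q 2) D)" "j < dim_col (four_block_mat \<Sigma> (0\<^sub>m 2 q) (0\<^sub>m q 2) D)"
      then have ij: "i < 2 + q" "j < 2 + q" using \<Sigma> D by auto
      have lt: "a = 0 \<or> a = 1 \<or> (\<exists>b. a = Suc (Suc b))" for a :: nat by (cases a; cases "a - 1") auto
      from lt[of i] lt[of j] show "youla_form m (Suc s) \<rho> $$ (i, j) = four_block_mat \<Sigma> (0\<^sub>m 2 q) (0\<^sub>m q 2) D $$ (i, j)"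
        using ij q D \<Sigma> by (elim disjE exE) (simp_all add: youla_form_def \<rho>_def \<Sigma>_def D_def)
    qed (use q \<Sigma> D in \<open>auto simp: youla_form_def\<close>)
    note [simp] = D carrier_matD[OF \<Sigma>] carrier_matD[OF unitaryD(1)[OF Z1]] carrier_matD[OF unitaryD(1)[OF Z0]] carrier_matD[OF unitaryD(1)[OF W]]
    have sW: "star_mat Transpose W = four_block_mat (1\<^sub>m 2) (0\<^sub>m 2 q) (0\<^sub>m q 2) (star_mat Transpose Z1)"
      unfolding W_def by (subst star_mat_four_block) (auto simp del: star_mat.simps)
    have "W * four_block_mat \<Sigma> (0\<^sub>m 2 q) (0\<^sub>m q 2) D * star_mat Transpose W = four_block_mat \<Sigma> (0\<^sub>m 2 q) (0\<^sub>m q 2) C"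
      unfolding sW unfolding W_def C_eq D_def[symmetric] by (simp add: four_block_mult_dim matalg del: star_mat.simps)
    moreover have "(Z0 * W) * four_block_mat \<Sigma> (0\<^sub>m 2 q) (0\<^sub>m q 2) D * star_mat Transpose (Z0 * W) =
        Z0 * (W * four_block_mat \<Sigma> (0\<^sub>m 2 q) (0\<^sub>m q 2) D * star_mat Transpose W) * star_mat Transpose Z0"
      using q by (simp add: starmat matalg del: star_mat.simps)
    ultimately have "B = (Z0 * W) * youla_form m (Suc s) \<rho> * star_mat Transpose (Z0 * W)"
      unfolding B form by simp
    moreover have "\<forall>i. \<rho> i > 0" using \<sigma> \<tau> by (auto simp: \<rho>_def split: nat.split)
    moreover have "2 * Suc s \<le> m" using s q by simp
    ultimately show ?thesis using unitary_mult[OF Z0 W] by blast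
  qed
qed

section \<open>The canonical forms Delta\<close>

lemma dim_perm_mat [simp]: "dim_row (perm_mat m \<pi>) = m" "dim_col (perm_mat m \<pi>) = m"
  by (auto simp: perm_mat_def)

lemma perm_mat_conjugate:
  assumes \<pi>: "\<pi> permutes {..<m}" and N: "N \<in> carrier_mat m m"
  shows "perm_mat m \<pi> * N * star_mat st (perm_mat m \<pi>) = mat m m (\<lambda>(a, b). N $$ (inv_into UNIV \<pi> a, inv_into UNIV \<pi> b))"
proof -
  have inv: "a = \<pi> k \<longleftrightarrow> inv_into UNIV \<pi> a = k" for a k using permutes_inverses[OF \<pi>] by metis
  have inv_less: "inv_into UNIV \<pi> a < m" if "a < m" for a
    using permutes_in_image[OF permutes_inv[OF \<pi>], of a] that by simp
  have 1: "perm_mat m \<pi> * N = mat m m (\<lambda>(a, b). N $$ (inv_into UNIV \<pi> a, b))"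
    by (rule eq_matI) (use N inv_less in \<open>auto simp: perm_mat_def scalar_prod_def inv if_distrib[of "\<lambda>x. x * _"] cong: if_cong\<close>)
  have 2: "star_mat st (perm_mat m \<pi>) = mat m m (\<lambda>(a, b). if inv_into UNIV \<pi> b = a then 1 else 0)"
    by (rule eq_matI) (auto simp: perm_mat_def inv star_scalar_def)
  show ?thesis unfolding 1 2
    by (rule eq_matI) (use inv_less in \<open>auto simp: scalar_prod_def if_distrib[of "\<lambda>x. _ * x"] cong: if_cong\<close>)
qed

lemma perm_mat_invertible:
  assumes \<pi>: "\<pi> permutes {..<m}"
  shows "invertible_mat (perm_mat m \<pi>)"
proof -
  have "perm_mat m \<pi> * 1\<^sub>m m * star_mat Transpose (perm_mat m \<pi>) = 1\<^sub>m m"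
    unfolding perm_mat_conjugate[OF \<pi> one_carrier_mat]
    by (rule eq_matI) (use permutes_in_image[OF permutes_inv[OF \<pi>]] permutes_inj[OF permutes_inv[OF \<pi>]] in \<open>auto dest: injD\<close>)
  then show ?thesis
    by (intro invertible_matI(1)[of _ m "star_mat Transpose (perm_mat m \<pi>)"]) (auto intro!: carrier_matI simp del: star_mat.simps)
qed

lemma mat_diag_invertible:
  assumes "\<And>i. i < m \<Longrightarrow> d i \<noteq> (0 :: complex)"
  shows "invertible_mat (mat_diag m d)"
proof -
  have "mat_diag m d * mat_diag m (\<lambda>i. 1 / d i) = 1\<^sub>m m"
    unfolding mat_diag_diag by (rule eq_matI) (use assms in \<open>auto simp: mat_diag_def\<close>)
  then show ?thesis by (intro invertible_matI(1)[of _ m "mat_diag m (\<lambda>i. 1 / d i)"]) auto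
qed

lemma unitary_invertible: "unitary m Z \<Longrightarrow> invertible_mat Z"
  using unitaryD[of m Z] by (intro invertible_matI(1)[of _ m "mat_adjoint Z"] adjoint_carrier) auto

lemma scaled_unitary_invertible:
  fixes d :: "nat \<Rightarrow> real"
  assumes Z: "unitary m Z" and \<pi>: "\<pi> permutes {..<m}" and d: "\<forall>i<m. 0 < d i"
  shows "Z * perm_mat m \<pi> * mat_diag m (\<lambda>i. complex_of_real (d i)) \<in> carrier_mat m m"
    "invertible_mat (Z * perm_mat m \<pi> * mat_diag m (\<lambda>i. complex_of_real (d i)))"
proof -
  note Zc = unitaryD(1)[OF Z]
  have P: "perm_mat m \<pi> \<in> carrier_mat m m" and D: "mat_diag m (\<lambda>i. complex_of_real (d i)) \<in> carrier_mat m m"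
    by (auto intro!: carrier_matI)
  show "Z * perm_mat m \<pi> * mat_diag m (\<lambda>i. complex_of_real (d i)) \<in> carrier_mat m m"
    by (rule mult_carrier_mat[OF mult_carrier_mat[OF Zc P] D])
  have "invertible_mat (mat_diag m (\<lambda>i. complex_of_real (d i)))"
    by (rule mat_diag_invertible) (use d in force)
  then show "invertible_mat (Z * perm_mat m \<pi> * mat_diag m (\<lambda>i. complex_of_real (d i)))"
    by (rule invertible_mat_mult[OF mult_carrier_mat[OF Zc P] D
          invertible_mat_mult[OF Zc P unitary_invertible[OF Z] perm_mat_invertible[OF \<pi>]]])
qed

lemma is_Y_factorI:
  fixes d :: "nat \<Rightarrow> real"
  assumes "unitary m Z" "\<pi> permutes {..<m}" "\<forall>i<m. 0 < d i"
    and "Y = Z * perm_mat m \<pi> * mat_diag m (\<lambda>i. complex_of_real (d i))"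
    and "B = Y * Delta_factor eps st m B * star_mat st Y"
  shows "is_Y_factor eps st m B Y"
  unfolding is_Y_factor_def using assms(1) unfolding unitary_def
  by (intro conjI exI[of _ Z] exI[of _ \<pi>] exI[of _ d] assms(2-)) simp_all

lemma is_Y_factorD:
  assumes "is_Y_factor eps st m B Y"
  shows "Y \<in> carrier_mat m m" "invertible_mat Y" "B = Y * Delta_factor eps st m B * star_mat st Y"
proof -
  from assms obtain Z \<pi> and d :: "nat \<Rightarrow> real" where Z: "unitary m Z" and \<pi>: "\<pi> permutes {..<m}"
    and d: "\<forall>i<m. 0 < d i" and Y: "Y = Z * perm_mat m \<pi> * mat_diag m (\<lambda>i. complex_of_real (d i))"
    and B: "B = Y * Delta_factor eps st m B * star_mat st Y"
    unfolding is_Y_factor_def unitary_def by blast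
  show "Y \<in> carrier_mat m m" "invertible_mat Y"
    unfolding Y by (rule scaled_unitary_invertible[OF Z \<pi> d])+
  show "B = Y * Delta_factor eps st m B * star_mat st Y" by (rule B)
qed

text \<open>
  How a congruence normal form \<open>M\<close> becomes \<open>\<Delta>\<close>: the permutation moves the entries to their places, and the
  positive scaling changes their moduli to 1.
\<close>
lemma sorted_scaled_factorization:
  fixes d :: "nat \<Rightarrow> real"
  assumes Z: "unitary m Z" and \<pi>: "\<pi> permutes {..<m}"
    and B: "B = Z * M * star_mat st Z" and M: "M \<in> carrier_mat m m"
    and \<Delta>: "\<Delta> \<in> carrier_mat m m"
    and entries: "\<And>i j. i < m \<Longrightarrow> j < m \<Longrightarrow> M $$ (\<pi> i, \<pi> j) = of_real (d i) * \<Delta> $$ (i, j) * of_real (d j)"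
    and Y: "Y = Z * perm_mat m \<pi> * mat_diag m (\<lambda>i. complex_of_real (d i))"
  shows "B = Y * \<Delta> * star_mat st Y"
proof -
  define P D where "P = perm_mat m \<pi>" and "D = mat_diag m (\<lambda>i. complex_of_real (d i))"
  note [simp] = carrier_matD[OF unitaryD(1)[OF Z]] carrier_matD[OF M] carrier_matD[OF \<Delta>]
  have [simp]: "dim_row P = m" "dim_col P = m" "dim_row D = m" "dim_col D = m" by (auto simp: P_def D_def)
  have Ds: "star_mat st D = D" by (rule eq_matI) (auto simp: D_def mat_diag_def)
  have N_index: "(D * \<Delta> * D) $$ (i, j) = of_real (d i) * \<Delta> $$ (i, j) * of_real (d j)" if "i < m" "j < m" for i j
  proof -
    have "D * \<Delta> \<in> carrier_mat m m" by (auto intro!: carrier_matI)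
    from mat_diag_mult_right[OF this] show ?thesis
      using that mat_diag_mult_left[OF \<Delta>] unfolding D_def by simp
  qed
  have "D * \<Delta> * D \<in> carrier_mat m m" by (auto intro!: carrier_matI)
  note perm = perm_mat_conjugate[OF \<pi> this, of st]
  have PNP: "P * (D * \<Delta> * D) * star_mat st P = M"
  proof (rule eq_matI)
    fix a b assume "a < dim_row M" "b < dim_col M"
    then have ab: "a < m" "b < m" by auto
    have less: "inv_into UNIV \<pi> a < m" "inv_into UNIV \<pi> b < m"
      using permutes_in_image[OF permutes_inv[OF \<pi>]] ab by auto
    have "(P * (D * \<Delta> * D) * star_mat st P) $$ (a, b) = (D * \<Delta> * D) $$ (inv_into UNIV \<pi> a, inv_into UNIV \<pi> b)"
      unfolding P_def perm using ab by simp
    also have "\<dots> = M $$ (\<pi> (inv_into UNIV \<pi> a), \<pi> (inv_into UNIV \<pi> b))"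
      unfolding N_index[OF less] entries[OF less] by (rule refl)
    also have "\<dots> = M $$ (a, b)" unfolding permutes_inverses(1)[OF \<pi>] by (rule refl)
    finally show "(P * (D * \<Delta> * D) * star_mat st P) $$ (a, b) = M $$ (a, b)" .
  qed auto
  have "Y * \<Delta> * star_mat st Y = Z * (P * (D * \<Delta> * D) * star_mat st P) * star_mat st Z"
    unfolding Y P_def[symmetric] D_def[symmetric] by (simp add: starmat matalg Ds)
  then show ?thesis unfolding PNP B by (rule sym)
qed

lemma scalar_mat_diag:
  "1\<^sub>m m = mat_diag m (\<lambda>_. 1 :: complex)" "0\<^sub>m m m = mat_diag m (\<lambda>_. 0 :: complex)"
  "c \<cdot>\<^sub>m mat_diag m f = mat_diag m (\<lambda>i. c * f i :: complex)"
  "- mat_diag m f = mat_diag m (\<lambda>i. - f i :: complex)"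
  by (rule eq_matI; simp add: mat_diag_def)+

lemma mat_diag_three_blocks:
  "diag_block_mat [mat_diag a f, mat_diag b g, mat_diag c h] =
    mat_diag (a + (b + c)) (\<lambda>i. if i < a then f i else if i < a + b then g (i - a) else h (i - a - b))"
proof -
  have "diag_block_mat [mat_diag b g, mat_diag c h] = mat_diag (b + c) (\<lambda>i. if i < b then g i else h (i - b))"
    unfolding diag_block_mat_two by (simp add: mat_diag_block)
  then have "diag_block_mat [mat_diag a f, mat_diag b g, mat_diag c h] =
      mat_diag (a + (b + c)) (\<lambda>i. if i < a then f i else if i - a < b then g (i - a) else h (i - a - b))"
    by (subst diag_block_mat.simps) (simp add: Let_def mat_diag_block del: diag_block_mat.simps)
  then show ?thesis by (simp add: mat_diag_def cong: if_cong) (rule eq_matI, auto)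
qed

lemma Delta_pq_eq:
  assumes "p + q \<le> m"
  shows "Delta_pq eps m p q = mat_diag m (\<lambda>i.
    if eps = 1 then (if i < q then \<i> else if i < p + q then - \<i> else 0)
    else (if i < p then 1 else if i < p + q then - 1 else 0))"
  using assms unfolding Delta_pq_def scalar_mat_diag mat_diag_three_blocks
  by (auto simp: add.commute simp del: mat_diag_one diag_block_mat.simps cong: if_cong)

lemma Delta_t_minus_eq:
  assumes "t \<le> m" "eps \<noteq> 1"
  shows "Delta_t eps m t = mat_diag m (\<lambda>i. if i < t then 1 else 0)"
  using assms unfolding Delta_t_def diag_block_mat_two scalar_mat_diag by (simp add: mat_diag_block del: mat_diag_one)

lemma Delta_t_plus_eq:
  assumes "2 * s \<le> m"
  shows "Delta_t 1 m (2 * s) = mat m m (\<lambda>(i, j). if i < s \<and> j = i + s then 1 else if j < s \<and> i = j + s then - 1 else 0)"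
  by (rule eq_matI) (use assms in \<open>auto simp: Delta_t_def Let_def\<close>)

lemma Delta_pq_full:
  assumes "eps \<in> {1, -1}"
  shows "Delta_pq eps (p + q) p q \<in> carrier_mat (p + q) (p + q)" "invertible_mat (Delta_pq eps (p + q) p q)"
    "star_mat ConjTranspose (Delta_pq eps (p + q) p q) = (- eps) \<cdot>\<^sub>m Delta_pq eps (p + q) p q"
  unfolding Delta_pq_eq[OF order_refl]
proof -
  let ?d = "\<lambda>i. if eps = 1 then if i < q then \<i> else if i < p + q then - \<i> else 0
      else if i < p then 1 else if i < p + q then - 1 else 0"
  show "mat_diag (p + q) ?d \<in> carrier_mat (p + q) (p + q)" by simp
  show "invertible_mat (mat_diag (p + q) ?d)" by (rule mat_diag_invertible) auto
  show "star_mat ConjTranspose (mat_diag (p + q) ?d) = (- eps) \<cdot>\<^sub>m mat_diag (p + q) ?d"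
    by (rule eq_matI) (use assms in \<open>auto simp: mat_diag_def\<close>)
qed

lemma Delta_t_full:
  assumes "eps \<in> {1, -1}" and even: "eps = 1 \<Longrightarrow> even m"
  shows "Delta_t eps m m \<in> carrier_mat m m" "invertible_mat (Delta_t eps m m)"
    "star_mat Transpose (Delta_t eps m m) = (- eps) \<cdot>\<^sub>m Delta_t eps m m"
proof -
  have "Delta_t eps m m \<in> carrier_mat m m \<and> invertible_mat (Delta_t eps m m) \<and>
    star_mat Transpose (Delta_t eps m m) = (- eps) \<cdot>\<^sub>m Delta_t eps m m"
  proof (cases "eps = 1")
    case True
    then obtain s where s: "m = 2 * s" using even by (auto elim: evenE)
    define A where "A = four_block_mat (0\<^sub>m s s) (1\<^sub>m s) (- 1\<^sub>m s) (0\<^sub>m s s :: complex mat)"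
    have eq: "Delta_t eps m m = A"
      unfolding True s Delta_t_plus_eq[OF order_refl] A_def by (rule eq_matI) auto
    have Ac: "A \<in> carrier_mat m m" by (auto simp: A_def s intro!: carrier_matI)
    have "star_mat Transpose A = four_block_mat (0\<^sub>m s s) (- 1\<^sub>m s) (1\<^sub>m s) (0\<^sub>m s s)"
      unfolding A_def by (subst star_mat_four_block) (simp_all add: star_mat_uminus del: star_mat.simps)
    also have "\<dots> = - A" unfolding A_def by (rule eq_matI) auto
    finally have star: "star_mat Transpose A = - A" .
    have "A * (- A) = 1\<^sub>m m"
    proof -
      have "A * A = four_block_mat (- 1\<^sub>m s) (0\<^sub>m s s) (0\<^sub>m s s) (- 1\<^sub>m s)"
        unfolding A_def by (simp add: four_block_mult_dim matalg)
      also have "\<dots> = - 1\<^sub>m m" unfolding s by (rule eq_matI) auto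
      finally have AA: "A * A = - 1\<^sub>m m" .
      show ?thesis by (subst mult_uminus_dim) (use Ac AA in auto)
    qed
    then have "invertible_mat A" using Ac by (intro invertible_matI(1)[of _ m "- A"]) auto
    then show ?thesis unfolding eq star using Ac True by (auto simp: matalg one_smult_mat)
  next
    case False
    then have [simp]: "eps = -1" using assms by auto
    have eq: "Delta_t eps m m = 1\<^sub>m m"
      using Delta_t_minus_eq[OF order_refl False] by (intro eq_matI) (auto simp: mat_diag_def)
    have "invertible_mat (1\<^sub>m m :: complex mat)" by (rule invertible_matI(1)[of _ m "1\<^sub>m m"]) auto
    then show ?thesis unfolding eq by (simp add: one_smult_mat)
  qed
  then show "Delta_t eps m m \<in> carrier_mat m m" "invertible_mat (Delta_t eps m m)"
    "star_mat Transpose (Delta_t eps m m) = (- eps) \<cdot>\<^sub>m Delta_t eps m m" by blast+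
qed

section \<open>Inertia\<close>

lemma proots_prod_linear: "proots (\<Prod>a\<leftarrow>xs. [:- a, 1:]) = mset (xs :: complex list)"
proof (induction xs)
  case (Cons a xs)
  have "(\<Prod>a\<leftarrow>xs. [:- a, 1:]) \<noteq> 0" by (auto simp: prod_list_zero_iff)
  then show ?case using Cons by (simp add: proots_mult del: mult_pCons_left)
qed auto

lemma mat_eigenvalues_diagonalized:
  assumes Z: "unitary m Z" and H: "H = Z * mat_diag m d * mat_adjoint Z"
  shows "mat_eigenvalues H = mset (map d [0..<m])"
proof -
  note uZ = unitaryD[OF Z]
  have "similar_mat H (mat_diag m d)"
    by (rule similar_matI[of _ _ Z "mat_adjoint Z" m]) (use uZ H in \<open>auto intro!: adjoint_carrier\<close>)
  then have "char_poly H = char_poly (mat_diag m d)" by (rule char_poly_similar)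
  also have "\<dots> = (\<Prod>a\<leftarrow>diag_mat (mat_diag m d). [:- a, 1:])"
    by (rule char_poly_upper_triangular[of _ m]) (auto simp: upper_triangular_def mat_diag_def)
  also have "diag_mat (mat_diag m d) = map d [0..<m]"
    by (auto simp: diag_mat_def mat_diag_def)
  finally show ?thesis unfolding mat_eigenvalues_def by (simp only: proots_prod_linear)
qed

lemma inertia_diagonalized:
  fixes d :: "nat \<Rightarrow> real"
  assumes Z: "unitary m Z" and H: "H = Z * mat_diag m (\<lambda>i. of_real (d i)) * mat_adjoint Z"
  shows "pos_inertia H = card {i. i < m \<and> 0 < d i}" "neg_inertia H = card {i. i < m \<and> d i < 0}"
proof -
  note e = mat_eigenvalues_diagonalized[OF assms]
  have len: "length (filter P [0..<m]) = card {i. i < m \<and> P i}" for P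
    unfolding length_filter_conv_card by (rule arg_cong[of _ _ card]) auto
  show "pos_inertia H = card {i. i < m \<and> 0 < d i}" "neg_inertia H = card {i. i < m \<and> d i < 0}"
    unfolding pos_inertia_def neg_inertia_def e mset_filter[symmetric] size_mset filter_map
    using len[of "\<lambda>i. 0 < d i"] len[of "\<lambda>i. d i < 0"] by (simp_all add: comp_def)
qed

text \<open>
  Enumerates the indices with property \<open>P\<close>, then those with property \<open>Q\<close>, then the others.
\<close>
lemma sorting_permutation:
  fixes P Q :: "nat \<Rightarrow> bool" and m :: nat
  assumes disj: "\<And>i. \<not> (P i \<and> Q i)"
  defines "a \<equiv> card {i. i < m \<and> P i}" and "b \<equiv> card {i. i < m \<and> Q i}"
  obtains \<pi> where "\<pi> permutes {..<m}" "a + b \<le> m"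
    "\<forall>i<m. if i < a then P (\<pi> i) else if i < a + b then Q (\<pi> i) else \<not> P (\<pi> i) \<and> \<not> Q (\<pi> i)"
proof -
  have len: "length (filter R [0..<m]) = card {i. i < m \<and> R i}" for R
    unfolding length_filter_conv_card by (rule arg_cong[of _ _ card]) auto
  define L1 L2 L3 where "L1 = filter P [0..<m]" and "L2 = filter Q [0..<m]" 
    and "L3 = filter (\<lambda>i. \<not> P i \<and> \<not> Q i) [0..<m]"
  define L where "L = L1 @ L2 @ L3"
  have l: "length L1 = a" "length L2 = b" by (auto simp: L1_def L2_def len a_def b_def)
  have dist: "distinct L" using disj by (auto simp: L_def L1_def L2_def L3_def)
  have set: "set L = {..<m}" by (auto simp: L_def L1_def L2_def L3_def)
  have lenL: "length L = m" using distinct_card[OF dist] set by simp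
  then have ab: "a + b \<le> m" using l by (simp add: L_def)
  define \<pi> where "\<pi> i = (if i < m then L ! i else i)" for i
  have "bij_betw (\<lambda>i. L ! i) {..<m} {..<m}" using bij_betw_nth[OF dist] lenL set by auto
  then have "bij_betw \<pi> {..<m} {..<m}" by (rule bij_betw_cong[THEN iffD1, rotated]) (auto simp: \<pi>_def)
  then have "\<pi> permutes {..<m}" by (rule bij_imp_permutes) (auto simp: \<pi>_def)
  moreover have "P (\<pi> i)" if "i < a" for i
  proof -
    have "L ! i = L1 ! i" "L1 ! i \<in> set L1" using that l by (auto simp: L_def nth_append)
    then show ?thesis using that ab by (auto simp: \<pi>_def L1_def)
  qed
  moreover have "Q (\<pi> i)" if "a \<le> i" "i < a + b" for i
  proof -
    have "L ! i = L2 ! (i - a)" "L2 ! (i - a) \<in> set L2" using that l by (auto simp: L_def nth_append)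
    then show ?thesis using that ab by (auto simp: \<pi>_def L2_def)
  qed
  moreover have "\<not> P (\<pi> i) \<and> \<not> Q (\<pi> i)" if "a + b \<le> i" "i < m" for i
  proof -
    have "L ! i = L3 ! (i - (a + b))" using that l by (auto simp: L_def nth_append)
    moreover have "L3 ! (i - (a + b)) \<in> set L3" using that l lenL by (intro nth_mem) (auto simp: L_def)
    ultimately show ?thesis using that by (auto simp: \<pi>_def L3_def)
  qed
  ultimately show thesis using ab by (intro that[of \<pi>]) auto
qed

section \<open>The star-factorization\<close>

lemma csqrt_minus_eps: "csqrt (- 1) = \<i>" "csqrt (- (- 1)) = 1"
  by (simp_all add: csqrt.code complex_eq_iff)

text \<open>
  Multiplication by the square root of \<open>- \<epsilon>\<close> makes \<open>B\<close> Hermitian; its diagonalization also diagonalizes \<open>B\<close>.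
\<close>
lemma hermitian_multiple:
  assumes eps: "eps \<in> {1, -1}" and B: "B \<in> carrier_mat m m" "star_mat ConjTranspose B = (- eps) \<cdot>\<^sub>m B"
  obtains Z and d :: "nat \<Rightarrow> real" where "unitary m Z"
    "csqrt (- eps) \<cdot>\<^sub>m B = Z * mat_diag m (\<lambda>i. of_real (d i)) * mat_adjoint Z"
    "B = Z * mat_diag m (\<lambda>i. (if eps = 1 then - \<i> else 1) * of_real (d i)) * star_mat ConjTranspose Z"
    "pos_inertia (csqrt (- eps) \<cdot>\<^sub>m B) = card {i. i < m \<and> 0 < d i}"
    "neg_inertia (csqrt (- eps) \<cdot>\<^sub>m B) = card {i. i < m \<and> d i < 0}"
proof -
  define c where "c = csqrt (- eps)"
  define c' where "c' = (if eps = 1 then - \<i> else 1)"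
  have c: "c' * c = 1" "cnj c * (- eps) = c"
    using eps by (auto simp: c_def c'_def csqrt_minus_eps)
  have "star_mat ConjTranspose (c \<cdot>\<^sub>m B) = (cnj c * (- eps)) \<cdot>\<^sub>m B"
    unfolding star_mat_smult B(2) by (simp add: smult_smult_assoc star_scalar_def)
  then have "star_mat ConjTranspose (c \<cdot>\<^sub>m B) = c \<cdot>\<^sub>m B" by (simp only: c)
  from unitary_diagonalization[OF _ this, of m] B(1) obtain Z and d :: "nat \<Rightarrow> real" where Z: "unitary m Z"
    and H: "c \<cdot>\<^sub>m B = Z * mat_diag m (\<lambda>i. of_real (d i)) * mat_adjoint Z" by auto
  note [simp] = carrier_matD[OF unitaryD(1)[OF Z]]
  have "B = c' \<cdot>\<^sub>m (c \<cdot>\<^sub>m B)" by (simp add: smult_smult_assoc c one_smult_mat)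
  also have "\<dots> = Z * (c' \<cdot>\<^sub>m mat_diag m (\<lambda>i. of_real (d i))) * mat_adjoint Z"
    unfolding H by (simp add: matalg)
  also have "c' \<cdot>\<^sub>m mat_diag m (\<lambda>i. of_real (d i)) = mat_diag m (\<lambda>i. c' * of_real (d i))"
    by (rule eq_matI) (auto simp: mat_diag_def)
  finally show thesis
    using that[OF Z, of d] H inertia_diagonalized[OF Z H] by (simp add: c_def c'_def)
qed

text \<open>
  The nonzero eigenvalues of the Hermitian matrix are sorted by sign. For \<open>\<epsilon> = 1\<close> the negative ones
  come first: \<open>B\<close> is \<open>- \<i>\<close> times the Hermitian matrix, so they produce the entries \<open>\<i>\<close> of \<open>\<Delta>\<close>.
\<close>
lemma star_factorization_conj:
  assumes eps: "eps \<in> {1, -1}" and B: "B \<in> carrier_mat m m" "star_mat ConjTranspose B = (- eps) \<cdot>\<^sub>m B"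
  shows "pos_inertia (csqrt (- eps) \<cdot>\<^sub>m B) + neg_inertia (csqrt (- eps) \<cdot>\<^sub>m B) \<le> m"
    "Delta_factor eps ConjTranspose m B \<in> carrier_mat m m"
    "\<exists>Y. is_Y_factor eps ConjTranspose m B Y"
    "invertible_mat B \<Longrightarrow> pos_inertia (csqrt (- eps) \<cdot>\<^sub>m B) + neg_inertia (csqrt (- eps) \<cdot>\<^sub>m B) = m"
proof -
  obtain Z and \<sigma> :: "nat \<Rightarrow> real" where Z: "unitary m Z"
    and H: "csqrt (- eps) \<cdot>\<^sub>m B = Z * mat_diag m (\<lambda>i. of_real (\<sigma> i)) * mat_adjoint Z"
    and B_eq: "B = Z * mat_diag m (\<lambda>i. (if eps = 1 then - \<i> else 1) * of_real (\<sigma> i)) * star_mat ConjTranspose Z"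
    and inertia: "pos_inertia (csqrt (- eps) \<cdot>\<^sub>m B) = card {i. i < m \<and> 0 < \<sigma> i}"
      "neg_inertia (csqrt (- eps) \<cdot>\<^sub>m B) = card {i. i < m \<and> \<sigma> i < 0}"
    by (rule hermitian_multiple[OF assms])
  define p q where "p = card {i. i < m \<and> 0 < \<sigma> i}" and "q = card {i. i < m \<and> \<sigma> i < 0}"
  define D where "D = Delta_factor eps ConjTranspose m B"
  have D_eq: "D = Delta_pq eps m p q" by (simp add: D_def inertia p_def q_def)
  have "\<exists>\<pi>. \<pi> permutes {..<m} \<and> p + q \<le> m \<and> (\<forall>i<m. 
     (if eps = 1 then (if i < q then \<sigma> (\<pi> i) < 0 else if i < p + q then \<sigma> (\<pi> i) > 0 else \<sigma> (\<pi> i) = 0)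
     else (if i < p then \<sigma> (\<pi> i) > 0 else if i < p + q then \<sigma> (\<pi> i) < 0 else \<sigma> (\<pi> i) = 0)))"
  proof (cases "eps = 1")
    case True
    obtain \<pi> where "\<pi> permutes {..<m}" "q + p \<le> m" "\<forall>i<m. if i < q then \<sigma> (\<pi> i) < 0
        else if i < q + p then \<sigma> (\<pi> i) > 0 else \<not> \<sigma> (\<pi> i) < 0 \<and> \<not> \<sigma> (\<pi> i) > 0"
      by (rule sorting_permutation[of "\<lambda>i. \<sigma> i < 0" "\<lambda>i. 0 < \<sigma> i" m, folded p_def q_def]) auto
    then show ?thesis using True by (intro exI[of _ \<pi>]) (auto simp: add.commute not_less intro: antisym)
  next
    case False
    obtain \<pi> where "\<pi> permutes {..<m}" "p + q \<le> m" "\<forall>i<m. if i < p then \<sigma> (\<pi> i) > 0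
        else if i < p + q then \<sigma> (\<pi> i) < 0 else \<not> \<sigma> (\<pi> i) > 0 \<and> \<not> \<sigma> (\<pi> i) < 0"
      by (rule sorting_permutation[of "\<lambda>i. 0 < \<sigma> i" "\<lambda>i. \<sigma> i < 0" m, folded p_def q_def]) auto
    then show ?thesis using False by (intro exI[of _ \<pi>]) (auto simp: not_less intro: antisym)
  qed
  then obtain \<pi> where \<pi>: "\<pi> permutes {..<m}" and pq: "p + q \<le> m" and sorted: "\<And>i. i < m \<Longrightarrow> 
     (if eps = 1 then (if i < q then \<sigma> (\<pi> i) < 0 else if i < p + q then \<sigma> (\<pi> i) > 0 else \<sigma> (\<pi> i) = 0)
     else (if i < p then \<sigma> (\<pi> i) > 0 else if i < p + q then \<sigma> (\<pi> i) < 0 else \<sigma> (\<pi> i) = 0))" by blast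
  show "pos_inertia (csqrt (- eps) \<cdot>\<^sub>m B) + neg_inertia (csqrt (- eps) \<cdot>\<^sub>m B) \<le> m"
    using pq by (simp add: inertia p_def q_def)
  have D: "D \<in> carrier_mat m m" unfolding D_eq Delta_pq_eq[OF pq] by simp
  then show "Delta_factor eps ConjTranspose m B \<in> carrier_mat m m" by (simp add: D_def)
  define \<delta> where "\<delta> i = (if \<sigma> (\<pi> i) = 0 then 1 else sqrt \<bar>\<sigma> (\<pi> i)\<bar>)" for i
  have \<delta>: "\<delta> i > 0" for i by (auto simp: \<delta>_def)
  have \<delta>2: "complex_of_real (\<delta> i) * complex_of_real (\<delta> i) = of_real (\<bar>\<sigma> (\<pi> i)\<bar>)" if "\<sigma> (\<pi> i) \<noteq> 0" for i
    using that by (simp add: \<delta>_def flip: of_real_mult)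
  define Y where "Y = Z * perm_mat m \<pi> * mat_diag m (\<lambda>i. complex_of_real (\<delta> i))"
  have "B = Y * D * star_mat ConjTranspose Y"
  proof (rule sorted_scaled_factorization[OF Z \<pi> B_eq _ D _ Y_def])
    fix i j assume ij: "i < m" "j < m"
    have pi: "\<pi> i < m" "\<pi> j < m" "\<pi> i = \<pi> j \<longleftrightarrow> i = j"
      using permutes_in_image[OF \<pi>] ij permutes_inj[OF \<pi>] by (auto dest: injD)
    show "mat_diag m (\<lambda>i. (if eps = 1 then - \<i> else 1) * complex_of_real (\<sigma> i)) $$ (\<pi> i, \<pi> j) =
        complex_of_real (\<delta> i) * D $$ (i, j) * complex_of_real (\<delta> j)"
    proof (cases "i = j \<and> \<sigma> (\<pi> i) \<noteq> 0")
      case True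
      then have e: "complex_of_real (\<delta> i) * D $$ (i, j) * complex_of_real (\<delta> j) = of_real (\<bar>\<sigma> (\<pi> i)\<bar>) * D $$ (i, i)"
        using \<delta>2[of i] by (auto simp: mult.commute mult.left_commute)
      show ?thesis unfolding e using True sorted[OF ij(1)] ij pi 
        by (auto simp: D_eq Delta_pq_eq[OF pq] mat_diag_def split: if_splits)
    next
      case False
      then show ?thesis using sorted[OF ij(1)] ij pi 
        by (auto simp: D_eq Delta_pq_eq[OF pq] mat_diag_def split: if_splits)
    qed
  qed auto
  then have "is_Y_factor eps ConjTranspose m B Y"
    using \<delta> unfolding D_def by (intro is_Y_factorI[OF Z \<pi> _ Y_def]) auto
  then show "\<exists>Y. is_Y_factor eps ConjTranspose m B Y" ..
  assume inv: "invertible_mat B"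
  have "\<sigma> i \<noteq> 0" if "i < m" for i
  proof
    assume "\<sigma> i = 0"
    moreover have "complex_of_real (\<sigma> i) \<in># mat_eigenvalues (csqrt (- eps) \<cdot>\<^sub>m B)"
      unfolding mat_eigenvalues_diagonalized[OF Z H] using that by simp
    ultimately have "0 \<in># mat_eigenvalues (csqrt (- eps) \<cdot>\<^sub>m B)" by simp
    then have "0 \<in> spectrum (csqrt (- eps) \<cdot>\<^sub>m B)" using set_mat_eigenvalues[of "csqrt (- eps) \<cdot>\<^sub>m B" m] B by simp
    then have "det (char_matrix (csqrt (- eps) \<cdot>\<^sub>m B) 0) = 0" using spectrum_iff_det[of "csqrt (- eps) \<cdot>\<^sub>m B" m] B by simp
    moreover have "char_matrix (csqrt (- eps) \<cdot>\<^sub>m B) 0 = csqrt (- eps) \<cdot>\<^sub>m B"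
      unfolding char_matrix_def by (rule eq_matI) (use B in auto)
    moreover have "csqrt (- eps) \<noteq> 0" using eps by auto
    ultimately show False using invertible_mat_smult[OF B(1) inv, of "csqrt (- eps)"] invertible_mat_iff_det[of "csqrt (- eps) \<cdot>\<^sub>m B" m] B(1) by simp
  qed
  then have "{i. i < m \<and> 0 < \<sigma> i} \<union> {i. i < m \<and> \<sigma> i < 0} = {..<m}"
    by (auto simp: neq_iff)
  then have "card ({i. i < m \<and> 0 < \<sigma> i} \<union> {i. i < m \<and> \<sigma> i < 0}) = m" by simp
  then have "p + q = m" unfolding p_def q_def by (subst (asm) card_Un_disjoint) auto
  then show "pos_inertia (csqrt (- eps) \<cdot>\<^sub>m B) + neg_inertia (csqrt (- eps) \<cdot>\<^sub>m B) = m"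
    by (simp add: inertia p_def q_def)
qed

text \<open>
  The surjectivity of \<open>Q\<close> makes the column spaces of \<open>P * Q\<close> and \<open>P\<close> equal, and the columns of \<open>P\<close> are
  independent.
\<close>
lemma rank_factor:
  fixes P Q :: "complex mat"
  assumes P: "P \<in> carrier_mat m t" "P' \<in> carrier_mat t m" "P' * P = 1\<^sub>m t"
    and Q: "Q \<in> carrier_mat t m" "Q' \<in> carrier_mat m t" "Q * Q' = 1\<^sub>m t"
  shows "vec_space.rank m (P * Q) = t"
proof -
  interpret vec_space "TYPE(complex)" m .
  have PQ: "P * Q \<in> carrier_mat m m" using P Q by simp
  have P_inj: "v = w" if "P *\<^sub>v v = P *\<^sub>v w" "v \<in> carrier_vec t" "w \<in> carrier_vec t" for v w
  proof -
    have "(P' * P) *\<^sub>v v = (P' * P) *\<^sub>v w"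
      unfolding assoc_mult_mat_vec[OF P(2,1) that(2)] assoc_mult_mat_vec[OF P(2,1) that(3)] that(1) by (rule refl)
    then show ?thesis using that(2,3) unfolding P(3) by simp
  qed
  have "span (set (cols (P * Q))) = span (set (cols P))"
  proof -
    have "{w \<in> carrier_vec m. \<exists>x \<in> carrier_vec m. (P * Q) *\<^sub>v x = w} = {w \<in> carrier_vec m. \<exists>x \<in> carrier_vec t. P *\<^sub>v x = w}"
    proof (intro equalityI subsetI; clarsimp)
      fix x :: "complex vec" assume "x \<in> carrier_vec m"
      then show "\<exists>y \<in> carrier_vec t. P *\<^sub>v y = P * Q *\<^sub>v x" using P Q by (intro bexI[of _ "Q *\<^sub>v x"]) auto
    next
      fix x :: "complex vec" assume x: "x \<in> carrier_vec t"
      have "Q *\<^sub>v (Q' *\<^sub>v x) = (Q * Q') *\<^sub>v x" by (rule assoc_mult_mat_vec[OF Q(1,2) x, symmetric])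
      then have QQ: "Q *\<^sub>v (Q' *\<^sub>v x) = x" unfolding Q(3) using x by simp
      have "Q' *\<^sub>v x \<in> carrier_vec m" using Q x by auto
      moreover from this have "P * Q *\<^sub>v (Q' *\<^sub>v x) = P *\<^sub>v x"
        by (subst assoc_mult_mat_vec[OF P(1) Q(1)]) (auto simp: QQ)
      ultimately show "\<exists>y \<in> carrier_vec m. P * Q *\<^sub>v y = P *\<^sub>v x"
        by blast
    qed
    then show ?thesis using col_space_eq[OF PQ] col_space_eq[OF P(1)] PQ P(1) Q(1) by (simp add: col_space_def)
  qed
  then have "rank (P * Q) = rank P" unfolding rank_def by simp
  also have "rank P = t"
  proof -
    have P_unit: "P *\<^sub>v unit_vec t i = col P i" if "i < t" for i
      using P(1) that by (intro eq_vecI) auto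
    have dist: "distinct (cols P)"
    proof (rule ccontr)
      assume "\<not> distinct (cols P)"
      then obtain i j where ij: "i < t" "j < t" "i \<noteq> j" "col P i = col P j"
        using P(1) by (auto simp: distinct_conv_nth)
      then have "unit_vec t i = (unit_vec t j :: complex vec)" using P_unit ij by (intro P_inj[of "unit_vec t i" "unit_vec t j"]) simp_all
      then show False using ij by simp
    qed
    moreover have "lin_indpt (set (cols P))"
    proof
      assume "lin_dep (set (cols P))"
      from lin_depE[OF P(1) this dist] obtain v where v: "v \<in> carrier_vec t" "v \<noteq> 0\<^sub>v t" "P *\<^sub>v v = 0\<^sub>v m" by blast
      moreover have "P *\<^sub>v 0\<^sub>v t = 0\<^sub>v m" using P(1) by (intro eq_vecI) auto
      ultimately have "v = 0\<^sub>v t" by (intro P_inj[of v "0\<^sub>v t"]) simp_all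
      then show False using v by simp
    qed
    ultimately show ?thesis using lin_indpt_full_rank[OF P(1)] by simp
  qed
  finally show ?thesis .
qed

text \<open>
  The middle factor is the product of \<open>E = [1; 0]\<close>, \<open>D\<close> and \<open>F = [1 0]\<close>, so \<open>rank_factor\<close> applies to \<open>Y E\<close> and
  \<open>D F Y\<^sup>\<star>\<close>.
\<close>
lemma rank_congruence:
  assumes Y: "Y \<in> carrier_mat m m" "invertible_mat Y" and D: "D \<in> carrier_mat t t" "invertible_mat D" and t: "t \<le> m"
    and B: "B = Y * four_block_mat D (0\<^sub>m t (m - t)) (0\<^sub>m (m - t) t) (0\<^sub>m (m - t) (m - t)) * star_mat st Y"
  shows "vec_space.rank m B = t"
proof -
  note Yi = mat_inv[OF Y] and Di = mat_inv[OF D]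
  note Ysi = mat_inv[OF star_mat_carrier[OF Y(1), of st] invertible_star_mat(1)[OF Y, of st]]
  note [simp] = carrier_matD[OF Y(1)] carrier_matD[OF D(1)] carrier_matD[OF Yi(1)] carrier_matD[OF Di(1)] carrier_matD[OF Ysi(1)]
  define E F where "E = 1\<^sub>m t @\<^sub>r (0\<^sub>m (m - t) t :: complex mat)" and "F = append_cols (1\<^sub>m t) (0\<^sub>m t (m - t))"
  have [simp]: "dim_row E = m" "dim_col E = t" "dim_row F = t" "dim_col F = m" using t by (auto simp: E_def F_def)
  have FE: "F * E = 1\<^sub>m t" unfolding E_def F_def by (subst append_cols_mult_append_rows) (auto simp: matalg)
  have EDF: "E * (D * F) = four_block_mat D (0\<^sub>m t (m - t)) (0\<^sub>m (m - t) t) (0\<^sub>m (m - t) (m - t))"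
  proof -
    have "D * F = append_cols D (0\<^sub>m t (m - t))"
      unfolding F_def by (subst mult_append_cols) (auto simp: matalg)
    then show ?thesis unfolding E_def
      by (simp only:) (subst append_rows_mult_append_cols; simp add: matalg)
  qed
  have B': "B = (Y * E) * ((D * F) * star_mat st Y)"
    unfolding B EDF[symmetric] by (simp add: matalg)
  note c = mult_cancel_left_dim[OF Yi(3)] mult_cancel_left_dim[OF Ysi(2)] mult_cancel_left_dim[OF FE] 
  show ?thesis unfolding B'
    by (rule rank_factor[of _ _ _ "F * mat_inv Y" _ "mat_inv (star_mat st Y) * (E * mat_inv D)"])
      (auto intro!: carrier_matI simp: matalg c FE Di)
qed

text \<open>
  The decompositions yield a factorization whose canonical form has some parameter \<open>t\<close>; that \<open>t\<close> is the
  rank of \<open>B\<close>, as the definition of \<open>\<Delta>\<close> requires, is seen afterwards from the factorization itself.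
\<close>
lemma star_factorization_transpose:
  assumes eps: "eps \<in> {1, -1}" and B: "B \<in> carrier_mat m m" "star_mat Transpose B = (- eps) \<cdot>\<^sub>m B"
  shows "eps = 1 \<Longrightarrow> even (vec_space.rank m B)"
    "Delta_factor eps Transpose m B \<in> carrier_mat m m"
    "\<exists>Y. is_Y_factor eps Transpose m B Y"
proof -
  have "\<exists>t Z \<pi> d. t \<le> m \<and> (eps = 1 \<longrightarrow> even t) \<and> unitary m Z \<and> \<pi> permutes {..<m} \<and> (\<forall>i<m. 0 < d i) \<and>
     Delta_t eps m t \<in> carrier_mat m m \<and>
     (let Y = Z * perm_mat m \<pi> * mat_diag m (\<lambda>i. complex_of_real (d i)) in B = Y * Delta_t eps m t * star_mat Transpose Y)"
  proof (cases "eps = 1")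
    case True
    have "star_mat Transpose B = - B" using B(2) True by (simp add: uminus_smult one_smult_mat)
    from youla_decomposition[OF B(1) this] obtain Z s and \<sigma> :: "nat \<Rightarrow> real" where
      Z: "unitary m Z" and s: "2 * s \<le> m" and \<sigma>: "\<And>i. \<sigma> i > 0" and B_eq: "B = Z * youla_form m s \<sigma> * star_mat Transpose Z" by blast
    \<comment> \<open>The pairs \<open>(2 i, 2 i + 1)\<close> of the Youla form correspond to the pairs \<open>(i, i + s)\<close> of \<open>\<Delta>\<close>.\<close>
    define \<pi> where "\<pi> i = (if i < s then 2 * i else if i < 2 * s then Suc (2 * (i - s)) else i)" for i
    define \<psi> where "\<psi> i = (if i < 2 * s then (if even i then i div 2 else s + i div 2) else i)" for i
    have \<psi>\<pi>: "\<psi> (\<pi> i) = i" for i by (auto simp: \<pi>_def \<psi>_def)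
    have \<pi>\<psi>: "\<pi> (\<psi> i) = i" for i by (auto simp: \<pi>_def \<psi>_def elim!: oddE)
    have "\<pi> i < m" "\<psi> i < m" if "i < m" for i using that s by (auto simp: \<pi>_def \<psi>_def elim!: oddE)
    then have "bij_betw \<pi> {..<m} {..<m}"
      using \<psi>\<pi> \<pi>\<psi> by (intro bij_betw_byWitness[of _ \<psi>]) auto
    then have \<pi>: "\<pi> permutes {..<m}" by (rule bij_imp_permutes) (use s in \<open>auto simp: \<pi>_def\<close>)
    define d where "d i = (if i < s then sqrt (\<sigma> i) else if i < 2 * s then sqrt (\<sigma> (i - s)) else 1)" for i
    have d: "\<forall>i<m. 0 < d i" using \<sigma> by (auto simp: d_def)
    have sq: "complex_of_real (sqrt (\<sigma> i)) * complex_of_real (sqrt (\<sigma> i)) = of_real (\<sigma> i)" for i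
      using \<sigma>[of i] by (simp flip: of_real_mult)
    have D: "Delta_t eps m (2 * s) \<in> carrier_mat m m" unfolding True Delta_t_plus_eq[OF s] by simp
    have "B = (Z * perm_mat m \<pi> * mat_diag m (\<lambda>i. complex_of_real (d i))) * Delta_t eps m (2 * s) *
      star_mat Transpose (Z * perm_mat m \<pi> * mat_diag m (\<lambda>i. complex_of_real (d i)))"
    proof (rule sorted_scaled_factorization[OF Z \<pi> B_eq _ D _ refl])
      fix i j assume ij: "i < m" "j < m"
      have pi: "\<pi> i < m" "\<pi> j < m" using permutes_in_image[OF \<pi>] ij by auto
      have e1: "\<pi> i < 2 * s \<and> even (\<pi> i) \<and> \<pi> j = Suc (\<pi> i) \<longleftrightarrow> i < s \<and> j = i + s" for i j
        by (auto simp: \<pi>_def; presburger)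
      have "youla_form m s \<sigma> $$ (\<pi> i, \<pi> j) = (if i < s \<and> j = i + s then of_real (\<sigma> i)
         else if j < s \<and> i = j + s then - of_real (\<sigma> j) else 0)"
        unfolding youla_form_def using pi e1[of i j] e1[of j i] by (auto simp: \<pi>_def)
      also have "\<dots> = complex_of_real (d i) * Delta_t eps m (2 * s) $$ (i, j) * complex_of_real (d j)"
        unfolding True Delta_t_plus_eq[OF s] using ij sq s by (auto simp: d_def)
      finally show "youla_form m s \<sigma> $$ (\<pi> i, \<pi> j) = complex_of_real (d i) * Delta_t eps m (2 * s) $$ (i, j) * complex_of_real (d j)" .
    qed (auto simp: youla_form_def)
    then show ?thesis using s Z \<pi> d D by (intro exI[of _ "2 * s"] exI[of _ Z] exI[of _ \<pi>] exI[of _ d]) (simp add: Let_def)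
  next
    case False
    then have eps: "eps = -1" using eps by simp
    have "star_mat Transpose B = B" using B(2) eps by (simp add: one_smult_mat)
    from unitary_diagonalization[OF B(1) this] obtain Z and \<sigma> :: "nat \<Rightarrow> real" where
      Z: "unitary m Z" and \<sigma>: "\<And>i. i < m \<Longrightarrow> \<sigma> i \<ge> 0" and B_eq: "B = Z * mat_diag m (\<lambda>i. of_real (\<sigma> i)) * star_mat Transpose Z" by blast
    define t where "t = card {i. i < m \<and> 0 < \<sigma> i}"
    obtain \<pi> where \<pi>: "\<pi> permutes {..<m}" and t0: "t + card {i. i < m \<and> False} \<le> m"
      and t1: "\<forall>i<m. if i < t then 0 < \<sigma> (\<pi> i) else if i < t + card {i. i < m \<and> False} then False
        else \<not> 0 < \<sigma> (\<pi> i) \<and> \<not> False"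
      by (rule sorting_permutation[of "\<lambda>i. 0 < \<sigma> i" "\<lambda>_. False" m, folded t_def]) auto
    have t: "t \<le> m" using t0 by simp
    have pos: "0 < \<sigma> (\<pi> i)" if "i < t" for i using t1 that t by auto
    have npos: "\<not> 0 < \<sigma> (\<pi> i)" if "t \<le> i" "i < m" for i using t1 that by auto
    have pi: "\<pi> i < m" if "i < m" for i using permutes_in_image[OF \<pi>] that by auto
    have zero: "\<sigma> (\<pi> i) = 0" if "t \<le> i" "i < m" for i using npos[OF that] \<sigma>[OF pi[OF that(2)]] by simp
    define d where "d i = (if i < t then sqrt (\<sigma> (\<pi> i)) else 1)" for i
    have d: "\<forall>i<m. 0 < d i" using pos by (auto simp: d_def)
    have sq: "complex_of_real (sqrt (\<sigma> (\<pi> i))) * complex_of_real (sqrt (\<sigma> (\<pi> i))) = of_real (\<sigma> (\<pi> i))" if "i < t" for i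
      using pos[OF that] by (simp flip: of_real_mult)
    have D: "Delta_t eps m t \<in> carrier_mat m m" unfolding Delta_t_minus_eq[OF t False] by simp
    have "B = (Z * perm_mat m \<pi> * mat_diag m (\<lambda>i. complex_of_real (d i))) * Delta_t eps m t *
      star_mat Transpose (Z * perm_mat m \<pi> * mat_diag m (\<lambda>i. complex_of_real (d i)))"
    proof (rule sorted_scaled_factorization[OF Z \<pi> B_eq _ D _ refl])
      fix i j assume ij: "i < m" "j < m"
      have "\<pi> i = \<pi> j \<longleftrightarrow> i = j" using permutes_inj[OF \<pi>] by (auto dest: injD)
      then show "mat_diag m (\<lambda>i. complex_of_real (\<sigma> i)) $$ (\<pi> i, \<pi> j) = complex_of_real (d i) * Delta_t eps m t $$ (i, j) * complex_of_real (d j)"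
        unfolding Delta_t_minus_eq[OF t False] using ij pi sq zero t by (auto simp: d_def mat_diag_def)
    qed auto
    then show ?thesis using t Z \<pi> d D False by (intro exI[of _ t] exI[of _ Z] exI[of _ \<pi>] exI[of _ d]) (simp add: Let_def)
  qed
  then obtain t Z \<pi> and d :: "nat \<Rightarrow> real" where t: "t \<le> m" "eps = 1 \<longrightarrow> even t" and Z: "unitary m Z" and \<pi>: "\<pi> permutes {..<m}"
    and d: "\<forall>i<m. 0 < d i" and D: "Delta_t eps m t \<in> carrier_mat m m"
    and B_eq: "B = (Z * perm_mat m \<pi> * mat_diag m (\<lambda>i. complex_of_real (d i))) * Delta_t eps m t *
      star_mat Transpose (Z * perm_mat m \<pi> * mat_diag m (\<lambda>i. complex_of_real (d i)))" by (auto simp: Let_def)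
  define Y where "Y = Z * perm_mat m \<pi> * mat_diag m (\<lambda>i. complex_of_real (d i))"
  have Y: "Y \<in> carrier_mat m m" "invertible_mat Y"
    unfolding Y_def by (rule scaled_unitary_invertible[OF Z \<pi> d])+
  have \<Delta>: "Delta_t eps m t = four_block_mat (Delta_t eps t t) (0\<^sub>m t (m - t)) (0\<^sub>m (m - t) t) (0\<^sub>m (m - t) (m - t))"
  proof (cases "eps = 1")
    case True
    then obtain s where s: "t = 2 * s" using t(2) by (auto elim: evenE)
    show ?thesis unfolding True s using t s
      by (subst (1 2) Delta_t_plus_eq) (auto intro!: eq_matI)
  next
    case False
    show ?thesis using t False
      by (subst (1 2) Delta_t_minus_eq) (auto simp: mat_diag_def intro!: eq_matI)
  qed
  have rank: "vec_space.rank m B = t"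
    by (rule rank_congruence[OF Y _ _ t(1), of "Delta_t eps t t" _ Transpose])
      (use Delta_t_full[OF eps, of t] t(2) B_eq in \<open>auto simp: \<Delta> Y_def simp del: star_mat.simps\<close>)
  then show "Delta_factor eps Transpose m B \<in> carrier_mat m m" using D by simp
  show "eps = 1 \<Longrightarrow> even (vec_space.rank m B)" using rank t(2) by simp
  have "is_Y_factor eps Transpose m B Y"
    by (rule is_Y_factorI[OF Z \<pi> d Y_def]) (unfold Delta_factor.simps rank Y_def, rule B_eq)
  then show "\<exists>Y. is_Y_factor eps Transpose m B Y" ..
qed

theorem star_factorization:
  assumes "eps \<in> {1, -1}" "B \<in> carrier_mat m m" "star_mat st B = (- eps) \<cdot>\<^sub>m B"
  shows "Delta_factor eps st m B \<in> carrier_mat m m" "\<exists>Y. is_Y_factor eps st m B Y"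
  using star_factorization_conj(2,3)[of eps B m] star_factorization_transpose(2,3)[of eps B m] assms
  by (cases st; simp)+

section \<open>Isotropic subspaces and inertia\<close>

text \<open>
  Padding the system with zero equations makes its matrix square and singular.
\<close>
lemma underdetermined_system:
  fixes A :: "nat \<Rightarrow> nat \<Rightarrow> complex"
  assumes "a < n"
  obtains v where "v \<in> carrier_mat n 1" "v \<noteq> 0\<^sub>m n 1" "\<And>r. r < a \<Longrightarrow> (\<Sum>i<n. A r i * v $$ (i, 0)) = 0"
proof -
  define M where "M = mat n n (\<lambda>(r, i). if r < a then A r i else 0)"
  have M: "M \<in> carrier_mat n n" by (simp add: M_def)
  have "\<not> invertible_mat M"
  proof
    assume "invertible_mat M"
    then obtain B where B: "B \<in> carrier_mat n n" "M * B = 1\<^sub>m n" using invertible_mat_iff[OF M] by auto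
    have "(M * B) $$ (a, a) = 0"
      using assms M B(1) by (simp add: scalar_prod_def M_def)
    then show False using assms B(2) by simp
  qed
  then have "det M = 0" using invertible_mat_iff_det[OF M] by simp
  then obtain v where v: "v \<in> carrier_vec n" "v \<noteq> 0\<^sub>v n" "M *\<^sub>v v = 0\<^sub>v n"
    using det_0_iff_vec_prod_zero_field[OF M] by blast
  define z where "z = mat n 1 (\<lambda>(i, j). v $ i)"
  show thesis
  proof
    show "z \<in> carrier_mat n 1" by (simp add: z_def)
    show "z \<noteq> 0\<^sub>m n 1"
    proof
      assume "z = 0\<^sub>m n 1"
      then have "z $$ (i, 0) = 0" if "i < n" for i using that by simp
      then have "v = 0\<^sub>v n" using v(1) by (intro eq_vecI) (auto simp: z_def)
      then show False using v by simp
    qed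
    fix r assume r: "r < a"
    have "(M *\<^sub>v v) $ r = 0" unfolding v using r assms by simp
    then have "(\<Sum>i = 0..<n. (if r < a then A r i else 0) * v $ i) = 0"
      using r assms v(1) by (simp add: M_def scalar_prod_def)
    then show "(\<Sum>i<n. A r i * z $$ (i, 0)) = 0"
      using r by (simp add: z_def lessThan_atLeast0)
  qed
qed

text \<open>
  Suppose that there are fewer than \<open>n\<close> positive weights. Then some \<open>v \<noteq> 0\<close> makes all the components of
  \<open>y = W\<^sup>* v\<close> with positive weight vanish. The isotropy gives \<open>\<Sum>\<^sub>j s\<^sub>j |y\<^sub>j|\<^sup>2 = 0\<close>, a sum of nonpositive
  terms, so the other components vanish as well. But \<open>y = 0\<close> implies \<open>v = 0\<close>, as \<open>W\<close> has a right inverse.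
\<close>
lemma isotropic_pos_count:
  fixes s :: "nat \<Rightarrow> real" and W :: "complex mat"
  assumes W: "W \<in> carrier_mat n N" and R: "R \<in> carrier_mat N n" "W * R = 1\<^sub>m n"
    and iso: "W * mat_diag N (\<lambda>i. of_real (s i)) * mat_adjoint W = 0\<^sub>m n n"
    and nz: "\<And>i. i < N \<Longrightarrow> s i \<noteq> 0"
  shows "n \<le> card {i. i < N \<and> 0 < s i}"
proof (rule ccontr)
  define P where "P = {i. i < N \<and> 0 < s i}"
  assume "\<not> n \<le> card {i. i < N \<and> 0 < s i}"
  then have less: "card P < n" by (simp add: P_def)
  have fin: "finite P" by (simp add: P_def)
  obtain h where h: "bij_betw h {0..<card P} P" using ex_bij_betw_nat_finite[OF fin] by blast
  note [simp] = carrier_matD[OF W] carrier_matD[OF R(1)]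
  obtain v where v: "v \<in> carrier_mat n 1" "v \<noteq> 0\<^sub>m n 1"
    and v0: "\<And>r. r < card P \<Longrightarrow> (\<Sum>i<n. mat_adjoint W $$ (h r, i) * v $$ (i, 0)) = 0"
    by (rule underdetermined_system[OF less, of "\<lambda>r i. mat_adjoint W $$ (h r, i)"]) blast
  note [simp] = carrier_matD[OF v(1)]
  define y where "y = mat_adjoint W * v"
  have [simp]: "dim_row y = N" "dim_col y = 1" by (auto simp: y_def)
  have y_index: "y $$ (j, 0) = (\<Sum>i<n. mat_adjoint W $$ (j, i) * v $$ (i, 0))" if "j < N" for j
    using that by (simp add: y_def scalar_prod_def lessThan_atLeast0)
  have yP: "y $$ (j, 0) = 0" if "j \<in> P" for j
  proof -
    have "j \<in> h ` {0..<card P}" using bij_betw_imp_surj_on[OF h] that by simp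
    then obtain r where "r < card P" "h r = j" by auto
    then show ?thesis using v0[of r] y_index[of j] that by (simp add: P_def)
  qed
  have "mat_adjoint v * (W * mat_diag N (\<lambda>i. of_real (s i)) * mat_adjoint W) * v = 0\<^sub>m 1 1"
    unfolding iso by (simp add: matalg)
  then have "mat_adjoint y * (mat_diag N (\<lambda>i. of_real (s i)) * y) = 0\<^sub>m 1 1"
    by (simp add: y_def adjoint_simps matalg)
  then have "(mat_adjoint y * (mat_diag N (\<lambda>i. of_real (s i)) * y)) $$ (0, 0) = 0" by simp
  moreover have "(mat_adjoint y * (mat_diag N (\<lambda>i. of_real (s i)) * y)) $$ (0, 0)
      = (\<Sum>j<N. cnj (y $$ (j, 0)) * (of_real (s j) * y $$ (j, 0)))"
  proof -
    have yc: "y \<in> carrier_mat N 1" by (intro carrier_matI) auto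
    show ?thesis unfolding mat_diag_mult_left[OF yc] by (simp add: scalar_prod_def lessThan_atLeast0)
  qed
  moreover have "\<dots> = of_real (\<Sum>j<N. s j * (cmod (y $$ (j, 0)))\<^sup>2)"
    by (simp add: complex_norm_square mult.commute mult.left_commute del: of_real_power)
  ultimately have "(\<Sum>j<N. s j * (cmod (y $$ (j, 0)))\<^sup>2) = 0" by (metis of_real_eq_0_iff)
  then have "(\<Sum>j<N. - (s j * (cmod (y $$ (j, 0)))\<^sup>2)) = 0" by (simp add: sum_negf)
  moreover have "- (s j * (cmod (y $$ (j, 0)))\<^sup>2) \<ge> 0" if "j < N" for j
  proof (cases "j \<in> P")
    case False
    then have "s j \<le> 0" using that by (auto simp: P_def)
    then show ?thesis by (simp add: mult_nonpos_nonneg)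
  qed (simp add: yP)
  ultimately have zero: "s j * (cmod (y $$ (j, 0)))\<^sup>2 = 0" if "j < N" for j
    using that by (subst (asm) sum_nonneg_eq_0_iff) auto
  have "y = 0\<^sub>m N 1"
    by (rule eq_matI) (use zero nz in auto)
  then have "mat_adjoint R * y = 0\<^sub>m n 1" by (simp add: matalg)
  moreover have "mat_adjoint R * y = mat_adjoint (W * R) * v" by (simp add: y_def adjoint_simps matalg)
  moreover have "\<dots> = v" unfolding R(2) by (simp add: adjoint_simps)
  ultimately show False using v(2) by simp
qed

text \<open>
  The rows of \<open>[X1 X2]\<close> span an \<open>n\<close>-dimensional isotropic subspace for the nondegenerate form
  \<open>diag (S1, S2)\<close>. By \<open>isotropic_pos_count\<close>, applied to the form and to its negative, the total positive and
  negative indices are at least \<open>n\<close>, and they add up to \<open>2 n\<close>.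
\<close>
lemma isotropic_inertia_complement:
  assumes eps: "eps \<in> {1, -1}"
    and S1: "S1 \<in> carrier_mat k k" "star_mat ConjTranspose S1 = (- eps) \<cdot>\<^sub>m S1" "invertible_mat S1"
    and S2: "S2 \<in> carrier_mat m m" "star_mat ConjTranspose S2 = (- eps) \<cdot>\<^sub>m S2" "invertible_mat S2"
    and X1: "X1 \<in> carrier_mat n k" and X2: "X2 \<in> carrier_mat n m" and km: "k + m = 2 * n"
    and R: "R \<in> carrier_mat (k + m) n" "append_cols X1 X2 * R = 1\<^sub>m n"
    and iso: "X1 * S1 * star_mat ConjTranspose X1 + X2 * S2 * star_mat ConjTranspose X2 = 0\<^sub>m n n"
  shows "pos_inertia (csqrt (- eps) \<cdot>\<^sub>m S1) + pos_inertia (csqrt (- eps) \<cdot>\<^sub>m S2) = n"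
    "neg_inertia (csqrt (- eps) \<cdot>\<^sub>m S1) + neg_inertia (csqrt (- eps) \<cdot>\<^sub>m S2) = n"
proof -
  define c where "c = csqrt (- eps)"
  obtain Z1 and d1 :: "nat \<Rightarrow> real" where Z1: "unitary k Z1"
    and H1: "c \<cdot>\<^sub>m S1 = Z1 * mat_diag k (\<lambda>i. of_real (d1 i)) * mat_adjoint Z1"
    and i1: "pos_inertia (c \<cdot>\<^sub>m S1) = card {i. i < k \<and> 0 < d1 i}" "neg_inertia (c \<cdot>\<^sub>m S1) = card {i. i < k \<and> d1 i < 0}"
    unfolding c_def by (rule hermitian_multiple[OF eps S1(1,2)])
  obtain Z2 and d2 :: "nat \<Rightarrow> real" where Z2: "unitary m Z2"
    and H2: "c \<cdot>\<^sub>m S2 = Z2 * mat_diag m (\<lambda>i. of_real (d2 i)) * mat_adjoint Z2"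
    and i2: "pos_inertia (c \<cdot>\<^sub>m S2) = card {i. i < m \<and> 0 < d2 i}" "neg_inertia (c \<cdot>\<^sub>m S2) = card {i. i < m \<and> d2 i < 0}"
    unfolding c_def by (rule hermitian_multiple[OF eps S2(1,2)])
  have nonzero: "\<forall>i<l. d i \<noteq> 0" if "card {i. i < l \<and> 0 < d i} + card {i. i < l \<and> d i < 0} = l" for l and d :: "nat \<Rightarrow> real"
  proof -
    have "card ({i. i < l \<and> 0 < d i} \<union> {i. i < l \<and> d i < 0}) = card {..<l}"
      using that by (subst card_Un_disjoint) auto
    then have "{i. i < l \<and> 0 < d i} \<union> {i. i < l \<and> d i < 0} = {..<l}"
      by (intro card_subset_eq) auto
    then have "i \<in> {i. i < l \<and> 0 < d i} \<union> {i. i < l \<and> d i < 0}" if "i < l" for i using that by simp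
    then show ?thesis by fastforce
  qed
  have sum1: "pos_inertia (c \<cdot>\<^sub>m S1) + neg_inertia (c \<cdot>\<^sub>m S1) = k"
    and sum2: "pos_inertia (c \<cdot>\<^sub>m S2) + neg_inertia (c \<cdot>\<^sub>m S2) = m"
    unfolding c_def by (rule star_factorization_conj(4)[OF eps S1], rule star_factorization_conj(4)[OF eps S2])
  have nz1: "\<forall>i<k. d1 i \<noteq> 0" by (rule nonzero[OF sum1[unfolded i1]])
  have nz2: "\<forall>i<m. d2 i \<noteq> 0" by (rule nonzero[OF sum2[unfolded i2]])
  note [simp] = carrier_matD[OF unitaryD(1)[OF Z1]] carrier_matD[OF unitaryD(1)[OF Z2]] carrier_matD[OF X1] carrier_matD[OF X2]
    carrier_matD[OF S1(1)] carrier_matD[OF S2(1)] carrier_matD[OF R(1)]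
  define W where "W = append_cols (X1 * Z1) (X2 * Z2)"
  have Wc: "W \<in> carrier_mat n (k + m)" by (auto simp: W_def intro!: carrier_matI)
  define s where "s i = (if i < k then d1 i else d2 (i - k))" for i
  have D: "mat_diag (k + m) (\<lambda>i. complex_of_real (s i)) = four_block_mat (mat_diag k (\<lambda>i. of_real (d1 i))) (0\<^sub>m k m) (0\<^sub>m m k) (mat_diag m (\<lambda>i. of_real (d2 i)))"
    unfolding mat_diag_block by (rule eq_matI) (auto simp: mat_diag_def s_def)
  define D1 D2 where "D1 = mat_diag k (\<lambda>i. complex_of_real (d1 i))" and "D2 = mat_diag m (\<lambda>i. complex_of_real (d2 i))"
  have [simp]: "dim_row D1 = k" "dim_col D1 = k" "dim_row D2 = m" "dim_col D2 = m" by (auto simp: D1_def D2_def)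
  have iso': "W * mat_diag (k + m) (\<lambda>i. complex_of_real (s i)) * mat_adjoint W = 0\<^sub>m n n"
  proof -
    have "W * mat_diag (k + m) (\<lambda>i. complex_of_real (s i)) * mat_adjoint W = X1 * (Z1 * D1 * mat_adjoint Z1) * mat_adjoint X1 + X2 * (Z2 * D2 * mat_adjoint Z2) * mat_adjoint X2"
      unfolding D D1_def[symmetric] D2_def[symmetric] unfolding W_def
      by (simp add: append_cols_mult_four_block adjoint_append_cols append_cols_mult_append_rows adjoint_simps matalg)
    also have "\<dots> = X1 * (c \<cdot>\<^sub>m S1) * mat_adjoint X1 + X2 * (c \<cdot>\<^sub>m S2) * mat_adjoint X2"
      unfolding H1 H2 D1_def D2_def by (rule refl)
    also have "\<dots> = c \<cdot>\<^sub>m (X1 * S1 * mat_adjoint X1 + X2 * S2 * mat_adjoint X2)" by (simp add: matalg)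
    also have "\<dots> = 0\<^sub>m n n" using iso by (simp add: smult_zero_mat)
    finally show ?thesis .
  qed
  define Rw where "Rw = four_block_mat (mat_adjoint Z1) (0\<^sub>m k m) (0\<^sub>m m k) (mat_adjoint Z2) * R"
  have Rw: "Rw \<in> carrier_mat (k + m) n" by (auto simp: Rw_def intro!: carrier_matI)
  have "W * Rw = W * four_block_mat (mat_adjoint Z1) (0\<^sub>m k m) (0\<^sub>m m k) (mat_adjoint Z2) * R"
    unfolding Rw_def using Wc by (simp add: mult_assoc_dim)
  also have "W * four_block_mat (mat_adjoint Z1) (0\<^sub>m k m) (0\<^sub>m m k) (mat_adjoint Z2) = append_cols X1 X2"
    unfolding W_def by (simp add: append_cols_mult_four_block matalg unitaryD(3)[OF Z1] unitaryD(3)[OF Z2])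
  finally have WR: "W * Rw = 1\<^sub>m n" unfolding R(2) .
  have nz: "s i \<noteq> 0" if "i < k + m" for i using that nz1 nz2 by (auto simp: s_def)
  have count: "card {i. i < k + m \<and> Q (s i)} = card {i. i < k \<and> Q (d1 i)} + card {i. i < m \<and> Q (d2 i)}" for Q
  proof -
    have "{i. i < k + m \<and> Q (s i)} = {i. i < k \<and> Q (d1 i)} \<union> (\<lambda>i. i + k) ` {i. i < m \<and> Q (d2 i)}"
    proof (intro equalityI subsetI)
      fix i assume i: "i \<in> {i. i < k + m \<and> Q (s i)}"
      show "i \<in> {i. i < k \<and> Q (d1 i)} \<union> (\<lambda>i. i + k) ` {i. i < m \<and> Q (d2 i)}"
      proof (cases "i < k")
        case False
        then have "i = (i - k) + k" "i - k < m" "Q (d2 (i - k))" using i by (auto simp: s_def)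
        then show ?thesis by blast
      qed (use i in \<open>auto simp: s_def\<close>)
    qed (auto simp: s_def)
    moreover have "card ({i. i < k \<and> Q (d1 i)} \<union> (\<lambda>i. i + k) ` {i. i < m \<and> Q (d2 i)})
        = card {i. i < k \<and> Q (d1 i)} + card ((\<lambda>i. i + k) ` {i. i < m \<and> Q (d2 i)})"
      by (rule card_Un_disjoint) auto
    moreover have "card ((\<lambda>i. i + k) ` {i. i < m \<and> Q (d2 i)}) = card {i. i < m \<and> Q (d2 i)}"
      by (rule card_image) (simp add: inj_on_def)
    ultimately show ?thesis by simp
  qed
  have "n \<le> card {i. i < k + m \<and> 0 < s i}"
    by (rule isotropic_pos_count[OF Wc Rw WR iso' nz])
  then have p: "n \<le> pos_inertia (c \<cdot>\<^sub>m S1) + pos_inertia (c \<cdot>\<^sub>m S2)" unfolding count i1 i2 .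
  have "mat_diag (k + m) (\<lambda>i. complex_of_real (- s i)) = - mat_diag (k + m) (\<lambda>i. complex_of_real (s i))"
    by (rule eq_matI) (auto simp: mat_diag_def)
  then have "W * mat_diag (k + m) (\<lambda>i. complex_of_real (- s i)) * mat_adjoint W = - (W * mat_diag (k + m) (\<lambda>i. complex_of_real (s i)) * mat_adjoint W)"
    using Wc by (simp add: uminus_mult_dim mult_uminus_dim)
  also have "\<dots> = 0\<^sub>m n n" unfolding iso' by (rule uminus_zero_mat)
  finally have "n \<le> card {i. i < k + m \<and> 0 < - s i}"
    by (rule isotropic_pos_count[OF Wc Rw WR]) (use nz in auto)
  then have q: "n \<le> neg_inertia (c \<cdot>\<^sub>m S1) + neg_inertia (c \<cdot>\<^sub>m S2)" using count[of "\<lambda>x. x < 0"] unfolding i1 i2 by simp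
  show "pos_inertia (csqrt (- eps) \<cdot>\<^sub>m S1) + pos_inertia (csqrt (- eps) \<cdot>\<^sub>m S2) = n"
    "neg_inertia (csqrt (- eps) \<cdot>\<^sub>m S1) + neg_inertia (csqrt (- eps) \<cdot>\<^sub>m S2) = n"
    using p q sum1 sum2 km unfolding c_def by linarith+
qed

section \<open>The matrix Omega\<close>

text \<open>
  The order of \<open>\<Omega>\<close> is right because \<open>S1\<close> is nonsingular: the inertia indices add up to \<open>k\<close> for the conjugate
  transpose, and \<open>k\<close> is even in the skew-symmetric case.
\<close>
lemma Omega_properties:
  assumes eps: "eps \<in> {1, -1}" and k: "k \<le> 2 * n"
    and S1: "S1 \<in> carrier_mat k k" "star_mat st S1 = (- eps) \<cdot>\<^sub>m S1" "invertible_mat S1"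
    and dims: "Omega_dims eps st n S1"
  shows "Omega eps st n k S1 \<in> carrier_mat (2 * n - k) (2 * n - k)" "invertible_mat (Omega eps st n k S1)"
    "star_mat st (Omega eps st n k S1) = (- eps) \<cdot>\<^sub>m Omega eps st n k S1"
proof -
  have "Omega eps st n k S1 \<in> carrier_mat (2 * n - k) (2 * n - k) \<and> invertible_mat (Omega eps st n k S1) \<and>
    star_mat st (Omega eps st n k S1) = (- eps) \<cdot>\<^sub>m Omega eps st n k S1"
  proof (cases st)
    case Transpose
    interpret vec_space "TYPE(complex)" k .
    have "rank S1 = k" using det_rank_iff[OF S1(1)] S1(3) invertible_mat_iff_det[OF S1(1)] by simp
    moreover have "even (rank S1)" if "eps = 1"
      by (rule star_factorization_transpose(1)[OF eps S1(1) _ that]) (use S1(2) Transpose in simp)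
    ultimately have "even (2 * n - k)" if "eps = 1" using that k by simp
    from Delta_t_full[OF eps this] show ?thesis unfolding Transpose by (simp del: star_mat.simps)
  next
    case ConjTranspose
    define p q where "p = pos_inertia (csqrt (- eps) \<cdot>\<^sub>m S1)" and "q = neg_inertia (csqrt (- eps) \<cdot>\<^sub>m S1)"
    have "p + q = k" unfolding p_def q_def
      by (rule star_factorization_conj(4)[OF eps S1(1)]) (use S1 ConjTranspose in simp_all)
    moreover have "p \<le> n" "q \<le> n" using dims ConjTranspose by (auto simp: p_def q_def)
    ultimately have m: "2 * n - k = (n - p) + (n - q)" by linarith
    from Delta_pq_full[OF eps, of "n - p" "n - q"] show ?thesis
      unfolding ConjTranspose Omega.simps p_def[symmetric] q_def[symmetric] m by blast
  qed
  then show "Omega eps st n k S1 \<in> carrier_mat (2 * n - k) (2 * n - k)" "invertible_mat (Omega eps st n k S1)"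
    "star_mat st (Omega eps st n k S1) = (- eps) \<cdot>\<^sub>m Omega eps st n k S1" by blast+
qed

section \<open>Parameters yield a solution\<close>

text \<open>
  The conditions on the parameters say that \<open>(X, T, S)\<close> is a \<open>palindromic_triple\<close>; in particular
  \<open>X S X\<^sup>\<star> = Y \<Delta> Y\<^sup>\<star> + Y \<Psi> \<Omega> \<Psi>\<^sup>\<star> Y\<^sup>\<star> = 0\<close>. As \<open>T\<close> is block diagonal, its first block satisfies the residual
  equation, and the eigenvalues left after removing those of \<open>T1\<close> are those of \<open>T2\<close>.
\<close>
lemma solution_of_parameters:
  assumes eps: "eps \<in> {1, -1}" and k: "k \<le> 2 * n"
    and X1: "X1 \<in> carrier_mat n k" and T1: "T1 \<in> carrier_mat k k" "invertible_mat T1"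
    and par: "iep_parameters eps st n k X1 T1 S1 Y Psi T2"
  defines "X \<equiv> append_cols X1 (Y * Psi)" and "T \<equiv> diag_block_mat [T1, T2]"
    and "S \<equiv> diag_block_mat [S1, Omega eps st n k S1]"
  shows "regular_iep_solution eps st n X1 T1 (coeff_A1 eps st X T S) (coeff_A0 eps st X T S)"
proof -
  define m where "m = 2 * n - k"
  have km: "k + m = 2 * n" using k by (simp add: m_def)
  define \<Omega> where "\<Omega> = Omega eps st n k S1"
  define B where "B = X1 * S1 * star_mat st X1"
  define \<Delta> where "\<Delta> = Delta_factor eps st n B"
  from par have S1: "S1 \<in> carrier_mat k k" "star_mat st S1 = (- eps) \<cdot>\<^sub>m S1" "S1 = T1 * S1 * star_mat st T1" "invertible_mat S1"
    and Y: "is_Y_factor eps st n B Y" and Psi: "Psi \<in> carrier_mat n m" and T2: "T2 \<in> carrier_mat m m"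
    and dims: "Omega_dims eps st n S1" and T2\<Omega>: "T2 * \<Omega> * star_mat st T2 = \<Omega>"
    and disj: "spectrum T1 \<inter> spectrum T2 = {}" and Psi\<Omega>: "Psi * \<Omega> * star_mat st Psi = - \<Delta>"
    and M: "invertible_mat (X1 * mat_inv T1 * S1 * star_mat st X1
        + Y * Psi * mat_inv T2 * \<Omega> * star_mat st Psi * star_mat st Y)"
    unfolding iep_parameters_def Let_def S_set_def m_def \<Omega>_def B_def \<Delta>_def by auto
  note \<Omega> = Omega_properties[OF eps k S1(1,2,4) dims, folded \<Omega>_def m_def]
  note Yf = is_Y_factorD[OF Y, folded \<Delta>_def]
  note T1i = mat_inv[OF T1]
  note [simp] = carrier_matD[OF X1] carrier_matD[OF T1(1)] carrier_matD[OF S1(1)] carrier_matD[OF Psi] carrier_matD[OF T2]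
    carrier_matD[OF \<Omega>(1)] carrier_matD[OF Yf(1)] carrier_matD[OF T1i(1)]
  have \<Delta>c: "\<Delta> \<in> carrier_mat n n"
  proof -
    have "dim_row (Psi * \<Omega> * star_mat st Psi) = n" "dim_col (Psi * \<Omega> * star_mat st Psi) = n" by simp_all
    then show ?thesis unfolding Psi\<Omega> by auto
  qed
  note [simp] = carrier_matD[OF \<Delta>c]
  have "invertible_mat (T2 * (\<Omega> * star_mat st T2))" using \<Omega>(2) T2\<Omega> by (simp add: matalg)
  then have T2_inv: "invertible_mat T2"
    by (rule invertible_mat_factors(1)[OF T2, rotated]) (auto intro!: carrier_matI)
  note T2i = mat_inv[OF T2 T2_inv]
  note [simp] = carrier_matD[OF T2i(1)]
  have T_eq: "T = four_block_mat T1 (0\<^sub>m k m) (0\<^sub>m m k) T2" unfolding T_def diag_block_mat_two by simp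
  have S_eq: "S = four_block_mat S1 (0\<^sub>m k m) (0\<^sub>m m k) \<Omega>" unfolding S_def \<Omega>_def[symmetric] diag_block_mat_two by simp
  note Ti = block_diag_inverse[OF T1(1) T2 T1(2) T2_inv, folded T_eq]
  have Xs: "star_mat st X = star_mat st X1 @\<^sub>r (star_mat st Psi * star_mat st Y)"
    unfolding X_def by (simp add: star_append_cols starmat)
  interpret palindromic_triple eps st n X T S
  proof
    show "eps \<in> {1, -1}" by (rule eps)
    show "X \<in> carrier_mat n (2 * n)" "T \<in> carrier_mat (2 * n) (2 * n)" "S \<in> carrier_mat (2 * n) (2 * n)"
      using km by (auto simp: X_def T_eq S_eq intro!: carrier_matI)
    show "invertible_mat T" by (rule Ti(1))
    show "star_mat st S = (- eps) \<cdot>\<^sub>m S" unfolding S_eq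
      by (subst star_mat_four_block) (auto simp: S1(2) \<Omega>(3) intro!: eq_matI)
    have Ts: "star_mat st T = four_block_mat (star_mat st T1) (0\<^sub>m k m) (0\<^sub>m m k) (star_mat st T2)"
      unfolding T_eq by (subst star_mat_four_block) auto
    have "T * S * star_mat st T = four_block_mat (T1 * S1 * star_mat st T1) (0\<^sub>m k m) (0\<^sub>m m k) (T2 * \<Omega> * star_mat st T2)"
      unfolding Ts unfolding T_eq S_eq by (simp add: four_block_mult_dim matalg)
    then show "T * S * star_mat st T = S" unfolding T2\<Omega> S1(3)[symmetric] S_eq .
    have "X * S * star_mat st X = B + Y * (Psi * \<Omega> * star_mat st Psi) * star_mat st Y"
      unfolding Xs unfolding X_def S_eq B_def
      by (simp add: append_cols_mult_four_block append_cols_mult_append_rows matalg)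
    also have "\<dots> = B + (- (Y * \<Delta> * star_mat st Y))" unfolding Psi\<Omega> by (simp add: matalg)
    also have "\<dots> = 0\<^sub>m n n" unfolding Yf(3)[symmetric] by (rule add_uminus_dim) (auto simp: B_def)
    finally show "X * S * star_mat st X = 0\<^sub>m n n" .
    have "X * mat_inv T * S * star_mat st X = X1 * mat_inv T1 * S1 * star_mat st X1
        + Y * Psi * mat_inv T2 * \<Omega> * star_mat st Psi * star_mat st Y"
      unfolding Xs Ti(2) unfolding X_def S_eq
      by (simp add: append_cols_mult_four_block append_cols_mult_append_rows matalg)
    then show "invertible_mat (X * mat_inv T * S * star_mat st X)" using M by simp
  qed
  interpret Q: regular_palindromic eps st n A1 A0 by (rule regular)
  have "append_cols (star_mat st A1 * X1 * T1 ^\<^sub>m 2 + A0 * X1 * T1 + eps \<cdot>\<^sub>m (A1 * X1))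
      (star_mat st A1 * (Y * Psi) * T2 ^\<^sub>m 2 + A0 * (Y * Psi) * T2 + eps \<cdot>\<^sub>m (A1 * (Y * Psi))) = R"
    unfolding R_def
    by (rule residual_append_cols[of "star_mat st A1" n A0 A1 X1 k "Y * Psi" m T1 T2 eps, folded X_def T_eq, symmetric])
      (auto intro!: carrier_matI)
  also have "\<dots> = append_cols (0\<^sub>m n k) (0\<^sub>m n m)"
    unfolding R_zero by (rule eq_matI) (use km in auto)
  finally have res: "star_mat st A1 * X1 * T1 ^\<^sub>m 2 + A0 * X1 * T1 + eps \<cdot>\<^sub>m (A1 * X1) = 0\<^sub>m n k"
    by (rule append_cols_inject(1)) auto
  have "quad_eigenvalues eps st n A1 A0 = mat_eigenvalues T"
    unfolding Q.quad_eigenvalues_eq by (simp add: mat_eigenvalues_def char_poly_companion)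
  also have "\<dots> = mat_eigenvalues T1 + mat_eigenvalues T2"
    unfolding T_eq by (rule mat_eigenvalues_block_triangular) (use T1 T2 in auto)
  finally have "set_mset (quad_eigenvalues eps st n A1 A0 - mat_eigenvalues T1) \<inter> spectrum T1 = {}"
    using set_mat_eigenvalues[OF T2] disj by auto
  then show ?thesis
    unfolding regular_iep_solution_def iep_solution_def palindromic_system_def
    using A1_invertible Q.A0 A0_star res by auto
qed

section \<open>A solution yields parameters\<close>

context regular_palindromic
begin

text \<open>
  The second block row of \<open>L\<close> is \<open>[- 1, 0]\<close>, so the lower half of an invariant basis is determined by the
  upper half; \<open>T\<close> is nonsingular since \<open>L\<close> preserves the nonsingular \<open>J\<close>.
\<close>
lemma invariant_basis_form:
  assumes X: "X \<in> carrier_mat n (2 * n)" and Z: "Z \<in> carrier_mat n (2 * n)" and T: "T \<in> carrier_mat (2 * n) (2 * n)"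
    and V: "invertible_mat (X @\<^sub>r Z)" and LV: "L * (X @\<^sub>r Z) = (X @\<^sub>r Z) * T"
  shows "invertible_mat T" "X @\<^sub>r Z = X @\<^sub>r (- (X * mat_inv T))"
proof -
  note [simp] = carrier_matD[OF X] carrier_matD[OF Z] carrier_matD[OF T] carrier_matD[OF L_carrier] carrier_matD[OF J_carrier]
  have Vc: "X @\<^sub>r Z \<in> carrier_mat (2 * n) (2 * n)" by (auto intro!: carrier_matI)
  have "invertible_mat (L * (J * star_mat st L))" using L_J_star_L J_invertible by (simp add: mult_assoc_dim)
  then have "invertible_mat L" by (rule invertible_mat_factors(1)[OF L_carrier, rotated]) (auto intro!: carrier_matI)
  from invertible_mat_mult[OF L_carrier Vc this V] show T_inv: "invertible_mat T"
    unfolding LV by (rule invertible_mat_factors(2)[OF Vc T])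
  note Ti = mat_inv[OF T T_inv]
  note [simp] = carrier_matD[OF Ti(1)]
  have "L * (X @\<^sub>r Z) = (append_cols (- (A1si * A0)) (eps \<cdot>\<^sub>m (A1si * A1)) * (X @\<^sub>r Z)) @\<^sub>r (append_cols (- 1\<^sub>m n) (0\<^sub>m n n) * (X @\<^sub>r Z))"
  proof -
    have "L = append_cols (- (A1si * A0)) (eps \<cdot>\<^sub>m (A1si * A1)) @\<^sub>r append_cols (- 1\<^sub>m n) (0\<^sub>m n n)"
      by (rule eq_matI) (auto simp: L_eq)
    then show ?thesis by (simp add: append_rows_mult)
  qed
  also have "append_cols (- 1\<^sub>m n) (0\<^sub>m n n) * (X @\<^sub>r Z) = - X"
    by (subst append_cols_mult_append_rows) (auto simp: matalg)
  finally have "(append_cols (- (A1si * A0)) (eps \<cdot>\<^sub>m (A1si * A1)) * (X @\<^sub>r Z)) @\<^sub>r (- X) = (X * T) @\<^sub>r (Z * T)"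
    unfolding LV by (simp add: append_rows_mult)
  then have "- X = Z * T" by (rule append_rows_inject(2)) auto
  then have "- X * mat_inv T = Z * T * mat_inv T" by simp
  then have "Z = - (X * mat_inv T)" by (simp add: matalg Ti)
  then show "X @\<^sub>r Z = X @\<^sub>r (- (X * mat_inv T))" by simp
qed

text \<open>
  The matrices \<open>S1\<close> and \<open>S2\<close> are found in a first basis \<open>V\<close> that decouples \<open>L\<close>. The factor \<open>W\<close> of \<open>S2\<close> then
  leads to the second basis \<open>V G\<close> with \<open>G = diag (1, W)\<close>, whose form is \<open>diag (S1, \<Omega>)\<close>. All conditions on the
  parameters and the formulas for the coefficients are read off from the second basis, where
  \<open>Y \<Psi> = X2 W\<close> for any choice of \<open>Y\<close>. In particular \<open>S1\<close> does not depend on \<open>Y\<close>.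
\<close>
lemma parameters_of_solution:
  assumes k: "k \<le> 2 * n" and X1: "X1 \<in> carrier_mat n k" and T1: "T1 \<in> carrier_mat k k" "invertible_mat T1"
    and rank: "vec_space.rank (2 * n) (X1 @\<^sub>r (- (X1 * mat_inv T1))) = k"
    and sim: "similar_mat T1 (star_mat st (mat_inv T1))"
    and sol: "iep_solution eps st n X1 T1 A1 A0"
  shows "\<exists>S1. (\<exists>Y. is_Y_factor eps st n (X1 * S1 * star_mat st X1) Y) \<and>
    (\<forall>Y. is_Y_factor eps st n (X1 * S1 * star_mat st X1) Y \<longrightarrow>
      (\<exists>Psi T2. iep_parameters eps st n k X1 T1 S1 Y Psi T2 \<and>
        (let X = append_cols X1 (Y * Psi); T = diag_block_mat [T1, T2];
             S = diag_block_mat [S1, Omega eps st n k S1]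
         in A1 = coeff_A1 eps st X T S \<and> A0 = coeff_A0 eps st X T S)))"
proof -
  define m where "m = 2 * n - k"
  have km: "k + m = 2 * n" using k by (simp add: m_def)
  note T1i = mat_inv[OF T1]
  define K where "K = X1 @\<^sub>r (- (X1 * mat_inv T1))"
  note [simp] = carrier_matD[OF X1] carrier_matD[OF T1(1)] carrier_matD[OF T1i(1)] carrier_matD[OF L_carrier] carrier_matD[OF J_carrier]
  have K: "K \<in> carrier_mat (2 * n) k" by (auto simp: K_def intro!: carrier_matI)
  have LK: "L * K = K * T1"
    unfolding K_def by (rule companion_mult[OF X1 T1(1) T1i(1,3)]) (use sol in \<open>simp add: iep_solution_def\<close>)
  have "set_mset (mat_eigenvalues L - mat_eigenvalues T1) \<inter> spectrum T1 = {}"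
    using sol by (simp add: iep_solution_def quad_eigenvalues_eq)
  from decouple[OF K T1(1) k rank[folded K_def] LK this, folded m_def] obtain K2 F where
    K2: "K2 \<in> carrier_mat (2 * n) m" and F: "F \<in> carrier_mat m m" and Vinv: "invertible_mat (append_cols K K2)"
    and LV: "L * append_cols K K2 = append_cols K K2 * four_block_mat T1 (0\<^sub>m k m) (0\<^sub>m m k) F"
    and disj: "spectrum T1 \<inter> spectrum F = {}" by blast
  from K2 have "K2 \<in> carrier_mat (n + n) m" by (simp add: mult_2)
  from split_rows[OF this] obtain X2 Z2 where X2: "X2 \<in> carrier_mat n m" and Z2: "Z2 \<in> carrier_mat n m" and K2_eq: "K2 = X2 @\<^sub>r Z2" by metis
  note [simp] = carrier_matD[OF F] carrier_matD[OF X2] carrier_matD[OF Z2] carrier_matD[OF K]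
  define V T X where "V = append_cols K K2" and "T = four_block_mat T1 (0\<^sub>m k m) (0\<^sub>m m k) F" and "X = append_cols X1 X2"
  have Vc: "V \<in> carrier_mat (2 * n) (2 * n)" using K K2 km by (auto simp: V_def intro!: carrier_matI)
  have Tc: "T \<in> carrier_mat (2 * n) (2 * n)" using km by (auto simp: T_def intro!: carrier_matI)
  have Xc: "X \<in> carrier_mat n (2 * n)" using km by (auto simp: X_def intro!: carrier_matI)
  have V_split: "V = X @\<^sub>r append_cols (- (X1 * mat_inv T1)) Z2"
    unfolding V_def K_def K2_eq X_def by (rule eq_matI) (auto simp del: index_mult_mat(1))
  have "append_cols (- (X1 * mat_inv T1)) Z2 \<in> carrier_mat n (2 * n)" using km by (auto intro!: carrier_matI)
  note form = invariant_basis_form[OF Xc this Tc, folded V_split, OF Vinv[folded V_def] LV[folded V_def T_def]]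
  define S where "S = mat_inv V * J * star_mat st (mat_inv V)"
  note triple = triple_of_invariant_basis[OF Xc Tc form Vinv[folded V_def] LV[folded V_def T_def] S_def]
  note Vi = mat_inv[OF Vc Vinv[folded V_def]]
  note [simp] = carrier_matD[OF Vc] carrier_matD[OF Vi(1)]
  have "S \<in> carrier_mat (k + m) (k + m)" using triple(1) unfolding km .
  from split_four_block[OF this] obtain S1 S12 S21 S2 where
    bl: "S1 \<in> carrier_mat k k" "S12 \<in> carrier_mat k m" "S21 \<in> carrier_mat m k" "S2 \<in> carrier_mat m m"
    and S_eq: "S = four_block_mat S1 S12 S21 S2" by metis
  note [simp] = bl[THEN carrier_matD(1)] bl[THEN carrier_matD(2)]
  have Ts: "star_mat st T = four_block_mat (star_mat st T1) (0\<^sub>m k m) (0\<^sub>m m k) (star_mat st F)"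
    unfolding T_def by (subst star_mat_four_block) auto
  have "four_block_mat (T1 * S1 * star_mat st T1) (T1 * S12 * star_mat st F) (F * S21 * star_mat st T1) (F * S2 * star_mat st F)
      = T * S * star_mat st T"
    unfolding Ts unfolding T_def S_eq by (simp add: four_block_mult_dim matalg)
  also have "\<dots> = S" by (rule triple(4))
  also note S_eq
  finally have TST: "four_block_mat (T1 * S1 * star_mat st T1) (T1 * S12 * star_mat st F) (F * S21 * star_mat st T1) (F * S2 * star_mat st F)
      = four_block_mat S1 S12 S21 S2" .
  have TS1: "T1 * S1 * star_mat st T1 = S1"
    by (rule four_block_inject(1)[OF TST, of k k m m]) (auto intro!: carrier_matI)
  have TS12: "T1 * S12 * star_mat st F = S12"
    by (rule four_block_inject(2)[OF TST, of k k m m]) (auto intro!: carrier_matI)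
  have "star_mat st S = four_block_mat (star_mat st S1) (star_mat st S21) (star_mat st S12) (star_mat st S2)"
    unfolding S_eq by (subst star_mat_four_block) auto
  moreover have "(- eps) \<cdot>\<^sub>m S = four_block_mat ((- eps) \<cdot>\<^sub>m S1) ((- eps) \<cdot>\<^sub>m S12) ((- eps) \<cdot>\<^sub>m S21) ((- eps) \<cdot>\<^sub>m S2)"
    unfolding S_eq by (rule eq_matI) auto
  ultimately have SS: "four_block_mat (star_mat st S1) (star_mat st S21) (star_mat st S12) (star_mat st S2)
      = four_block_mat ((- eps) \<cdot>\<^sub>m S1) ((- eps) \<cdot>\<^sub>m S12) ((- eps) \<cdot>\<^sub>m S21) ((- eps) \<cdot>\<^sub>m S2)"
    using triple(3) by simp
  have S1_star: "star_mat st S1 = (- eps) \<cdot>\<^sub>m S1"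
    by (rule four_block_inject(1)[OF SS, of k k m m]) (auto intro!: carrier_matI)
  have S2_star: "star_mat st S2 = (- eps) \<cdot>\<^sub>m S2"
    by (rule four_block_inject(4)[OF SS, of k k m m]) (auto intro!: carrier_matI)
  have S12_star: "star_mat st S12 = (- eps) \<cdot>\<^sub>m S21"
    by (rule four_block_inject(3)[OF SS, of k k m m]) (auto intro!: carrier_matI)
  \<comment> \<open>As \<open>T1\<close> is similar to \<open>T1\<^sup>-\<^sup>\<star>\<close>, an eigenvalue common to \<open>T1\<^sup>-\<^sup>1\<close> and \<open>F\<^sup>\<star>\<close> would yield one common to \<open>T1\<close> and \<open>F\<close>.\<close>
  have S12_0: "S12 = 0\<^sub>m k m"
  proof (rule sylvester_zero[OF T1i(1) star_mat_carrier[OF F] _ bl(2)])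
    have "mat_inv T1 * (T1 * S12 * star_mat st F) = S12 * star_mat st F"
      by (simp add: matalg mult_cancel_left_dim[OF T1i(3)])
    then show "mat_inv T1 * S12 = S12 * star_mat st F" unfolding TS12 .
    have "star_scalar st x \<in> spectrum T1" if "x \<in> spectrum (mat_inv T1)" for x
      using that spectrum_star[OF T1i(1), of "star_scalar st x" st] spectrum_similar[OF sim] by simp
    then show "spectrum (mat_inv T1) \<inter> spectrum (star_mat st F) = {}"
      using disj spectrum_star[OF F] by auto
  qed
  have "S21 = (1 / (- eps)) \<cdot>\<^sub>m ((- eps) \<cdot>\<^sub>m S21)" using eps by (auto simp: smult_smult_assoc one_smult_mat)
  then have S21_0: "S21 = 0\<^sub>m m k" unfolding S12_star[symmetric] S12_0 by (simp add: smult_zero_mat)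
  have S_diag: "S = four_block_mat S1 (0\<^sub>m k m) (0\<^sub>m m k) S2" unfolding S_eq S12_0 S21_0 by (rule refl)
  have "det S = det S1 * det S2" unfolding S_diag
    by (rule det_four_block_mat_lower_left_zero) (use bl in auto)
  then have S1_inv: "invertible_mat S1" and S2_inv: "invertible_mat S2"
    using triple(2) invertible_mat_iff_det[OF triple(1)] invertible_mat_iff_det[OF bl(1)] invertible_mat_iff_det[OF bl(4)] by auto
  define B where "B = X1 * S1 * star_mat st X1"
  have B: "B \<in> carrier_mat n n" by (auto simp: B_def intro!: carrier_matI)
  have B_star: "star_mat st B = (- eps) \<cdot>\<^sub>m B" by (simp add: B_def starmat matalg S1_star)
  note [simp] = carrier_matD[OF B]
  have iso: "B + X2 * S2 * star_mat st X2 = 0\<^sub>m n n"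
    using triple(5) unfolding X_def S_diag B_def
    by (simp add: star_append_cols append_cols_mult_four_block append_cols_mult_append_rows matalg)
  have Omega_S2: "Omega_dims eps st n S1 \<and> Delta_factor eps st m S2 = Omega eps st n k S1"
  proof (cases st)
    case Transpose
    interpret vec_space "TYPE(complex)" m .
    have "rank S2 = m" using det_rank_iff[OF bl(4)] S2_inv invertible_mat_iff_det[OF bl(4)] by simp
    then show ?thesis unfolding Transpose by (simp add: m_def)
  next
    case ConjTranspose
    \<comment> \<open>A right inverse of the upper half \<open>X\<close> of \<open>V\<close>.\<close>
    define R where "R = mat_inv V * (1\<^sub>m n @\<^sub>r 0\<^sub>m n n)"
    have R: "R \<in> carrier_mat (k + m) n" using km by (auto simp: R_def intro!: carrier_matI)
    have "V * R = 1\<^sub>m n @\<^sub>r 0\<^sub>m n n" unfolding R_def by (rule mult_cancel_left_dim[OF Vi(2)]) auto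
    moreover have "V * R = (X * R) @\<^sub>r (append_cols (- (X1 * mat_inv T1)) Z2 * R)"
      unfolding V_split by (rule append_rows_mult) (use R Xc km in auto)
    ultimately have "(X * R) @\<^sub>r (append_cols (- (X1 * mat_inv T1)) Z2 * R) = 1\<^sub>m n @\<^sub>r 0\<^sub>m n n" by simp
    then have XR: "append_cols X1 X2 * R = 1\<^sub>m n" unfolding X_def by (rule append_rows_inject(1)) (use R in auto)
    from isotropic_inertia_complement[OF eps bl(1) _ S1_inv bl(4) _ S2_inv X1 X2 km R XR]
      S1_star S2_star iso ConjTranspose
    have "pos_inertia (csqrt (- eps) \<cdot>\<^sub>m S1) + pos_inertia (csqrt (- eps) \<cdot>\<^sub>m S2) = n"
      "neg_inertia (csqrt (- eps) \<cdot>\<^sub>m S1) + neg_inertia (csqrt (- eps) \<cdot>\<^sub>m S2) = n"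
      by (auto simp: B_def)
    then have "pos_inertia (csqrt (- eps) \<cdot>\<^sub>m S1) \<le> n" "neg_inertia (csqrt (- eps) \<cdot>\<^sub>m S1) \<le> n"
      "pos_inertia (csqrt (- eps) \<cdot>\<^sub>m S2) = n - pos_inertia (csqrt (- eps) \<cdot>\<^sub>m S1)"
      "neg_inertia (csqrt (- eps) \<cdot>\<^sub>m S2) = n - neg_inertia (csqrt (- eps) \<cdot>\<^sub>m S1)" by linarith+
    then show ?thesis unfolding ConjTranspose by (simp add: m_def)
  qed
  define \<Omega> where "\<Omega> = Omega eps st n k S1"
  note \<Omega> = Omega_properties[OF eps k bl(1) S1_star S1_inv conjunct1[OF Omega_S2], folded \<Omega>_def m_def]
  note [simp] = carrier_matD[OF \<Omega>(1)]
  obtain W where "is_Y_factor eps st m S2 W" using star_factorization(2)[OF eps bl(4) S2_star] by blast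
  note Wf = is_Y_factorD[OF this, unfolded conjunct2[OF Omega_S2], folded \<Omega>_def]
  note Wi = mat_inv[OF Wf(1,2)]
  note [simp] = carrier_matD[OF Wf(1)] carrier_matD[OF Wi(1)]
  define G where "G = four_block_mat (1\<^sub>m k) (0\<^sub>m k m) (0\<^sub>m m k) W"
  have one_inv: "invertible_mat (1\<^sub>m k :: complex mat)" "mat_inv (1\<^sub>m k) = 1\<^sub>m k"
    by (rule invertible_matI(1)[of _ k "1\<^sub>m k"]; simp) (rule mat_inv_unique[of _ k]; simp)
  note Gi = block_diag_inverse[OF one_carrier_mat Wf(1) one_inv(1) Wf(2), folded G_def, unfolded one_inv(2)]
  have Gc: "G \<in> carrier_mat (2 * n) (2 * n)" using km by (auto simp: G_def intro!: carrier_matI)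
  note Gi' = mat_inv[OF Gc Gi(1)]
  note [simp] = carrier_matD[OF Gc] carrier_matD[OF Gi'(1)] carrier_matD[OF Xc] carrier_matD[OF Tc]
  define T2 where "T2 = mat_inv W * F * W"
  have T2: "T2 \<in> carrier_mat m m" by (auto simp: T2_def intro!: carrier_matI)
  note [simp] = carrier_matD[OF T2]
  define T' where "T' = four_block_mat T1 (0\<^sub>m k m) (0\<^sub>m m k) T2"
  have T'c: "T' \<in> carrier_mat (2 * n) (2 * n)" using km by (auto simp: T'_def intro!: carrier_matI)
  note [simp] = carrier_matD[OF T'c]
  have GT: "G * T' = T * G"
    unfolding G_def T'_def T_def
    by (simp add: four_block_mult_dim matalg T2_def mult_cancel_left_dim[OF Wi(2)])
  define X' where "X' = append_cols X1 (X2 * W)"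
  have XG: "X * G = X'" unfolding X_def G_def X'_def by (simp add: append_cols_mult_four_block matalg)
  have X'c: "X' \<in> carrier_mat n (2 * n)" using km by (auto simp: X'_def intro!: carrier_matI)
  define Z' where "Z' = append_cols (- (X1 * mat_inv T1)) Z2 * G"
  have Z'c: "Z' \<in> carrier_mat n (2 * n)" by (auto simp: Z'_def intro!: carrier_matI)
  have VG: "V * G = X' @\<^sub>r Z'"
    unfolding V_split Z'_def XG[symmetric] by (rule append_rows_mult) (use km in auto)
  have VGc: "V * G \<in> carrier_mat (2 * n) (2 * n)" using Vc Gc by simp
  have VG_inv: "invertible_mat (V * G)" by (rule invertible_mat_mult[OF Vc Gc Vinv[folded V_def] Gi(1)])
  have "L * (V * G) = (L * V) * G" by (simp add: matalg)
  also have "\<dots> = V * (T * G)" unfolding LV[folded V_def T_def] by (simp add: matalg)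
  also have "\<dots> = (V * G) * T'" unfolding GT[symmetric] by (simp add: matalg)
  finally have LVG: "L * (V * G) = (V * G) * T'" .
  note form' = invariant_basis_form[OF X'c Z'c T'c, folded VG, OF VG_inv LVG]
  define S' where "S' = mat_inv (V * G) * J * star_mat st (mat_inv (V * G))"
  note triple' = triple_of_invariant_basis[OF X'c T'c form' VG_inv LVG S'_def]
  have VG_i: "mat_inv (V * G) = mat_inv G * mat_inv V"
  proof (rule mat_inv_unique[OF VGc])
    show "mat_inv G * mat_inv V \<in> carrier_mat (2 * n) (2 * n)" by (auto intro!: carrier_matI)
    show "V * G * (mat_inv G * mat_inv V) = 1\<^sub>m (2 * n)"
      by (simp add: matalg mult_cancel_left_dim[OF Gi'(2)] Vi)
  qed
  have S'_eq: "S' = four_block_mat S1 (0\<^sub>m k m) (0\<^sub>m m k) \<Omega>"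
  proof -
    have "S' = mat_inv G * S * star_mat st (mat_inv G)"
      unfolding S'_def VG_i S_def by (simp add: starmat matalg)
    also have "star_mat st (mat_inv G) = four_block_mat (1\<^sub>m k) (0\<^sub>m k m) (0\<^sub>m m k) (star_mat st (mat_inv W))"
      unfolding Gi(2) by (subst star_mat_four_block) auto
    also have "mat_inv G * S * \<dots> = four_block_mat S1 (0\<^sub>m k m) (0\<^sub>m m k) (mat_inv W * S2 * star_mat st (mat_inv W))"
      unfolding Gi(2) S_diag by (simp add: four_block_mult_dim matalg)
    also have "mat_inv W * S2 * star_mat st (mat_inv W) = \<Omega>"
    proof -
      have "star_mat st W * star_mat st (mat_inv W) = star_mat st (mat_inv W * W)" by (simp add: star_mat_mult)
      also have "\<dots> = 1\<^sub>m m" unfolding Wi by simp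
      finally have e: "star_mat st W * star_mat st (mat_inv W) = 1\<^sub>m m" .
      show ?thesis by (subst Wf(3)) (simp add: matalg e mult_cancel_left_dim[OF Wi(3)])
    qed
    finally show ?thesis .
  qed
  have X's: "star_mat st X' = star_mat st X1 @\<^sub>r (star_mat st (X2 * W))"
    unfolding X'_def by (simp add: star_append_cols)
  have iso': "B + X2 * W * \<Omega> * star_mat st (X2 * W) = 0\<^sub>m n n"
    using triple'(5) unfolding X's unfolding X'_def S'_eq B_def
    by (simp add: append_cols_mult_four_block append_cols_mult_append_rows matalg)
  have "det T' = det T1 * det T2" unfolding T'_def
    by (rule det_four_block_mat_lower_left_zero) (use T1 T2 in auto)
  then have T2_inv: "invertible_mat T2"
    using form'(1) invertible_mat_iff_det[OF T'c] invertible_mat_iff_det[OF T2] by auto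
  note T'i = block_diag_inverse(2)[OF T1(1) T2 T1(2) T2_inv, folded T'_def]
  note T2i = mat_inv[OF T2 T2_inv]
  note [simp] = carrier_matD[OF T2i(1)]
  have T2\<Omega>: "T2 * \<Omega> * star_mat st T2 = \<Omega>"
  proof -
    have "star_mat st T' = four_block_mat (star_mat st T1) (0\<^sub>m k m) (0\<^sub>m m k) (star_mat st T2)"
      unfolding T'_def by (subst star_mat_four_block) auto
    then have "T' * S' * star_mat st T' = four_block_mat (T1 * S1 * star_mat st T1) (0\<^sub>m k m) (0\<^sub>m m k) (T2 * \<Omega> * star_mat st T2)"
      unfolding T'_def S'_eq by (simp add: four_block_mult_dim matalg)
    then have "four_block_mat (T1 * S1 * star_mat st T1) (0\<^sub>m k m) (0\<^sub>m m k) (T2 * \<Omega> * star_mat st T2) = four_block_mat S1 (0\<^sub>m k m) (0\<^sub>m m k) \<Omega>"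
      using triple'(4) S'_eq by simp
    then show ?thesis by (rule four_block_inject(4)[of _ _ _ _ _ _ _ _ k k m m]) (auto intro!: carrier_matI)
  qed
  have "similar_mat T2 F"
    by (rule similar_matI[of _ _ "mat_inv W" W m]) (use T2 F Wf(1) Wi in \<open>auto simp: T2_def\<close>)
  then have disj': "spectrum T1 \<inter> spectrum T2 = {}" using disj spectrum_similar by blast
  show ?thesis
  proof (rule exI[of _ S1], intro conjI allI impI)
    show "\<exists>Y. is_Y_factor eps st n (X1 * S1 * star_mat st X1) Y"
      using star_factorization(2)[OF eps B B_star] unfolding B_def .
    fix Y assume Y: "is_Y_factor eps st n (X1 * S1 * star_mat st X1) Y"
    note Yf = is_Y_factorD[OF Y, folded B_def]
    note Yi = mat_inv[OF Yf(1,2)]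
    define \<Delta> where "\<Delta> = Delta_factor eps st n B"
    have \<Delta>: "\<Delta> \<in> carrier_mat n n" unfolding \<Delta>_def by (rule star_factorization(1)[OF eps B B_star])
    note [simp] = carrier_matD[OF Yf(1)] carrier_matD[OF Yi(1)] carrier_matD[OF \<Delta>]
    define Psi where "Psi = mat_inv Y * (X2 * W)"
    have Psi: "Psi \<in> carrier_mat n m" by (auto simp: Psi_def intro!: carrier_matI)
    note [simp] = carrier_matD[OF Psi]
    have YPsi: "Y * Psi = X2 * W" unfolding Psi_def by (rule mult_cancel_left_dim[OF Yi(2)]) auto
    have Psi\<Omega>: "Psi * \<Omega> * star_mat st Psi = - \<Delta>"
    proof -
      have "star_mat st Y * star_mat st (mat_inv Y) = star_mat st (mat_inv Y * Y)" by (simp add: star_mat_mult)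
      also have "\<dots> = 1\<^sub>m n" unfolding Yi by simp
      finally have e: "star_mat st Y * star_mat st (mat_inv Y) = 1\<^sub>m n" .
      have "X2 * W * \<Omega> * star_mat st (X2 * W) \<in> carrier_mat n n" by (auto intro!: carrier_matI)
      then have "X2 * W * \<Omega> * star_mat st (X2 * W) + (- (- B)) = 0\<^sub>m n n"
        using iso' comm_add_mat[OF B] by simp
      then have "X2 * W * \<Omega> * star_mat st (X2 * W) = - B" by (rule add_uminus_eq_zeroD) auto
      then have *: "X2 * W * \<Omega> * star_mat st (X2 * W) = - (Y * \<Delta> * star_mat st Y)" unfolding \<Delta>_def using Yf(3) by simp
      have "Psi * \<Omega> * star_mat st Psi = mat_inv Y * (X2 * W * \<Omega> * star_mat st (X2 * W)) * star_mat st (mat_inv Y)"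
        unfolding Psi_def by (simp add: starmat matalg)
      also have "\<dots> = - \<Delta>" unfolding * by (simp add: matalg e mult_cancel_left_dim[OF Yi(3)])
      finally show ?thesis .
    qed
    have X'_eq: "append_cols X1 (Y * Psi) = X'" unfolding YPsi X'_def by (rule refl)
    have T'_eq: "diag_block_mat [T1, T2] = T'" unfolding T'_def diag_block_mat_two by simp
    have S'_eq': "diag_block_mat [S1, Omega eps st n k S1] = S'" unfolding S'_eq \<Omega>_def[symmetric] diag_block_mat_two by simp
    have "X' * mat_inv T' * S' * star_mat st X' = X1 * mat_inv T1 * S1 * star_mat st X1
        + X2 * W * mat_inv T2 * \<Omega> * star_mat st (X2 * W)"
      unfolding X's T'i unfolding X'_def S'_eq
      by (simp add: append_cols_mult_four_block append_cols_mult_append_rows matalg)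
    also have "X2 * W * mat_inv T2 * \<Omega> * star_mat st (X2 * W) = Y * Psi * mat_inv T2 * \<Omega> * star_mat st Psi * star_mat st Y"
      unfolding YPsi[symmetric] by (simp add: starmat matalg)
    finally have M: "invertible_mat (X1 * mat_inv T1 * S1 * star_mat st X1 + Y * Psi * mat_inv T2 * \<Omega> * star_mat st Psi * star_mat st Y)"
      using triple'(6) by simp
    have "iep_parameters eps st n k X1 T1 S1 Y Psi T2"
      unfolding iep_parameters_def Let_def S_set_def \<Omega>_def[symmetric] B_def[symmetric] \<Delta>_def[symmetric] m_def[symmetric]
      using bl(1) S1_star TS1 S1_inv Y Psi T2 Omega_S2 T2\<Omega> disj' Psi\<Omega> M by (auto simp: B_def)
    then show "\<exists>Psi T2. iep_parameters eps st n k X1 T1 S1 Y Psi T2 \<and>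
        (let X = append_cols X1 (Y * Psi); T = diag_block_mat [T1, T2];
             S = diag_block_mat [S1, Omega eps st n k S1]
         in A1 = coeff_A1 eps st X T S \<and> A0 = coeff_A0 eps st X T S)"
      using triple'(7,8) by (intro exI[of _ Psi] exI[of _ T2]) (simp add: Let_def X'_eq T'_eq S'_eq' del: diag_block_mat.simps)
  qed
qed

end

theorem theorem3p4:
  fixes eps :: complex and st :: star and n k :: nat and X1 T1 :: "complex mat"
  assumes "eps \<in> {1, -1}"
    and "1 \<le> k" and "k < 2 * n"
    and "X1 \<in> carrier_mat n k" and "T1 \<in> carrier_mat k k"
    and "invertible_mat T1"
    and "vec_space.rank (2 * n) (X1 @\<^sub>r (- (X1 * mat_inv T1))) = k"
    and "similar_mat T1 (star_mat st (mat_inv T1))"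
  shows
    "((\<exists>A1 A0. regular_iep_solution eps st n X1 T1 A1 A0) \<longleftrightarrow>
      (\<exists>S1 Y Psi T2. iep_parameters eps st n k X1 T1 S1 Y Psi T2))
   \<and> (\<forall>S1 Y Psi T2. iep_parameters eps st n k X1 T1 S1 Y Psi T2 \<longrightarrow>
        (let X = append_cols X1 (Y * Psi);
             T = diag_block_mat [T1, T2];
             S = diag_block_mat [S1, Omega eps st n k S1]
         in regular_iep_solution eps st n X1 T1 (coeff_A1 eps st X T S) (coeff_A0 eps st X T S)))
   \<and> (\<forall>A1 A0. regular_iep_solution eps st n X1 T1 A1 A0 \<longrightarrow>
        (\<exists>S1. (\<exists>Y. is_Y_factor eps st n (X1 * S1 * star_mat st X1) Y) \<and>
           (\<forall>Y. is_Y_factor eps st n (X1 * S1 * star_mat st X1) Y \<longrightarrow>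
             (\<exists>Psi T2. iep_parameters eps st n k X1 T1 S1 Y Psi T2 \<and>
               (let X = append_cols X1 (Y * Psi);
                    T = diag_block_mat [T1, T2];
                    S = diag_block_mat [S1, Omega eps st n k S1]
                in A1 = coeff_A1 eps st X T S \<and> A0 = coeff_A0 eps st X T S)))))"
    (is "?equiv \<and> ?sufficient \<and> ?necessary")
proof -
  have k: "k \<le> 2 * n" using assms(3) by simp
  have sufficient: ?sufficient
    using solution_of_parameters[OF assms(1) k assms(4-6)] by (simp only: Let_def) blast
  have necessary: ?necessary
  proof (intro allI impI)
    fix A1 A0 assume sol: "regular_iep_solution eps st n X1 T1 A1 A0"
    then interpret regular_palindromic eps st n A1 A0
      using assms(1) by unfold_locales (auto simp: regular_iep_solution_def iep_solution_def palindromic_system_def)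
    show "\<exists>S1. (\<exists>Y. is_Y_factor eps st n (X1 * S1 * star_mat st X1) Y) \<and>
           (\<forall>Y. is_Y_factor eps st n (X1 * S1 * star_mat st X1) Y \<longrightarrow>
             (\<exists>Psi T2. iep_parameters eps st n k X1 T1 S1 Y Psi T2 \<and>
               (let X = append_cols X1 (Y * Psi);
                    T = diag_block_mat [T1, T2];
                    S = diag_block_mat [S1, Omega eps st n k S1]
                in A1 = coeff_A1 eps st X T S \<and> A0 = coeff_A0 eps st X T S)))"
      by (rule parameters_of_solution[OF k assms(4-8)]) (use sol in \<open>simp add: regular_iep_solution_def\<close>)
  qed
  have ?equiv
  proof
    assume "\<exists>A1 A0. regular_iep_solution eps st n X1 T1 A1 A0"
    then obtain A1 A0 where "regular_iep_solution eps st n X1 T1 A1 A0" by blast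
    from necessary[rule_format, OF this] show "\<exists>S1 Y Psi T2. iep_parameters eps st n k X1 T1 S1 Y Psi T2" by blast
  next
    assume "\<exists>S1 Y Psi T2. iep_parameters eps st n k X1 T1 S1 Y Psi T2"
    then obtain S1 Y Psi T2 where "iep_parameters eps st n k X1 T1 S1 Y Psi T2" by blast
    from sufficient[rule_format, OF this] show "\<exists>A1 A0. regular_iep_solution eps st n X1 T1 A1 A0"
      unfolding Let_def by blast
  qed
  then show ?thesis using sufficient necessary by blast
qed

end
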